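(* Let $B$ be a commutative $k$-algebra and let $(A,B,C,\psi,\zeta)$ be an entwining structure over $B$. Then: (a) The cup products $\cup$ and $\sqcup$ on the complex $\mathscr E_\psi^\bullet(A,B,C,\zeta)$ coincide. (b) $\mathscr E_\psi^\bullet(A,B,C,\zeta)$, with the operations $\Diamond_i$ and the element $\alpha$ described in the context, is a right comp algebra over $k$. (c) The cohomology $(H^\bullet(\mathscr E_\psi^\bullet(A,B,C,\zeta)),\cup,[.,.])$ carries the structure of a Gerstenhaber algebra, where $\cup$ and $[.,.]$ are induced by $f\cup g=(\alpha\Diamond_0f)\Diamond_mg$ and $[f,g]=f\Diamond g-(-1)^{(m-1)(n-1)}g\Diamond f$ with $f\Diamond g=\sum_{i\ge0}(-1)^{i(n-1)}f\Diamond_ig$, for $f\in\mathscr E^m_\psi(A,B,C,\zeta)$, $g\in\mathscr E^n_\psi(A,B,C,\zeta)$.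
   Context: Conventions: $k$ is a field; $\otimes$ and $\mathrm{Hom}$ are over $k$; $A$ is a unital associative $k$-algebra; $C\neq 0$ is a $k$-coalgebra with coproduct $\Delta(c)=c_1\otimes c_2$ (summation suppressed) and counit $\varepsilon$. For a linear map $\psi:C\otimes A\to A\otimes C$ write $\psi(c\otimes a)=a_\psi\otimes c^\psi$ (summation suppressed). Entwining structure over $k$: a triple $(A,C,\psi)$ with $\psi:C\otimes A\to A\otimes C$ linear such that for all $a,b\in A$, $c\in C$: $(ab)_\psi\otimes c^\psi=a_\psi b_\psi\otimes {c^\psi}^\psi$ [i.e. $\psi\circ(1\otimes\mu)=(\mu\otimes 1)(1\otimes\psi)(\psi\otimes 1)$]; $a_\psi\otimes\Delta(c^\psi)={a_\psi}_\psi\otimes c_1^\psi\otimes c_2^\psi$ [i.e. $(1\otimes\Delta)\psi=(\psi\otimes1)(1\otimes\psi)(\Delta\otimes 1)$]; $a_\psi\varepsilon(c^\psi)=\varepsilon(c)a$; $1_\psi\otimes c^\psi=1\otimes c$. Entwining structure over a commutative $k$-algebra $B$: a tuple $(A,B,C,\psi,\zeta)$ with $(A,C,\psi)$ an entwining structure over $k$ and $\zeta:B\to A$ a $k$-algebra morphism with $\zeta(B)\subseteq Z(A)$ and $\psi(c\otimes\zeta(b))=\zeta(b)\otimes c$ for all $b\in B,c\in C$. Tensor matrices: an element of $C\otimes A^{\otimes n}\otimes B^{\otimes n(n-1)/2}$ is written $c\otimes T$, where $T$ is an $n\times n$ upper triangular array with diagonal entries $a_i\in A$, entries $b_{ij}\in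 B$ in position $(i,j)$ for $i<j$, and $1$ below the diagonal. Passing $c$ successively past $a_1,\dots,a_i$ by $\psi$ is denoted $c\otimes a_1\otimes\cdots\otimes a_i\mapsto a_{1\psi}\otimes\cdots\otimes a_{i\psi}\otimes c^{\psi^i}$. For $T$ of size $m$, $T_\psi\otimes c^{\psi^m}$ denotes the result of passing $c$ past all diagonal entries, so $T_\psi$ has diagonal $a_{1\psi},\dots,a_{m\psi}$ and the same $b_{ij}$. Empty products equal $1$. Complex: $\mathscr C^n_\psi=\mathscr C^n_\psi(A,B,C,\zeta)=\mathrm{Hom}(C\otimes A^{\otimes n}\otimes B^{\otimes n(n-1)/2},A)$ for $n\ge0$ (and $0$ for $n<0$), with differential, for $T$ of size $n+1$, $$\delta^n(f)(c\otimes T)=\zeta\Big(\prod_{j=2}^{n+1}b_{1j}\Big)a_{1\psi}f(c^\psi\otimes T^{(0)})+\sum_{i=1}^n(-1)^if(c\otimes T^{(i)})+(-1)^{n+1}\zeta\Big(\prod_{r=1}^{n}b_{r,n+1}\Big)f(c\otimes T^{(n+1)})a_{n+1},$$ where $T^{(0)}$ (resp. $T^{(n+1)}$) is $T$ with first (resp. last) row and column deleted, and $T^{(i)}$, $1\le i\le n$, is obtained by merging indices $i,i+1$: the merged diagonal entry is $\zeta(b_{i,i+1})a_ia_{i+1}$, for $r<i$ the entry joining $r$ to the merged index is $b_{ri}b_{r,i+1}$, for $s>i+1$ the entry joining the merged index to $s$ is $b_{is}b_{i+1,s}$, other entries unchanged. Operations $\Diamond_i$: for $f\in\mathscr C^m_\psi$,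 $g\in\mathscr C^n_\psi$, $0\le i\le m-1$ and $T$ of size $m+n-1$, let $I=\{1,\dots,i\}$, $J=\{i+1,\dots,i+n\}$, $K=\{i+n+1,\dots,m+n-1\}$, and let $T_J$ be the submatrix of $T$ with rows and columns in $J$. Then $(f\Diamond_ig)(c\otimes T)=f(c_1\otimes T')$, where $T'$ is the tensor matrix of size $m$ with diagonal entries $a_{1\psi},\dots,a_{i\psi},\ g(c_2^{\psi^i}\otimes T_J),\ a_{i+n+1},\dots,a_{m+n-1}$ and off-diagonal entries: $b_{rs}$ for $r<s$ in $I\cup K$; $\prod_{s\in J}b_{rs}$ between $r\in I$ and the $(i+1)$-st place; $\prod_{r\in J}b_{rs}$ between the $(i+1)$-st place and $s\in K$. For $i\ge m$, $f\Diamond_ig=0$. The element $\alpha\in\mathscr C^2_\psi$ is $\alpha\left(c\otimes\begin{pmatrix}a_1&b_{12}\\1&a_2\end{pmatrix}\right)=\varepsilon(c)\zeta(b_{12})a_1a_2$. Cup products on cochains: for $f\in\mathscr C^m_\psi$, $g\in\mathscr C^n_\psi$ and $T$ of size $m+n$, let $T'$ be the upper left $m\times m$ block, $T''$ the lower right $n\times n$ block, $\beta=\prod_{r\le m<s}b_{rs}$. Then $(f\cup g)(c\otimes T)=\zeta(\beta)f(c_1\otimes T'_\psi)\,g(c_2^{\psi^m}\otimes T'')$ and $(f\sqcup g)(c\otimes T)=\zeta(\beta)f(c_2\otimes T')_\psi\,g(c_1^\psi\otimes T'')$. Equivariant subcomplex: $\mathscr E^n_\psi(A,B,C,\zeta)\subseteq\mathscr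 C^n_\psi(A,B,C,\zeta)$ consists of those $f$ with $(f\otimes \mathrm{id})\circ\rho^n_R=\psi\circ(\mathrm{id}\otimes f)\circ\rho^n_L$, where $\rho^n_L(c\otimes T)=c_1\otimes(c_2\otimes T)$ and $\rho^n_R(c\otimes T)=(c_1\otimes T_\psi)\otimes c_2^{\psi^n}$; i.e. $f(c_1\otimes T_\psi)\otimes c_2^{\psi^n}=f(c_2\otimes T)_\psi\otimes c_1^\psi$ in $A\otimes C$. It carries the restrictions of $\delta$, $\Diamond_i$, $\cup$, $\sqcup$. Right comp algebra $(V^\bullet,\Diamond,\alpha)$ over $k$: a graded vector space $V=\bigoplus_{i\ge0}V^i$, an element $\alpha\in V^2$, and operations $\Diamond_i:V^m\otimes V^n\to V^{m+n-1}$, $i\ge0$, such that for $f\in V^m,g\in V^n,h\in V^p$: (1) $f\Diamond_ig=0$ if $i>m-1$; (2) $(f\Diamond_ig)\Diamond_jh=(f\Diamond_jh)\Diamond_{i+p-1}g$ if $j<i$; (3) $(f\Diamond_ig)\Diamond_jh=f\Diamond_i(g\Diamond_{j-i}h)$ if $i\le j<n+i$; (4) $(f\Diamond_ig)\Diamond_jh=(f\Diamond_{j-n+1}h)\Diamond_ig$ if $j\ge n+i$; (5) $\alpha\Diamond_0\alpha=\alpha\Diamond_1\alpha$. Gerstenhaber algebra $(V,\cup,[.,.])$ over $k$: a graded vector space $V=\bigoplus_{i\ge0}V^i$ with a product $\cup:V^m\otimes V^n\to V^{m+n}$ making $V$ a graded commutative (associative) algebra, a bracket $[.,.]:V^m\otimes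 V^n\to V^{m+n-1}$ of degree $-1$ making $V$ a graded Lie algebra (with respect to the degree shifted by one), and such that the bracket is a graded derivation for the cup product: $[f\cup g,h]=[f,h]\cup g+(-1)^{m(p-1)}f\cup[g,h]$ for $f\in V^m,g\in V^n,h\in V^p$. *)

theory Defs
  imports Complex_Main "HOL-Library.Function_Algebras" "HOL-Algebra.Module" "HOL-Algebra.AbelCoset"
begin

section \<open>Tensor products over a field\<close>

text \<open>
  Vector spaces over a field are types of class \<open>ab_group_add\<close> with a scalar multiplication
  satisfying \<open>vector_space\<close>.  A pure tensor is the evaluation functional on bilinear forms;
  over a field, the tensor product of \<open>V\<close> and \<open>W\<close> is the space of finite sums of these
  functionals inside the dual of the space of bilinear forms on \<open>V \<times> W\<close>.
  The lemmas \<open>tensor_lift_sum\<close> and \<open>tensor_lift_unique\<close> below give its universal property;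
  \<open>tens3_sum_eqD\<close> is the corresponding statement for threefold tensor products.
  Linear maps out of a tensor product are written as bilinear (multilinear) maps.
\<close>

definition bilin ::
  "('k::field \<Rightarrow> 'v::ab_group_add \<Rightarrow> 'v) \<Rightarrow> ('k \<Rightarrow> 'w::ab_group_add \<Rightarrow> 'w) \<Rightarrow>
   ('k \<Rightarrow> 'u::ab_group_add \<Rightarrow> 'u) \<Rightarrow> ('v \<Rightarrow> 'w \<Rightarrow> 'u) \<Rightarrow> bool"
  where "bilin s t u \<beta> \<longleftrightarrow>
    (\<forall>x. Vector_Spaces.linear t u (\<lambda>y. \<beta> x y)) \<and> (\<forall>y. Vector_Spaces.linear s u (\<lambda>x. \<beta> x y))"

definition trilin ::
  "('k::field \<Rightarrow> 'v::ab_group_add \<Rightarrow> 'v) \<Rightarrow> ('k \<Rightarrow> 'w::ab_group_add \<Rightarrow> 'w) \<Rightarrow>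
   ('k \<Rightarrow> 'x::ab_group_add \<Rightarrow> 'x) \<Rightarrow> ('k \<Rightarrow> 'u::ab_group_add \<Rightarrow> 'u) \<Rightarrow> ('v \<Rightarrow> 'w \<Rightarrow> 'x \<Rightarrow> 'u) \<Rightarrow> bool"
  where "trilin s t r u \<beta> \<longleftrightarrow>
    (\<forall>x. bilin t r u (\<lambda>y z. \<beta> x y z)) \<and> (\<forall>y z. Vector_Spaces.linear s u (\<lambda>x. \<beta> x y z))"

type_synonym ('k, 'v, 'w) tensor = "('v \<Rightarrow> 'w \<Rightarrow> 'k) \<Rightarrow> 'k"
type_synonym ('k, 'v, 'w, 'x) tensor3 = "('v \<Rightarrow> 'w \<Rightarrow> 'x \<Rightarrow> 'k) \<Rightarrow> 'k"

definition tens ::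
  "('k::field \<Rightarrow> 'v::ab_group_add \<Rightarrow> 'v) \<Rightarrow> ('k \<Rightarrow> 'w::ab_group_add \<Rightarrow> 'w) \<Rightarrow>
   'v \<Rightarrow> 'w \<Rightarrow> ('k, 'v, 'w) tensor"
  where "tens s t x y = (\<lambda>\<beta>. if bilin s t (*) \<beta> then \<beta> x y else 0)"

definition tens3 ::
  "('k::field \<Rightarrow> 'v::ab_group_add \<Rightarrow> 'v) \<Rightarrow> ('k \<Rightarrow> 'w::ab_group_add \<Rightarrow> 'w) \<Rightarrow>
   ('k \<Rightarrow> 'x::ab_group_add \<Rightarrow> 'x) \<Rightarrow> 'v \<Rightarrow> 'w \<Rightarrow> 'x \<Rightarrow> ('k, 'v, 'w, 'x) tensor3"
  where "tens3 s t r x y z = (\<lambda>\<beta>. if trilin s t r (*) \<beta> then \<beta> x y z else 0)"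

definition scale_tensor :: "'k::field \<Rightarrow> ('b \<Rightarrow> 'k) \<Rightarrow> ('b \<Rightarrow> 'k)"
  where "scale_tensor l u = (\<lambda>\<beta>. l * u \<beta>)"

definition tensor_space ::
  "('k::field \<Rightarrow> 'v::ab_group_add \<Rightarrow> 'v) \<Rightarrow> ('k \<Rightarrow> 'w::ab_group_add \<Rightarrow> 'w) \<Rightarrow> ('k, 'v, 'w) tensor set"
  where "tensor_space s t = range (\<lambda>xs. \<Sum>(x, y)\<leftarrow>xs. tens s t x y)"

text \<open>The linear map on the tensor product induced by a bilinear map \<open>\<beta>\<close>, evaluated at \<open>u\<close>.
  With \<open>u\<close> a value of a coproduct or of an entwining map, this renders Sweedler-type notation:
  \<open>tensor_lift s t \<beta> u\<close> is the sum of \<open>\<beta> u\<^sub>1 u\<^sub>2\<close>, where \<open>u\<close> is the sum of \<open>u\<^sub>1 \<otimes> u\<^sub>2\<close>.\<close>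

definition tensor_lift ::
  "('k::field \<Rightarrow> 'v::ab_group_add \<Rightarrow> 'v) \<Rightarrow> ('k \<Rightarrow> 'w::ab_group_add \<Rightarrow> 'w) \<Rightarrow>
   ('v \<Rightarrow> 'w \<Rightarrow> 'u::ab_group_add) \<Rightarrow> ('k, 'v, 'w) tensor \<Rightarrow> 'u"
  where "tensor_lift s t \<beta> u =
    (\<Sum>(x, y)\<leftarrow>(SOME xs. u = (\<Sum>(x, y)\<leftarrow>xs. tens s t x y)). \<beta> x y)"

lemma linear_functional_separates:
  fixes u :: "'k::field \<Rightarrow> 'u::ab_group_add \<Rightarrow> 'u"
  assumes "vector_space u" "r \<noteq> 0"
  shows "\<exists>\<phi>. Vector_Spaces.linear u (*) \<phi> \<and> \<phi> r \<noteq> 0"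
proof -
  have kv: "vector_space ((*) :: 'k \<Rightarrow> 'k \<Rightarrow> 'k)"
    by unfold_locales (auto simp: algebra_simps)
  interpret vector_space_pair u "(*) :: 'k \<Rightarrow> 'k \<Rightarrow> 'k"
    using assms kv by (simp add: vector_space_pair_def)
  have ind: "vs1.independent {r}"
    using assms(2) by simp
  have "Vector_Spaces.linear u (*) (construct {r} (\<lambda>_. 1))"
    by (rule linear_construct[OF ind])
  moreover have "construct {r} (\<lambda>_. 1) r = 1"
    by (rule construct_basis[OF ind]) simp
  ultimately show ?thesis by (intro exI[of _ "construct {r} (\<lambda>_. 1)"]) auto
qed

lemma sum_list_fun_apply:
  "(\<Sum>p\<leftarrow>xs. F p) \<beta> = (\<Sum>p\<leftarrow>xs. F p \<beta>)" for F :: "'p \<Rightarrow> 'b \<Rightarrow> 'k::comm_monoid_add"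
  by (induction xs) auto

lemma linear_sum_list:
  assumes "Vector_Spaces.linear s t \<phi>"
  shows "\<phi> (\<Sum>p\<leftarrow>xs. F p) = (\<Sum>p\<leftarrow>xs. \<phi> (F p))"
proof -
  interpret Vector_Spaces.linear s t \<phi> by fact
  show ?thesis by (induction xs) (auto simp: add zero)
qed

lemma linear_comp:
  assumes "Vector_Spaces.linear s t f" "Vector_Spaces.linear t u g"
  shows "Vector_Spaces.linear s u (\<lambda>x. g (f x))"
  using Vector_Spaces.linear_compose[OF assms] by (simp add: o_def)

lemma tens_sum_eqD:
  assumes eq: "(\<Sum>(x, y)\<leftarrow>xs. tens s t x y) = (\<Sum>(x, y)\<leftarrow>ys. tens s t x y)"
    and b: "bilin s t u \<beta>"
  shows "(\<Sum>(x, y)\<leftarrow>xs. \<beta> x y) = (\<Sum>(x, y)\<leftarrow>ys. \<beta> x y)"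
proof (rule ccontr)
  have vs: "vector_space u"
    using b by (auto simp: bilin_def Vector_Spaces.linear_def)
  let ?d = "(\<Sum>(x, y)\<leftarrow>xs. \<beta> x y) - (\<Sum>(x, y)\<leftarrow>ys. \<beta> x y)"
  assume "\<not> ?thesis"
  then obtain \<phi> where \<phi>: "Vector_Spaces.linear u (*) \<phi>" "\<phi> ?d \<noteq> 0"
    using linear_functional_separates[OF vs, of ?d] by auto
  interpret Vector_Spaces.linear u "(*)" \<phi> by (fact \<phi>(1))
  have b': "bilin s t (*) (\<lambda>x y. \<phi> (\<beta> x y))"
    using b by (auto simp: bilin_def intro!: linear_comp[OF _ \<phi>(1)])
  have "(\<Sum>(x, y)\<leftarrow>zs. tens s t x y) (\<lambda>x y. \<phi> (\<beta> x y)) = \<phi> (\<Sum>(x, y)\<leftarrow>zs. \<beta> x y)" for zs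
    using b' by (simp add: sum_list_fun_apply linear_sum_list[OF \<phi>(1)] tens_def split_def)
  then have "\<phi> (\<Sum>(x, y)\<leftarrow>xs. \<beta> x y) = \<phi> (\<Sum>(x, y)\<leftarrow>ys. \<beta> x y)"
    using eq by metis
  then show False using \<phi>(2) by (simp add: diff)
qed

lemma tensor_lift_sum:
  assumes "bilin s t u \<beta>"
  shows "tensor_lift s t \<beta> (\<Sum>(x, y)\<leftarrow>xs. tens s t x y) = (\<Sum>(x, y)\<leftarrow>xs. \<beta> x y)"
  unfolding tensor_lift_def
  by (rule tens_sum_eqD[OF _ assms, symmetric]) (rule someI, rule refl)

lemma bilin_tens:
  assumes "vector_space s" "vector_space t"
  shows "bilin s t scale_tensor (tens s t)"
proof -
  have kv: "vector_space (scale_tensor :: 'a \<Rightarrow> ('a, 'b, 'c) tensor \<Rightarrow> ('a, 'b, 'c) tensor)"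
    by unfold_locales (auto simp: scale_tensor_def algebra_simps fun_eq_iff)
  have m: "\<beta> x (y + y') = \<beta> x y + \<beta> x y'" "\<beta> x (t l y) = l * \<beta> x y"
     "\<beta> (x + x') y = \<beta> x y + \<beta> x' y" "\<beta> (s l x) y = l * \<beta> x y"
    if "bilin s t (*) \<beta>" for \<beta> x x' y y' l
  proof -
    interpret a: Vector_Spaces.linear t "(*)" "\<lambda>y. \<beta> x y" using that by (auto simp: bilin_def)
    interpret b: Vector_Spaces.linear s "(*)" "\<lambda>x. \<beta> x y" using that by (auto simp: bilin_def)
    show "\<beta> x (y + y') = \<beta> x y + \<beta> x y'" "\<beta> x (t l y) = l * \<beta> x y"
     "\<beta> (x + x') y = \<beta> x y + \<beta> x' y" "\<beta> (s l x) y = l * \<beta> x y"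
      by (fact a.add a.scale b.add b.scale)+
  qed
  have "Vector_Spaces.linear t scale_tensor (tens s t x)" for x
    unfolding Vector_Spaces.linear_def module_hom_def module_hom_axioms_def
    using assms kv by (auto simp: vector_space_def Modules.module_def
        tens_def scale_tensor_def fun_eq_iff m)
  moreover have "Vector_Spaces.linear s scale_tensor (\<lambda>x. tens s t x y)" for y
    unfolding Vector_Spaces.linear_def module_hom_def module_hom_axioms_def
    using assms kv by (auto simp: vector_space_def Modules.module_def
        tens_def scale_tensor_def fun_eq_iff m)
  ultimately show ?thesis by (simp add: bilin_def)
qed

lemma tensor_lift_unique:
  assumes "bilin s t u \<beta>" "z \<in> tensor_space s t"
    and "\<And>x y. F (tens s t x y) = \<beta> x y"
    and "\<And>z w. z \<in> tensor_space s t \<Longrightarrow> w \<in> tensor_space s t \<Longrightarrow> F (z + w) = F z + F w"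
  shows "F z = tensor_lift s t \<beta> z"
proof -
  have mem: "(\<Sum>(x, y)\<leftarrow>xs. tens s t x y) \<in> tensor_space s t" for xs
    by (simp add: tensor_space_def)
  have "F 0 = F 0 + F 0" using assms(4)[OF mem[of "[]"] mem[of "[]"]] by simp
  then have F0: "F 0 = 0" by simp
  have one: "tens s t x y \<in> tensor_space s t" for x y
    using mem[of "[(x, y)]"] by simp
  have "F (\<Sum>(x, y)\<leftarrow>xs. tens s t x y) = (\<Sum>(x, y)\<leftarrow>xs. \<beta> x y)" for xs
  proof (induction xs)
    case Nil
    then show ?case using F0 by (simp add: zero_fun_def)
  next
    case (Cons p xs)
    then show ?case
      using assms(4)[OF one mem, of "fst p" "snd p" xs] assms(3)
      by (simp add: split_def del: plus_fun_apply)
  qed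
  then show ?thesis
    using assms(1,2) by (auto simp: tensor_space_def tensor_lift_sum)
qed

lemma tens3_sum_eqD:
  assumes eq: "(\<Sum>(x, y, z)\<leftarrow>xs. tens3 s t r x y z) = (\<Sum>(x, y, z)\<leftarrow>ys. tens3 s t r x y z)"
    and b: "trilin s t r u \<beta>"
  shows "(\<Sum>(x, y, z)\<leftarrow>xs. \<beta> x y z) = (\<Sum>(x, y, z)\<leftarrow>ys. \<beta> x y z)"
proof (rule ccontr)
  have vs: "vector_space u"
    using b by (auto simp: trilin_def Vector_Spaces.linear_def)
  let ?d = "(\<Sum>(x, y, z)\<leftarrow>xs. \<beta> x y z) - (\<Sum>(x, y, z)\<leftarrow>ys. \<beta> x y z)"
  assume "\<not> ?thesis"
  then obtain \<phi> where \<phi>: "Vector_Spaces.linear u (*) \<phi>" "\<phi> ?d \<noteq> 0"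
    using linear_functional_separates[OF vs, of ?d] by auto
  interpret Vector_Spaces.linear u "(*)" \<phi> by (fact \<phi>(1))
  have b': "trilin s t r (*) (\<lambda>x y z. \<phi> (\<beta> x y z))"
    using b by (auto simp: trilin_def bilin_def intro!: linear_comp[OF _ \<phi>(1)])
  have "(\<Sum>(x, y, z)\<leftarrow>zs. tens3 s t r x y z) (\<lambda>x y z. \<phi> (\<beta> x y z)) = \<phi> (\<Sum>(x, y, z)\<leftarrow>zs. \<beta> x y z)" for zs
    using b' by (simp add: sum_list_fun_apply linear_sum_list[OF \<phi>(1)] tens3_def split_def)
  then have "\<phi> (\<Sum>(x, y, z)\<leftarrow>xs. \<beta> x y z) = \<phi> (\<Sum>(x, y, z)\<leftarrow>ys. \<beta> x y z)"
    using eq by metis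
  then show False using \<phi>(2) by (simp add: diff)
qed


section \<open>Entwining structures\<close>

text \<open>The sort of a \<open>k\<close>-algebra is \<open>ring + monoid_mult\<close> rather than \<open>ring_1\<close>, which would exclude
  the zero algebra.\<close>

locale k_algebra = vector_space s
  for s :: "'k::field \<Rightarrow> 'a::{ring, monoid_mult} \<Rightarrow> 'a" +
  assumes scale_mult_left: "s l x * y = s l (x * y)"
    and scale_mult_right: "x * s l y = s l (x * y)"

locale k_coalgebra = vector_space s
  for s :: "'k::field \<Rightarrow> 'c::ab_group_add \<Rightarrow> 'c" +
  fixes \<Delta> :: "'c \<Rightarrow> ('k, 'c, 'c) tensor"
    and \<epsilon> :: "'c \<Rightarrow> 'k"
  assumes comult_linear: "Vector_Spaces.linear s scale_tensor \<Delta>"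
    and comult_in: "\<Delta> c \<in> tensor_space s s"
    and counit_linear: "Vector_Spaces.linear s (*) \<epsilon>"
    and coassoc:
      "tensor_lift s s (\<lambda>x z. tensor_lift s s (\<lambda>x1 x2. tens3 s s s x1 x2 z) (\<Delta> x)) (\<Delta> c) =
       tensor_lift s s (\<lambda>x z. tensor_lift s s (\<lambda>z1 z2. tens3 s s s x z1 z2) (\<Delta> z)) (\<Delta> c)"
    and counit_left: "tensor_lift s s (\<lambda>x y. s (\<epsilon> x) y) (\<Delta> c) = c"
    and counit_right: "tensor_lift s s (\<lambda>x y. s (\<epsilon> y) x) (\<Delta> c) = c"

locale entwining_structure = A: k_algebra sA + C: k_coalgebra sC \<Delta> \<epsilon>
  for sA :: "'k::field \<Rightarrow> 'a::{ring, monoid_mult} \<Rightarrow> 'a"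
    and sC :: "'k \<Rightarrow> 'c::ab_group_add \<Rightarrow> 'c"
    and \<Delta> :: "'c \<Rightarrow> ('k, 'c, 'c) tensor"
    and \<epsilon> :: "'c \<Rightarrow> 'k" +
  fixes \<psi> :: "'c \<Rightarrow> 'a \<Rightarrow> ('k, 'a, 'c) tensor"
  assumes coalgebra_nonzero: "\<exists>c::'c. c \<noteq> 0"
    and psi_bilin: "bilin sC sA scale_tensor \<psi>"
    and psi_in: "\<psi> c a \<in> tensor_space sA sC"
    and psi_mult:
      "\<psi> c (a * b) =
       tensor_lift sA sC (\<lambda>a' c'. tensor_lift sA sC (\<lambda>b' c''. tens sA sC (a' * b') c'') (\<psi> c' b)) (\<psi> c a)"
    and psi_comult:
      "tensor_lift sA sC (\<lambda>a' c'. tensor_lift sC sC (\<lambda>c1 c2. tens3 sA sC sC a' c1 c2) (\<Delta> c')) (\<psi> c a) =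
       tensor_lift sC sC (\<lambda>c1 c2. tensor_lift sA sC (\<lambda>a' c2'.
         tensor_lift sA sC (\<lambda>a'' c1'. tens3 sA sC sC a'' c1' c2') (\<psi> c1 a')) (\<psi> c2 a)) (\<Delta> c)"
    and psi_counit: "tensor_lift sA sC (\<lambda>a' c'. sA (\<epsilon> c') a') (\<psi> c a) = sA (\<epsilon> c) a"
    and psi_one: "\<psi> c 1 = tens sA sC 1 c"

record ('k, 'a, 'b, 'c) entwining_data =
  scA :: "'k \<Rightarrow> 'a \<Rightarrow> 'a"
  scB :: "'k \<Rightarrow> 'b \<Rightarrow> 'b"
  scC :: "'k \<Rightarrow> 'c \<Rightarrow> 'c"
  comult :: "'c \<Rightarrow> ('k, 'c, 'c) tensor"
  counit :: "'c \<Rightarrow> 'k"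
  psi :: "'c \<Rightarrow> 'a \<Rightarrow> ('k, 'a, 'c) tensor"
  zeta :: "'b \<Rightarrow> 'a"

locale entwining_structure_over =
  entwining_structure "scA D" "scC D" "comult D" "counit D" "psi D" + B: k_algebra "scB D"
  for D :: "('k::field, 'a::{ring, monoid_mult}, 'b::{comm_ring, comm_monoid_mult}, 'c::ab_group_add)
            entwining_data" +
  assumes zeta_linear: "Vector_Spaces.linear (scB D) (scA D) (zeta D)"
    and zeta_mult: "zeta D (b * b') = zeta D b * zeta D b'"
    and zeta_one: "zeta D 1 = 1"
    and zeta_central: "zeta D b * a = a * zeta D b"
    and psi_zeta: "psi D c (zeta D b) = tens (scA D) (scC D) (zeta D b) c"

abbreviation liftAC ::
  "('k::field, 'a::ab_group_add, 'b, 'c::ab_group_add) entwining_data \<Rightarrow>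
   ('a \<Rightarrow> 'c \<Rightarrow> 'u::ab_group_add) \<Rightarrow> ('k, 'a, 'c) tensor \<Rightarrow> 'u"
  where "liftAC D \<equiv> tensor_lift (scA D) (scC D)"

abbreviation liftCC ::
  "('k::field, 'a, 'b, 'c::ab_group_add) entwining_data \<Rightarrow>
   ('c \<Rightarrow> 'c \<Rightarrow> 'u::ab_group_add) \<Rightarrow> ('k, 'c, 'c) tensor \<Rightarrow> 'u"
  where "liftCC D \<equiv> tensor_lift (scC D) (scC D)"


section \<open>Cochains\<close>

text \<open>
  A tensor matrix of size \<open>n\<close> is given by its diagonal \<open>a\<close> and its off-diagonal entries \<open>b\<close>, of which
  only \<open>a i\<close> with \<open>1 \<le> i \<le> n\<close> and \<open>b i j\<close> with \<open>1 \<le> i < j \<le> n\<close> are relevant.  A cochain of degree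
  \<open>n\<close> is a map that is linear in \<open>c\<close> and in each of these entries, and depends on nothing else.
\<close>

type_synonym ('a, 'b, 'c) cochain = "'c \<Rightarrow> (nat \<Rightarrow> 'a) \<Rightarrow> (nat \<Rightarrow> nat \<Rightarrow> 'b) \<Rightarrow> 'a"

definition cochains ::
  "('k::field, 'a::ab_group_add, 'b::ab_group_add, 'c::ab_group_add) entwining_data \<Rightarrow> nat \<Rightarrow>
   ('a, 'b, 'c) cochain set"
  where "cochains D n = {f.
     (\<forall>a b. Vector_Spaces.linear (scC D) (scA D) (\<lambda>c. f c a b)) \<and>
     (\<forall>c a b. \<forall>i\<in>{1..n}. Vector_Spaces.linear (scA D) (scA D) (\<lambda>x. f c (a(i := x)) b)) \<and>
     (\<forall>c a b i j. 1 \<le> i \<and> i < j \<and> j \<le> n \<longrightarrow>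
        Vector_Spaces.linear (scB D) (scA D) (\<lambda>y. f c a (b(i := (b i)(j := y))))) \<and>
     (\<forall>c a b a' b'. (\<forall>i\<in>{1..n}. a i = a' i) \<and>
        (\<forall>i j. 1 \<le> i \<and> i < j \<and> j \<le> n \<longrightarrow> b i j = b' i j) \<longrightarrow> f c a b = f c a' b')}"

text \<open>Multiplication by \<open>(-1) ^ e\<close>.\<close>
definition sgn_act :: "int \<Rightarrow> 'v::ab_group_add \<Rightarrow> 'v"
  where "sgn_act e x = (if even e then x else - x)"

definition shift_diag :: "nat \<Rightarrow> (nat \<Rightarrow> 'a) \<Rightarrow> nat \<Rightarrow> 'a"
  where "shift_diag i a = (\<lambda>p. a (i + p))"

definition shift_off :: "nat \<Rightarrow> (nat \<Rightarrow> nat \<Rightarrow> 'b) \<Rightarrow> nat \<Rightarrow> nat \<Rightarrow> 'b"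
  where "shift_off i b = (\<lambda>r s. b (i + r) (i + s))"

text \<open>\<open>pass D i c a F\<close> moves \<open>c\<close> past \<open>a 1, \<dots>, a i\<close> by \<open>\<psi>\<close> and applies the multilinear map \<open>F\<close> to
  the modified diagonal and the modified element of \<open>C\<close>.\<close>
primrec pass ::
  "('k::field, 'a::ab_group_add, 'b, 'c::ab_group_add) entwining_data \<Rightarrow> nat \<Rightarrow> 'c \<Rightarrow> (nat \<Rightarrow> 'a) \<Rightarrow>
   ((nat \<Rightarrow> 'a) \<Rightarrow> 'c \<Rightarrow> 'u::ab_group_add) \<Rightarrow> 'u"
  where
    "pass D 0 c a F = F a c"
  | "pass D (Suc i) c a F = pass D i c a
       (\<lambda>a' c'. liftAC D (\<lambda>x c''. F (a'(Suc i := x)) c'') (psi D c' (a (Suc i))))"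

text \<open>Merging the indices \<open>i\<close> and \<open>i + 1\<close>.\<close>
definition merge_diag :: "('b \<Rightarrow> 'a::monoid_mult) \<Rightarrow> nat \<Rightarrow> (nat \<Rightarrow> 'a) \<Rightarrow> (nat \<Rightarrow> nat \<Rightarrow> 'b) \<Rightarrow> nat \<Rightarrow> 'a"
  where "merge_diag \<zeta> i a b = (\<lambda>p.
    if p < i then a p else if p = i then \<zeta> (b i (i + 1)) * a i * a (i + 1) else a (p + 1))"

definition merge_off :: "nat \<Rightarrow> (nat \<Rightarrow> nat \<Rightarrow> 'b::times) \<Rightarrow> nat \<Rightarrow> nat \<Rightarrow> 'b"
  where "merge_off i b = (\<lambda>r s.
    if s < i then b r s
    else if s = i then b r i * b r (i + 1)
    else if r < i then b r (s + 1)
    else if r = i then b i (s + 1) * b (i + 1) (s + 1)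
    else b (r + 1) (s + 1))"

definition differential ::
  "('k::field, 'a::{ring, monoid_mult}, 'b::comm_monoid_mult, 'c::ab_group_add) entwining_data \<Rightarrow>
   nat \<Rightarrow> ('a, 'b, 'c) cochain \<Rightarrow> ('a, 'b, 'c) cochain"
  where "differential D n f = (\<lambda>c a b.
      liftAC D (\<lambda>x c'. zeta D (\<Prod>j\<in>{2..n+1}. b 1 j) * x * f c' (shift_diag 1 a) (shift_off 1 b))
        (psi D c (a 1))
    + (\<Sum>i\<in>{1..n}. sgn_act (int i) (f c (merge_diag (zeta D) i a b) (merge_off i b)))
    + sgn_act (int n + 1) (zeta D (\<Prod>r\<in>{1..n}. b r (n + 1)) * f c a b * a (n + 1)))"

text \<open>The tensor matrix obtained from one of size \<open>m + n - 1\<close> by replacing the \<open>n\<close> indices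
  \<open>i + 1, \<dots>, i + n\<close> by a single one, with diagonal entry \<open>x\<close>.\<close>
definition insert_diag :: "nat \<Rightarrow> nat \<Rightarrow> 'a \<Rightarrow> (nat \<Rightarrow> 'a) \<Rightarrow> nat \<Rightarrow> 'a"
  where "insert_diag n i x a = (\<lambda>p. if p \<le> i then a p else if p = i + 1 then x else a (p + n - 1))"

definition insert_off :: "nat \<Rightarrow> nat \<Rightarrow> (nat \<Rightarrow> nat \<Rightarrow> 'b::comm_monoid_mult) \<Rightarrow> nat \<Rightarrow> nat \<Rightarrow> 'b"
  where "insert_off n i b = (\<lambda>r s.
    if s \<le> i then b r s
    else if s = i + 1 then (\<Prod>t\<in>{i+1..i+n}. b r t)
    else if r \<le> i then b r (s + n - 1)
    else if r = i + 1 then (\<Prod>t\<in>{i+1..i+n}. b t (s + n - 1))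
    else b (r + n - 1) (s + n - 1))"

definition dia ::
  "('k::field, 'a::ab_group_add, 'b::comm_monoid_mult, 'c::ab_group_add) entwining_data \<Rightarrow>
   nat \<Rightarrow> nat \<Rightarrow> nat \<Rightarrow> ('a, 'b, 'c) cochain \<Rightarrow> ('a, 'b, 'c) cochain \<Rightarrow> ('a, 'b, 'c) cochain"
  where "dia D m n i f g = (if i < m then
      (\<lambda>c a b. liftCC D (\<lambda>c1 c2. pass D i c2 a (\<lambda>a' c2'.
         f c1 (insert_diag n i (g c2' (shift_diag i a) (shift_off i b)) a') (insert_off n i b)))
       (comult D c))
    else 0)"

definition alpha ::
  "('k, 'a::monoid_mult, 'b, 'c) entwining_data \<Rightarrow> ('a, 'b, 'c) cochain"
  where "alpha D = (\<lambda>c a b. scA D (counit D c) (zeta D (b 1 2) * a 1 * a 2))"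

definition cup ::
  "('k::field, 'a::{ring, monoid_mult}, 'b::comm_monoid_mult, 'c::ab_group_add) entwining_data \<Rightarrow>
   nat \<Rightarrow> nat \<Rightarrow> ('a, 'b, 'c) cochain \<Rightarrow> ('a, 'b, 'c) cochain \<Rightarrow> ('a, 'b, 'c) cochain"
  where "cup D m n f g = (\<lambda>c a b. liftCC D (\<lambda>c1 c2. pass D m c2 a (\<lambda>a' c2'.
      zeta D (\<Prod>r\<in>{1..m}. \<Prod>s\<in>{m+1..m+n}. b r s) *
      f c1 a' b * g c2' (shift_diag m a) (shift_off m b))) (comult D c))"

definition sqcup ::
  "('k::field, 'a::{ring, monoid_mult}, 'b::comm_monoid_mult, 'c::ab_group_add) entwining_data \<Rightarrow>
   nat \<Rightarrow> nat \<Rightarrow> ('a, 'b, 'c) cochain \<Rightarrow> ('a, 'b, 'c) cochain \<Rightarrow> ('a, 'b, 'c) cochain"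
  where "sqcup D m n f g = (\<lambda>c a b. liftCC D (\<lambda>c1 c2. liftAC D (\<lambda>x c1'.
      zeta D (\<Prod>r\<in>{1..m}. \<Prod>s\<in>{m+1..m+n}. b r s) *
      x * g c1' (shift_diag m a) (shift_off m b)) (psi D c1 (f c2 a b))) (comult D c))"

definition equivariant ::
  "('k::field, 'a::ab_group_add, 'b, 'c::ab_group_add) entwining_data \<Rightarrow> nat \<Rightarrow>
   ('a, 'b, 'c) cochain \<Rightarrow> bool"
  where "equivariant D n f \<longleftrightarrow> (\<forall>c a b.
    liftCC D (\<lambda>c1 c2. pass D n c2 a (\<lambda>a' c2'. tens (scA D) (scC D) (f c1 a' b) c2')) (comult D c) =
    liftCC D (\<lambda>c1 c2. psi D c1 (f c2 a b)) (comult D c))"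


section \<open>Comp algebras and Gerstenhaber algebras\<close>

text \<open>
  Graded vector spaces are families of modules over the ring record of a field.  They are indexed
  by \<open>int\<close>, with zero components in negative degrees, since the operations of degree \<open>-1\<close> map a pair
  of elements of degree \<open>0\<close> to degree \<open>-1\<close>.  The operations take the degrees of their arguments as
  parameters; their values outside the relevant carriers are irrelevant.  The multiplicative part
  of the \<open>module\<close> records is not used.
\<close>

definition field_ring :: "'k::field ring"
  where "field_ring = \<lparr>carrier = UNIV, mult = (*), one = 1, zero = 0, add = (+)\<rparr>"

definition module_bilinear ::
  "('k, 'r) ring_scheme \<Rightarrow> ('k, 'u) module \<Rightarrow> ('k, 'v) module \<Rightarrow> ('k, 'w) module \<Rightarrow> ('u \<Rightarrow> 'v \<Rightarrow> 'w) \<Rightarrow> bool"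
  where "module_bilinear K U V W \<beta> \<longleftrightarrow>
    (\<forall>x\<in>carrier U. \<forall>y\<in>carrier V. \<beta> x y \<in> carrier W) \<and>
    (\<forall>x\<in>carrier U. \<forall>x'\<in>carrier U. \<forall>y\<in>carrier V. \<beta> (x \<oplus>\<^bsub>U\<^esub> x') y = \<beta> x y \<oplus>\<^bsub>W\<^esub> \<beta> x' y) \<and>
    (\<forall>x\<in>carrier U. \<forall>y\<in>carrier V. \<forall>y'\<in>carrier V. \<beta> x (y \<oplus>\<^bsub>V\<^esub> y') = \<beta> x y \<oplus>\<^bsub>W\<^esub> \<beta> x y') \<and>
    (\<forall>l\<in>carrier K. \<forall>x\<in>carrier U. \<forall>y\<in>carrier V.
       \<beta> (l \<odot>\<^bsub>U\<^esub> x) y = l \<odot>\<^bsub>W\<^esub> \<beta> x y \<and> \<beta> x (l \<odot>\<^bsub>V\<^esub> y) = l \<odot>\<^bsub>W\<^esub> \<beta> x y)"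

text \<open>Multiplication by \<open>(-1) ^ e\<close> in \<open>V\<close>.\<close>
definition msgn :: "('k, 'v) module \<Rightarrow> int \<Rightarrow> 'v \<Rightarrow> 'v"
  where "msgn V e x = (if even e then x else \<ominus>\<^bsub>V\<^esub> x)"

locale graded_vector_space =
  fixes K :: "('k, 'r) ring_scheme" and V :: "int \<Rightarrow> ('k, 'v) module"
  assumes scalars_field: "Ring.field K"
    and component_module: "Module.module K (V n)"
    and component_neg: "n < 0 \<Longrightarrow> carrier (V n) = {\<zero>\<^bsub>V n\<^esub>}"

locale right_comp_algebra = graded_vector_space K V
  for K :: "('k, 'r) ring_scheme" and V :: "int \<Rightarrow> ('k, 'v) module" +
  fixes comp :: "int \<Rightarrow> int \<Rightarrow> nat \<Rightarrow> 'v \<Rightarrow> 'v \<Rightarrow> 'v"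
    and al :: 'v
  assumes al_in: "al \<in> carrier (V 2)"
    and comp_bilinear: "module_bilinear K (V m) (V n) (V (m + n - 1)) (comp m n i)"
    and comp_zero: "\<lbrakk>f \<in> carrier (V m); g \<in> carrier (V n); int i > m - 1\<rbrakk> \<Longrightarrow>
      comp m n i f g = \<zero>\<^bsub>V (m + n - 1)\<^esub>"
    and comp_before: "\<And>m n p :: nat. \<lbrakk>f \<in> carrier (V m); g \<in> carrier (V n); h \<in> carrier (V p); j < i\<rbrakk> \<Longrightarrow>
      comp (int m + int n - 1) p j (comp m n i f g) h =
      comp (int m + int p - 1) n (i + p - 1) (comp m p j f h) g"
    and comp_inside: "\<And>m n p :: nat. \<lbrakk>f \<in> carrier (V m); g \<in> carrier (V n); h \<in> carrier (V p); i \<le> j; j < n + i\<rbrakk> \<Longrightarrow>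
      comp (int m + int n - 1) p j (comp m n i f g) h =
      comp m (int n + int p - 1) i f (comp n p (j - i) g h)"
    and comp_after: "\<And>m n p :: nat. \<lbrakk>f \<in> carrier (V m); g \<in> carrier (V n); h \<in> carrier (V p); n + i \<le> j\<rbrakk> \<Longrightarrow>
      comp (int m + int n - 1) p j (comp m n i f g) h =
      comp (int m + int p - 1) n i (comp m p (j + 1 - n) f h) g"
    and comp_al: "comp 2 2 0 al al = comp 2 2 1 al al"

locale gerstenhaber_algebra = graded_vector_space K V
  for K :: "('k, 'r) ring_scheme" and V :: "int \<Rightarrow> ('k, 'v) module" +
  fixes prd :: "int \<Rightarrow> int \<Rightarrow> 'v \<Rightarrow> 'v \<Rightarrow> 'v"
    and brk :: "int \<Rightarrow> int \<Rightarrow> 'v \<Rightarrow> 'v \<Rightarrow> 'v"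
  assumes prd_bilinear: "module_bilinear K (V m) (V n) (V (m + n)) (prd m n)"
    and prd_assoc: "\<lbrakk>f \<in> carrier (V m); g \<in> carrier (V n); h \<in> carrier (V p)\<rbrakk> \<Longrightarrow>
      prd (m + n) p (prd m n f g) h = prd m (n + p) f (prd n p g h)"
    and prd_graded_comm: "\<lbrakk>f \<in> carrier (V m); g \<in> carrier (V n)\<rbrakk> \<Longrightarrow>
      prd m n f g = msgn (V (m + n)) (m * n) (prd n m g f)"
    and brk_bilinear: "module_bilinear K (V m) (V n) (V (m + n - 1)) (brk m n)"
    and brk_antisym: "\<lbrakk>f \<in> carrier (V m); g \<in> carrier (V n)\<rbrakk> \<Longrightarrow>
      brk m n f g = \<ominus>\<^bsub>V (m + n - 1)\<^esub> (msgn (V (m + n - 1)) ((m - 1) * (n - 1)) (brk n m g f))"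
    and brk_jacobi: "\<lbrakk>f \<in> carrier (V m); g \<in> carrier (V n); h \<in> carrier (V p)\<rbrakk> \<Longrightarrow>
      msgn (V (m + n + p - 2)) ((m - 1) * (p - 1)) (brk m (n + p - 1) f (brk n p g h))
        \<oplus>\<^bsub>V (m + n + p - 2)\<^esub>
      msgn (V (m + n + p - 2)) ((n - 1) * (m - 1)) (brk n (p + m - 1) g (brk p m h f))
        \<oplus>\<^bsub>V (m + n + p - 2)\<^esub>
      msgn (V (m + n + p - 2)) ((p - 1) * (n - 1)) (brk p (m + n - 1) h (brk m n f g))
      = \<zero>\<^bsub>V (m + n + p - 2)\<^esub>"
    and brk_derivation: "\<lbrakk>f \<in> carrier (V m); g \<in> carrier (V n); h \<in> carrier (V p)\<rbrakk> \<Longrightarrow>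
      brk (m + n) p (prd m n f g) h =
      prd (m + p - 1) n (brk m p f h) g
        \<oplus>\<^bsub>V (m + n + p - 1)\<^esub>
      msgn (V (m + n + p - 1)) (m * (p - 1)) (prd m (n + p - 1) f (brk n p g h))"


section \<open>The equivariant complex and its cohomology\<close>

definition equivariant_cochains ::
  "('k::field, 'a::ab_group_add, 'b::ab_group_add, 'c::ab_group_add) entwining_data \<Rightarrow> int \<Rightarrow>
   ('a, 'b, 'c) cochain set"
  where "equivariant_cochains D n =
    (if n < 0 then {0} else {f \<in> cochains D (nat n). equivariant D (nat n) f})"

definition equivariant_module ::
  "('k::field, 'a::ab_group_add, 'b::ab_group_add, 'c::ab_group_add) entwining_data \<Rightarrow> int \<Rightarrow>
   ('k, ('a, 'b, 'c) cochain) module"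
  where "equivariant_module D n =
    \<lparr>carrier = equivariant_cochains D n, mult = undefined, one = undefined, zero = 0, add = (+),
     smult = (\<lambda>l f c a b. scA D l (f c a b))\<rparr>"

definition comp_op ::
  "('k::field, 'a::ab_group_add, 'b::comm_monoid_mult, 'c::ab_group_add) entwining_data \<Rightarrow>
   int \<Rightarrow> int \<Rightarrow> nat \<Rightarrow> ('a, 'b, 'c) cochain \<Rightarrow> ('a, 'b, 'c) cochain \<Rightarrow> ('a, 'b, 'c) cochain"
  where "comp_op D m n i f g = dia D (nat m) (nat n) i f g"

definition comp_cup ::
  "('k::field, 'a::{ring, monoid_mult}, 'b::comm_monoid_mult, 'c::ab_group_add) entwining_data \<Rightarrow>
   nat \<Rightarrow> nat \<Rightarrow> ('a, 'b, 'c) cochain \<Rightarrow> ('a, 'b, 'c) cochain \<Rightarrow> ('a, 'b, 'c) cochain"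
  where "comp_cup D m n f g = dia D (m + 1) n m (dia D 2 m 0 (alpha D) f) g"

text \<open>The sum over \<open>i\<close> is finite, as the terms with \<open>i \<ge> m\<close> vanish.\<close>
definition circ ::
  "('k::field, 'a::ab_group_add, 'b::comm_monoid_mult, 'c::ab_group_add) entwining_data \<Rightarrow>
   nat \<Rightarrow> nat \<Rightarrow> ('a, 'b, 'c) cochain \<Rightarrow> ('a, 'b, 'c) cochain \<Rightarrow> ('a, 'b, 'c) cochain"
  where "circ D m n f g = (\<Sum>i<m. sgn_act (int i * (int n - 1)) (dia D m n i f g))"

definition bracket ::
  "('k::field, 'a::ab_group_add, 'b::comm_monoid_mult, 'c::ab_group_add) entwining_data \<Rightarrow>
   nat \<Rightarrow> nat \<Rightarrow> ('a, 'b, 'c) cochain \<Rightarrow> ('a, 'b, 'c) cochain \<Rightarrow> ('a, 'b, 'c) cochain"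
  where "bracket D m n f g =
    circ D m n f g - sgn_act ((int m - 1) * (int n - 1)) (circ D n m g f)"

definition cocycles ::
  "('k::field, 'a::{ring, monoid_mult}, 'b::{comm_ring, comm_monoid_mult}, 'c::ab_group_add) entwining_data \<Rightarrow>
   int \<Rightarrow> ('a, 'b, 'c) cochain set"
  where "cocycles D n = {f \<in> equivariant_cochains D n. n \<ge> 0 \<longrightarrow> differential D (nat n) f = 0}"

definition coboundaries ::
  "('k::field, 'a::{ring, monoid_mult}, 'b::{comm_ring, comm_monoid_mult}, 'c::ab_group_add) entwining_data \<Rightarrow>
   int \<Rightarrow> ('a, 'b, 'c) cochain set"
  where "coboundaries D n =
    (if n \<ge> 1 then differential D (nat (n - 1)) ` equivariant_cochains D (n - 1) else {0})"

text \<open>The quotient \<open>Z / N\<close> of two submodules \<open>N \<subseteq> Z\<close> of \<open>M\<close>, as a module of cosets of \<open>N\<close>.\<close>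
definition subquotient :: "('k, 'v) module \<Rightarrow> 'v set \<Rightarrow> 'v set \<Rightarrow> ('k, 'v set) module"
  where "subquotient M Z N =
    \<lparr>carrier = {N +>\<^bsub>M\<^esub> z | z. z \<in> Z}, mult = undefined, one = undefined, zero = N,
     add = (\<lambda>X Y. X <+>\<^bsub>M\<^esub> Y), smult = (\<lambda>l X. \<Union>x\<in>X. N +>\<^bsub>M\<^esub> (l \<odot>\<^bsub>M\<^esub> x))\<rparr>"

definition cohomology ::
  "('k::field, 'a::{ring, monoid_mult}, 'b::{comm_ring, comm_monoid_mult}, 'c::ab_group_add) entwining_data \<Rightarrow>
   int \<Rightarrow> ('k, ('a, 'b, 'c) cochain set) module"
  where "cohomology D n = subquotient (equivariant_module D n) (cocycles D n) (coboundaries D n)"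

definition cohomology_class ::
  "('k::field, 'a::{ring, monoid_mult}, 'b::{comm_ring, comm_monoid_mult}, 'c::ab_group_add) entwining_data \<Rightarrow>
   int \<Rightarrow> ('a, 'b, 'c) cochain \<Rightarrow> ('a, 'b, 'c) cochain set"
  where "cohomology_class D n f = coboundaries D n +>\<^bsub>equivariant_module D n\<^esub> f"

end

theory Submission
  imports Defs
begin

text \<open>
  An equivariant cochain of degree \<open>n\<close> is a morphism \<open>A\<^sup>n \<rightarrow> A\<close> in a monoidal category: a morphism
  \<open>X \<rightarrow> Y\<close> is a map \<open>C \<otimes> X \<rightarrow> Y\<close>, morphisms are composed by means of the coproduct, and equivariance,
  that is compatibility with \<open>\<psi>\<close>, makes insertions at different places commute.  The operations
  \<open>\<Diamond>\<^sub>i\<close> are the partial compositions of the endomorphism operad of \<open>A\<close> in this category.  Part (a) is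
  equivariance of \<open>f\<close>, followed by the bilinear map \<open>x \<otimes> c \<mapsto> \<zeta>(\<beta>) x g(c \<otimes> T'')\<close>.

  For part (c), put \<open>|f| = m - 1\<close> for \<open>f\<close> of degree \<open>m\<close>, and absorb the sign \<open>(-1)\<^sup>i\<^sup>|\<^sup>g\<^sup>|\<close> into
  \<open>f \<Diamond>\<^sub>i g\<close>.  Then all signs are Koszul signs, \<open>\<alpha>\<close> is odd with \<open>\<alpha>{\<alpha>} = 0\<close>, and \<open>-\<delta>\<close> is \<open>[_, \<alpha>]\<close>.  The
  Jacobi identity is a consequence of the pre-Lie identity.  With the braces \<open>f{g}\<close> and \<open>f{g, h}\<close>,
  which insert their arguments at all places in the given order, \<open>f \<union> g\<close> is \<open>\<alpha>{f, g}\<close> up to sign;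
  the cochain \<open>f{g}\<close> is a homotopy for commutativity of the cup product, and \<open>h{f, g}\<close> is a homotopy
  for the derivation property of \<open>[_, h]\<close>.
\<close>

section \<open>Brace identities in a comp algebra with Koszul signs\<close>

text \<open>Among the relations between insertions, only the exchange of insertions at different
  places uses equivariance: there a copy of \<open>c\<close> must be moved past the value of a
  cochain, and equivariance replaces this by moving it past the arguments. Nested insertions compose
  for arbitrary cochains.

  The obstacle is that \<open>tensor_lift\<close> evaluates a tensor on a chosen representation, so
  it is well behaved only for bilinear maps. Each use of coassociativity or of an entwining axiom
  inside a nested Sweedler sum therefore carries a multilinearity condition. To make these
  conditions mechanical, diagonals are treated as lists and off-diagonal entries are kept apart from
  them; a relation for \<open>\<Diamond>\<close> then splits into an identity of Sweedler sums and
  an identity of index maps.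

  In the brace calculus, \<open>\<alpha>\<close> has only two slots, so threefold braces never have
  \<open>\<alpha>\<close> outermost; those with \<open>h\<close> outermost occur in the differential
  of \<open>h{f, g}\<close> and cancel there. Since \<open>k\<close> may have characteristic 2,
  nothing may be derived from twice an identity.\<close>

lemma sgn_act_zero [simp]: "sgn_act e 0 = 0"
  by (simp add: sgn_act_def)

lemma sgn_act_add: "sgn_act e (x + y) = sgn_act e x + sgn_act e y"
  by (simp add: sgn_act_def)

lemma sgn_act_sum: "sgn_act e (sum F I) = (\<Sum>i\<in>I. sgn_act e (F i))"
  by (simp add: sgn_act_def sum_negf)

lemma sgn_act_sgn_act: "sgn_act e (sgn_act e' x) = sgn_act (e + e') x"
  by (simp add: sgn_act_def)

section \<open>Sums over the slots of a composite\<close>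

text \<open>After an element with \<open>y + 1\<close> inputs has been put into slot
  \<open>i\<close>, the slots split into those before \<open>i\<close>, those of the inserted
  element, and those after it, shifted by \<open>y\<close>. For \<open>y = -1\<close> the inserted
  element has no inputs and the middle range is empty.\<close>

lemma sum_slots:
  fixes F :: "int \<Rightarrow> 'a::comm_monoid_add"
  assumes "a \<le> i" "i \<le> x" "-1 \<le> y"
  shows "sum F {a..x + y} = sum F {a..i - 1} + (\<Sum>j=0..y. F (i + j)) + (\<Sum>j=i + 1..x. F (j + y))"
proof -
  have "{a..x + y} = ({a..i - 1} \<union> {i..i + y}) \<union> {i + y + 1..x + y}"
    using assms by auto
  moreover have "sum F {i..i + y} = (\<Sum>j=0..y. F (i + j))"
    by (rule sum.reindex_bij_witness[of _ "\<lambda>j. i + j" "\<lambda>j. j - i"]) auto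
  moreover have "sum F {i + y + 1..x + y} = (\<Sum>j=i + 1..x. F (j + y))"
    by (rule sum.reindex_bij_witness[of _ "\<lambda>j. j + y" "\<lambda>j. j - y"]) auto
  moreover have "sum F (({a..i - 1} \<union> {i..i + y}) \<union> {i + y + 1..x + y}) =
      sum F ({a..i - 1} \<union> {i..i + y}) + sum F {i + y + 1..x + y}"
    using assms by (intro sum.union_disjoint) auto
  moreover have "sum F ({a..i - 1} \<union> {i..i + y}) = sum F {a..i - 1} + sum F {i..i + y}"
    by (intro sum.union_disjoint) auto
  ultimately show ?thesis by (simp add: add.assoc)
qed

text \<open>Counts the slots to the right of slot \<open>j\<close> of the inserted element: first
  the rest of that element, then the later slots of the outer one. It serves for a second argument
  to be placed after a first one.\<close>

lemma sum_slots_inside: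
  fixes F :: "int \<Rightarrow> 'a::comm_monoid_add"
  assumes "0 \<le> j" "j \<le> y" "i \<le> x"
  shows "sum F {i + j + 1..x + y} = (\<Sum>k=j + 1..y. F (i + k)) + (\<Sum>k=i + 1..x. F (k + y))"
proof -
  have "{i + j + 1..x + y} = {i + j + 1..i + y} \<union> {i + y + 1..x + y}"
    using assms by auto
  moreover have "sum F {i + j + 1..i + y} = (\<Sum>k=j + 1..y. F (i + k))"
    by (rule sum.reindex_bij_witness[of _ "\<lambda>j. i + j" "\<lambda>j. j - i"]) auto
  moreover have "sum F {i + y + 1..x + y} = (\<Sum>j=i + 1..x. F (j + y))"
    by (rule sum.reindex_bij_witness[of _ "\<lambda>j. j + y" "\<lambda>j. j - y"]) auto
  moreover have "sum F ({i + j + 1..i + y} \<union> {i + y + 1..x + y}) =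
      sum F {i + j + 1..i + y} + sum F {i + y + 1..x + y}"
    using assms by (intro sum.union_disjoint) auto
  ultimately show ?thesis by simp
qed

lemma sum_shift_int:
  fixes F :: "int \<Rightarrow> 'a::comm_monoid_add"
  shows "sum F {a + y..b + y} = (\<Sum>k=a..b. F (k + y))"
  by (rule sum.reindex_bij_witness[of _ "\<lambda>j. j + y" "\<lambda>j. j - y"]) auto

lemma sum_triangle_swap:
  fixes F :: "int \<Rightarrow> int \<Rightarrow> 'a::comm_monoid_add"
  shows "(\<Sum>j=a..x. \<Sum>k=a..j - 1. F j k) = (\<Sum>k=a..x. \<Sum>j=k + 1..x. F j k)"
proof -
  have "(\<Sum>j=a..x. \<Sum>k\<in>{k\<in>{a..x}. k < j}. F j k) = (\<Sum>k=a..x. \<Sum>j\<in>{j\<in>{a..x}. k < j}. F j k)"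
    by (rule sum.swap_restrict) auto
  moreover have "{k\<in>{a..x}. k < j} = {a..j - 1}" if "j \<in> {a..x}" for j
    using that by auto
  moreover have "{j\<in>{a..x}. k < j} = {k + 1..x}" if "k \<in> {a..x}" for k
    using that by auto
  ultimately show ?thesis by simp
qed

text \<open>The component \<open>W x\<close> consists of the elements with \<open>x + 1\<close> inputs, and \<open>cmp x y i f g\<close> is
  \<open>f \<Diamond>\<^sub>i g\<close> with the sign \<open>(-1)\<^sup>i\<^sup>y\<close>, which turns \<open>\<alpha> \<Diamond>\<^sub>0 \<alpha> = \<alpha> \<Diamond>\<^sub>1 \<alpha>\<close> into \<open>al_al\<close>.\<close>

locale suspended_comp_algebra = vector_space sc
  for sc :: "'k::field \<Rightarrow> 'v::ab_group_add \<Rightarrow> 'v" +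
  fixes W :: "int \<Rightarrow> 'v set"
    and cmp :: "int \<Rightarrow> int \<Rightarrow> int \<Rightarrow> 'v \<Rightarrow> 'v \<Rightarrow> 'v"
    and al :: 'v
  assumes subspace_W: "subspace (W x)"
    and W_trivial: "x < -1 \<Longrightarrow> W x = {0}"
    and cmp_in: "\<lbrakk>f \<in> W x; g \<in> W y\<rbrakk> \<Longrightarrow> cmp x y i f g \<in> W (x + y)"
    and cmp_add_left: "\<lbrakk>f \<in> W x; f' \<in> W x; g \<in> W y\<rbrakk> \<Longrightarrow>
      cmp x y i (f + f') g = cmp x y i f g + cmp x y i f' g"
    and cmp_add_right: "\<lbrakk>f \<in> W x; g \<in> W y; g' \<in> W y\<rbrakk> \<Longrightarrow>
      cmp x y i f (g + g') = cmp x y i f g + cmp x y i f g'"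
    and cmp_scale_left: "\<lbrakk>f \<in> W x; g \<in> W y\<rbrakk> \<Longrightarrow> cmp x y i (sc l f) g = sc l (cmp x y i f g)"
    and cmp_scale_right: "\<lbrakk>f \<in> W x; g \<in> W y\<rbrakk> \<Longrightarrow> cmp x y i f (sc l g) = sc l (cmp x y i f g)"
    and cmp_outside: "\<lbrakk>f \<in> W x; g \<in> W y; i < 0 \<or> x < i\<rbrakk> \<Longrightarrow> cmp x y i f g = 0"
    and cmp_parallel: "\<lbrakk>f \<in> W x; g \<in> W y; h \<in> W z; j < i\<rbrakk> \<Longrightarrow>
      cmp (x + y) z j (cmp x y i f g) h = sgn_act (y * z) (cmp (x + z) y (i + z) (cmp x z j f h) g)"
    and cmp_inside: "\<lbrakk>f \<in> W x; g \<in> W y; h \<in> W z; 0 \<le> j; j \<le> y\<rbrakk> \<Longrightarrow>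
      cmp (x + y) z (i + j) (cmp x y i f g) h = cmp x (y + z) i f (cmp y z j g h)"
    and al_in: "al \<in> W 1"
    and al_al: "cmp 1 1 0 al al + cmp 1 1 1 al al = 0"
begin

lemma W_zero [simp]: "0 \<in> W x"
  using subspace_W by (rule subspace_0)

lemma W_add: "f \<in> W x \<Longrightarrow> g \<in> W x \<Longrightarrow> f + g \<in> W x"
  using subspace_W by (rule subspace_add)

lemma W_diff: "f \<in> W x \<Longrightarrow> g \<in> W x \<Longrightarrow> f - g \<in> W x"
  using subspace_W by (rule subspace_diff)

lemma W_neg: "f \<in> W x \<Longrightarrow> - f \<in> W x"
  using subspace_W by (rule subspace_neg)

lemma W_scale: "f \<in> W x \<Longrightarrow> sc l f \<in> W x"
  using subspace_W by (rule subspace_scale)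

lemma W_sum: "(\<And>i. i \<in> I \<Longrightarrow> F i \<in> W x) \<Longrightarrow> sum F I \<in> W x"
  using subspace_W by (rule subspace_sum)

lemma W_sgn: "f \<in> W x \<Longrightarrow> sgn_act e f \<in> W x"
  by (simp add: sgn_act_def W_neg)

lemma cmp_in': "\<lbrakk>f \<in> W x; g \<in> W y; u = x + y\<rbrakk> \<Longrightarrow> cmp x y i f g \<in> W u"
  by (simp add: cmp_in)

lemma cmp_zero_left [simp]: "g \<in> W y \<Longrightarrow> cmp x y i 0 g = 0"
  using cmp_add_left[of 0 x 0 g y i] by simp

lemma cmp_zero_right [simp]: "f \<in> W x \<Longrightarrow> cmp x y i f 0 = 0"
  using cmp_add_right[of f x 0 y 0 i] by simp

lemma cmp_minus_left: "f \<in> W x \<Longrightarrow> g \<in> W y \<Longrightarrow> cmp x y i (- f) g = - cmp x y i f g"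
  using cmp_add_left[of f x "- f" g y i] by (simp add: W_neg add_eq_0_iff)

lemma cmp_minus_right: "f \<in> W x \<Longrightarrow> g \<in> W y \<Longrightarrow> cmp x y i f (- g) = - cmp x y i f g"
  using cmp_add_right[of f x g y "- g" i] by (simp add: W_neg add_eq_0_iff)

lemma cmp_sgn_left: "f \<in> W x \<Longrightarrow> g \<in> W y \<Longrightarrow> cmp x y i (sgn_act e f) g = sgn_act e (cmp x y i f g)"
  by (simp add: sgn_act_def cmp_minus_left)

lemma cmp_sum_left:
  "(\<And>i. i \<in> I \<Longrightarrow> F i \<in> W x) \<Longrightarrow> g \<in> W y \<Longrightarrow> cmp x y j (sum F I) g = (\<Sum>i\<in>I. cmp x y j (F i) g)"
  by (induction I rule: infinite_finite_induct) (simp_all add: cmp_add_left W_sum)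

lemma cmp_sum_right:
  "f \<in> W x \<Longrightarrow> (\<And>i. i \<in> I \<Longrightarrow> G i \<in> W y) \<Longrightarrow> cmp x y j f (sum G I) = (\<Sum>i\<in>I. cmp x y j f (G i))"
  by (induction I rule: infinite_finite_induct) (simp_all add: cmp_add_right W_sum)

lemma cmp_parallel':
  "\<lbrakk>f \<in> W x; g \<in> W y; h \<in> W z; j < i; u = x + y; v = x + z; i' = i + z\<rbrakk> \<Longrightarrow>
    cmp u z j (cmp x y i f g) h = sgn_act (y * z) (cmp v y i' (cmp x z j f h) g)"
  by (simp add: cmp_parallel)

lemma cmp_inside':
  "\<lbrakk>f \<in> W x; g \<in> W y; h \<in> W z; i \<le> i'; i' \<le> i + y; u = x + y; v = y + z; j = i' - i\<rbrakk> \<Longrightarrow>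
    cmp u z i' (cmp x y i f g) h = cmp x v i f (cmp y z j g h)"
  using cmp_inside[of f x g y h z "i' - i" i] by simp

section \<open>Braces with one, two and three arguments\<close>

definition brace1 :: "int \<Rightarrow> int \<Rightarrow> 'v \<Rightarrow> 'v \<Rightarrow> 'v"
  where "brace1 x y f g = (\<Sum>i=0..x. cmp x y i f g)"

text \<open>This is \<open>f{g, h}\<close>. Slot \<open>j\<close> of \<open>f\<close> becomes slot
  \<open>j + y\<close> once \<open>g\<close> occupies an earlier slot. The Koszul signs are
  contained in \<open>cmp\<close>, so none appear here.\<close>

definition brace2 :: "int \<Rightarrow> int \<Rightarrow> int \<Rightarrow> 'v \<Rightarrow> 'v \<Rightarrow> 'v \<Rightarrow> 'v"
  where "brace2 x y z f g h =
    (\<Sum>i=0..x. \<Sum>j=i + 1..x. cmp (x + y) z (j + y) (cmp x y i f g) h)"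

definition brace3 :: "int \<Rightarrow> int \<Rightarrow> int \<Rightarrow> int \<Rightarrow> 'v \<Rightarrow> 'v \<Rightarrow> 'v \<Rightarrow> 'v \<Rightarrow> 'v"
  where "brace3 x y z w f g h k =
    (\<Sum>i=0..x. \<Sum>j=i + 1..x. \<Sum>l=j + 1..x.
       cmp (x + y + z) w (l + y + z) (cmp (x + y) z (j + y) (cmp x y i f g) h) k)"

lemma brace1_in: "\<lbrakk>f \<in> W x; g \<in> W y; u = x + y\<rbrakk> \<Longrightarrow> brace1 x y f g \<in> W u"
  by (simp add: brace1_def W_sum cmp_in)

lemma brace2_in: "\<lbrakk>f \<in> W x; g \<in> W y; h \<in> W z; u = x + y + z\<rbrakk> \<Longrightarrow> brace2 x y z f g h \<in> W u"
  by (simp add: brace2_def W_sum cmp_in)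

lemma brace1_zero_right [simp]: "f \<in> W x \<Longrightarrow> brace1 x y f 0 = 0"
  by (simp add: brace1_def)

lemma brace1_zero_left [simp]: "g \<in> W y \<Longrightarrow> brace1 x y 0 g = 0"
  by (simp add: brace1_def)

lemma brace2_zero1 [simp]: "g \<in> W y \<Longrightarrow> h \<in> W z \<Longrightarrow> brace2 x y z 0 g h = 0"
  by (simp add: brace2_def)

lemma brace2_zero2 [simp]: "f \<in> W x \<Longrightarrow> h \<in> W z \<Longrightarrow> brace2 x y z f 0 h = 0"
  by (simp add: brace2_def)

lemma brace2_zero3 [simp]: "f \<in> W x \<Longrightarrow> g \<in> W y \<Longrightarrow> brace2 x y z f g 0 = 0"
  by (simp add: brace2_def cmp_in)

lemma brace3_zero [simp]:
  "f \<in> W x \<Longrightarrow> h \<in> W z \<Longrightarrow> k \<in> W w \<Longrightarrow> brace3 x y z w f 0 h k = 0"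
  "f \<in> W x \<Longrightarrow> g \<in> W y \<Longrightarrow> k \<in> W w \<Longrightarrow> brace3 x y z w f g 0 k = 0"
  "f \<in> W x \<Longrightarrow> g \<in> W y \<Longrightarrow> h \<in> W z \<Longrightarrow> brace3 x y z w f g h 0 = 0"
  by (simp_all add: brace3_def cmp_in)

text \<open>Splitting the slots around an inserted element presupposes that its degree is at least
  -1; in lower degrees the element is 0 and the identities are trivial.\<close>

lemma trivial_degree: "f \<in> W x \<Longrightarrow> f = 0 \<or> -1 \<le> x"
  using W_trivial[of x] by (cases "x < -1") auto

text \<open>When \<open>h\<close> is inserted into \<open>f{g}\<close>, a slot of \<open>g\<close>
  gives \<open>f{g{h}}\<close>, a slot of \<open>f\<close> to the right of \<open>g\<close> gives
  \<open>f{g, h}\<close>, and a slot to the left gives \<open>f{h, g}\<close> with the Koszul sign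
  for exchanging \<open>g\<close> and \<open>h\<close>. So the associator of the single brace is
  graded symmetric in \<open>g\<close> and \<open>h\<close>.\<close>

theorem pre_lie:
  assumes f: "f \<in> W x" and g: "g \<in> W y" and h: "h \<in> W z"
  shows "brace1 (x + y) z (brace1 x y f g) h =
    brace1 x (y + z) f (brace1 y z g h) + brace2 x y z f g h + sgn_act (y * z) (brace2 x z y f h g)"
proof (cases "g = 0")
  case True
  then show ?thesis using f h by simp
next
  case False
  then have y: "-1 \<le> y" using trivial_degree[OF g] by simp
  define T where "T i j = cmp (x + y) z j (cmp x y i f g) h" for i j
  have "brace1 (x + y) z (brace1 x y f g) h = (\<Sum>j=0..x + y. \<Sum>i=0..x. T i j)"
    unfolding brace1_def T_def by (intro sum.cong refl cmp_sum_left cmp_in f g h)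
  also have "\<dots> = (\<Sum>i=0..x. \<Sum>j=0..x + y. T i j)"
    by (rule sum.swap)
  also have "\<dots> = (\<Sum>i=0..x. (\<Sum>j=0..i - 1. T i j) + (\<Sum>j=0..y. T i (i + j)) +
      (\<Sum>j=i + 1..x. T i (j + y)))"
    by (intro sum.cong refl sum_slots y) auto
  also have "\<dots> = (\<Sum>i=0..x. \<Sum>j=0..i - 1. T i j) + (\<Sum>i=0..x. \<Sum>j=0..y. T i (i + j)) +
      (\<Sum>i=0..x. \<Sum>j=i + 1..x. T i (j + y))"
    by (simp add: sum.distrib)
  also have "(\<Sum>i=0..x. \<Sum>j=i + 1..x. T i (j + y)) = brace2 x y z f g h"
    by (simp add: brace2_def T_def)
  also have "(\<Sum>i=0..x. \<Sum>j=0..y. T i (i + j)) = brace1 x (y + z) f (brace1 y z g h)"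
  proof -
    have "(\<Sum>j=0..y. T i (i + j)) = cmp x (y + z) i f (brace1 y z g h)" for i
    proof -
      have "(\<Sum>j=0..y. T i (i + j)) = (\<Sum>j=0..y. cmp x (y + z) i f (cmp y z j g h))"
        unfolding T_def by (intro sum.cong refl cmp_inside' f g h) auto
      also have "\<dots> = cmp x (y + z) i f (brace1 y z g h)"
        unfolding brace1_def by (intro cmp_sum_right[symmetric] cmp_in f g h)
      finally show ?thesis .
    qed
    then show ?thesis by (simp add: brace1_def[of x])
  qed
  also have "(\<Sum>i=0..x. \<Sum>j=0..i - 1. T i j) = sgn_act (y * z) (brace2 x z y f h g)"
  proof -
    have "(\<Sum>i=0..x. \<Sum>j=0..i - 1. T i j) =
        (\<Sum>i=0..x. \<Sum>j=0..i - 1. sgn_act (y * z) (cmp (x + z) y (i + z) (cmp x z j f h) g))"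
      unfolding T_def by (intro sum.cong refl cmp_parallel f g h) auto
    also have "\<dots> = (\<Sum>j=0..x. \<Sum>i=j + 1..x. sgn_act (y * z) (cmp (x + z) y (i + z) (cmp x z j f h) g))"
      by (rule sum_triangle_swap)
    finally show ?thesis by (simp add: brace2_def sgn_act_sum)
  qed
  finally show ?thesis by (simp add: add_ac)
qed


text \<open>The slots of a composite in which \<open>g\<close> occupies slot \<open>i\<close> of \<open>f\<close> lie before, inside or after \<open>g\<close>.
  Both identities for iterated braces sort the summands of the left-hand side in this way.\<close>

theorem brace2_brace1:
  assumes f: "f \<in> W x" and g: "g \<in> W y" and h: "h \<in> W z" and k: "k \<in> W w"
  shows "brace1 (x + y + z) w (brace2 x y z f g h) k =
    brace2 x y (z + w) f g (brace1 z w h k) + sgn_act (z * w) (brace2 x (y + w) z f (brace1 y w g k) h)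
    + brace3 x y z w f g h k + sgn_act (z * w) (brace3 x y w z f g k h)
    + sgn_act (z * w + y * w) (brace3 x w y z f k g h)"
proof (cases "g = 0 \<or> h = 0")
  case True
  then show ?thesis using f g h k by (auto simp: brace1_in)
next
  case False
  then have y: "-1 \<le> y" and z: "-1 \<le> z" using trivial_degree[OF g] trivial_degree[OF h] by auto
  note [intro] = cmp_in' f g h k
  define P where "P i j = cmp (x + y) z (j + y) (cmp x y i f g) h" for i j
  define T where "T i j l = cmp (x + y + z) w l (P i j) k" for i j l
  have P: "P i j \<in> W (x + y + z)" for i j unfolding P_def by auto
  let ?I = "{0..x}"
  have "brace1 (x + y + z) w (brace2 x y z f g h) k =
      (\<Sum>l=0..x + y + z. \<Sum>i\<in>?I. \<Sum>j=i + 1..x. T i j l)"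
    unfolding brace1_def brace2_def T_def P_def[symmetric]
    by (simp add: cmp_sum_left k P W_sum)
  also have "\<dots> = (\<Sum>i\<in>?I. \<Sum>l=0..x + y + z. \<Sum>j=i + 1..x. T i j l)"
    by (rule sum.swap)
  also have "\<dots> = (\<Sum>i\<in>?I. \<Sum>j=i + 1..x. \<Sum>l=0..x + y + z. T i j l)"
    by (intro sum.cong refl sum.swap)
  \<comment> \<open>Relative to \<open>g\<close> and \<open>h\<close> there are five ranges for
    \<open>k\<close>: before \<open>g\<close>, inside \<open>g\<close>, between \<open>g\<close> and
    \<open>h\<close>, inside \<open>h\<close>, and after \<open>h\<close>.\<close>
  also have "\<dots> = (\<Sum>i\<in>?I. \<Sum>j=i + 1..x.
      (\<Sum>l=0..i - 1. T i j l) + (\<Sum>l=0..y. T i j (i + l)) + (\<Sum>l=i + 1..j - 1. T i j (l + y))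
      + (\<Sum>l=0..z. T i j (j + y + l)) + (\<Sum>l=j + 1..x. T i j (l + y + z)))"
    (is "_ = (\<Sum>i\<in>_. \<Sum>j\<in>?J i. ?R i j)")
  proof (intro sum.cong refl)
    fix i j assume ij: "i \<in> ?I" "j \<in> {i + 1..x}"
    have "(\<Sum>l=0..x + y + z. T i j l) = (\<Sum>l=0..j + y - 1. T i j l) +
        (\<Sum>l=0..z. T i j (j + y + l)) + (\<Sum>l=j + y + 1..x + y. T i j (l + z))"
      using ij y z by (intro sum_slots) auto
    also have "(\<Sum>l=j + y + 1..x + y. T i j (l + z)) = (\<Sum>l=j + 1..x. T i j (l + y + z))"
      using sum_shift_int[of "\<lambda>l. T i j (l + z)" "j + 1" y x] by (simp add: add_ac)
    also have "{0..j + y - 1} = {0..(j - 1) + y}" by (simp add: algebra_simps)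
    also have "(\<Sum>l=0..(j - 1) + y. T i j l) = (\<Sum>l=0..i - 1. T i j l) +
        (\<Sum>l=0..y. T i j (i + l)) + (\<Sum>l=i + 1..j - 1. T i j (l + y))"
      using ij y by (intro sum_slots) auto
    finally show "(\<Sum>l=0..x + y + z. T i j l) = ?R i j"
      by simp
  qed
  also have "\<dots> = (\<Sum>i\<in>?I. \<Sum>j=i + 1..x. \<Sum>l=0..i - 1. T i j l)
      + (\<Sum>i\<in>?I. \<Sum>j=i + 1..x. \<Sum>l=0..y. T i j (i + l))
      + (\<Sum>i\<in>?I. \<Sum>j=i + 1..x. \<Sum>l=i + 1..j - 1. T i j (l + y))
      + (\<Sum>i\<in>?I. \<Sum>j=i + 1..x. \<Sum>l=0..z. T i j (j + y + l))
      + (\<Sum>i\<in>?I. \<Sum>j=i + 1..x. \<Sum>l=j + 1..x. T i j (l + y + z))"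
    by (simp add: sum.distrib)
  also have "(\<Sum>i\<in>?I. \<Sum>j=i + 1..x. \<Sum>l=j + 1..x. T i j (l + y + z)) = brace3 x y z w f g h k"
    by (simp add: brace3_def T_def P_def)
  also have "(\<Sum>i\<in>?I. \<Sum>j=i + 1..x. \<Sum>l=0..z. T i j (j + y + l)) =
      brace2 x y (z + w) f g (brace1 z w h k)"
  proof -
    have "(\<Sum>l=0..z. T i j (j + y + l)) = cmp (x + y) (z + w) (j + y) (cmp x y i f g) (brace1 z w h k)" for i j
    proof -
      have "(\<Sum>l=0..z. T i j (j + y + l)) =
          (\<Sum>l=0..z. cmp (x + y) (z + w) (j + y) (cmp x y i f g) (cmp z w l h k))"
        unfolding T_def P_def by (intro sum.cong refl cmp_inside') auto
      also have "\<dots> = cmp (x + y) (z + w) (j + y) (cmp x y i f g) (brace1 z w h k)"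
        unfolding brace1_def by (intro cmp_sum_right[symmetric]) auto
      finally show ?thesis .
    qed
    then show ?thesis by (simp add: brace2_def)
  qed
  also have "(\<Sum>i\<in>?I. \<Sum>j=i + 1..x. \<Sum>l=i + 1..j - 1. T i j (l + y)) =
      sgn_act (z * w) (brace3 x y w z f g k h)"
  proof -
    have "(\<Sum>i\<in>?I. \<Sum>j=i + 1..x. \<Sum>l=i + 1..j - 1. T i j (l + y)) =
        (\<Sum>i\<in>?I. \<Sum>j=i + 1..x. \<Sum>l=i + 1..j - 1. sgn_act (z * w)
          (cmp (x + y + w) z (j + y + w) (cmp (x + y) w (l + y) (cmp x y i f g) k) h))"
      unfolding T_def P_def by (intro sum.cong refl cmp_parallel') auto
    also have "\<dots> = (\<Sum>i\<in>?I. \<Sum>l=i + 1..x. \<Sum>j=l + 1..x. sgn_act (z * w)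
          (cmp (x + y + w) z (j + y + w) (cmp (x + y) w (l + y) (cmp x y i f g) k) h))"
      by (intro sum.cong refl sum_triangle_swap)
    finally show ?thesis by (simp add: brace3_def sgn_act_sum)
  qed
  also have "(\<Sum>i\<in>?I. \<Sum>j=i + 1..x. \<Sum>l=0..y. T i j (i + l)) =
      sgn_act (z * w) (brace2 x (y + w) z f (brace1 y w g k) h)"
  proof -
    have "(\<Sum>l=0..y. T i j (i + l)) = sgn_act (z * w)
        (cmp (x + (y + w)) z (j + (y + w)) (cmp x (y + w) i f (brace1 y w g k)) h)"
      if "i \<in> ?I" "j \<in> {i + 1..x}" for i j
    proof -
      have "(\<Sum>l=0..y. T i j (i + l)) = (\<Sum>l=0..y. sgn_act (z * w)
          (cmp (x + (y + w)) z (j + (y + w)) (cmp (x + y) w (i + l) (cmp x y i f g) k) h))"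
        unfolding T_def P_def using that by (intro sum.cong refl cmp_parallel') auto
      also have "\<dots> = (\<Sum>l=0..y. sgn_act (z * w)
          (cmp (x + (y + w)) z (j + (y + w)) (cmp x (y + w) i f (cmp y w l g k)) h))"
        by (intro sum.cong refl arg_cong[of _ _ "sgn_act _"]
            arg_cong[of _ _ "\<lambda>u. cmp (x + (y + w)) z (j + (y + w)) u h"] cmp_inside') auto
      also have "\<dots> = sgn_act (z * w)
          (cmp (x + (y + w)) z (j + (y + w)) (cmp x (y + w) i f (brace1 y w g k)) h)"
        unfolding brace1_def
        by (subst cmp_sum_right, blast, blast, subst cmp_sum_left) (auto simp: sgn_act_sum)
      finally show ?thesis .
    qed
    then show ?thesis by (simp add: brace2_def sgn_act_sum)
  qed
  also have "(\<Sum>i\<in>?I. \<Sum>j=i + 1..x. \<Sum>l=0..i - 1. T i j l) =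
      sgn_act (z * w + y * w) (brace3 x w y z f k g h)"
  proof -
    let ?U = "\<lambda>l i j. cmp (x + w + y) z (j + w + y) (cmp (x + w) y (i + w) (cmp x w l f k) g) h"
    have "T i j l = sgn_act (z * w + y * w) (?U l i j)"
      if "i \<in> ?I" "j \<in> {i + 1..x}" "l \<in> {0..i - 1}" for i j l
    proof -
      \<comment> \<open>Here \<open>k\<close> lies to the left of both \<open>g\<close> and
        \<open>h\<close>; it is exchanged first with \<open>h\<close> and then with
        \<open>g\<close>, and each exchange contributes its sign.\<close>
      have "T i j l = sgn_act (z * w) (cmp (x + y + w) z (j + w + y) (cmp (x + y) w l (cmp x y i f g) k) h)"
        unfolding T_def P_def using that y by (intro cmp_parallel') auto
      also have "cmp (x + y) w l (cmp x y i f g) k = sgn_act (y * w) (cmp (x + w) y (i + w) (cmp x w l f k) g)"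
        using that by (intro cmp_parallel') auto
      also have "cmp (x + y + w) z (j + w + y) (sgn_act (y * w) (cmp (x + w) y (i + w) (cmp x w l f k) g)) h =
          sgn_act (y * w) (cmp (x + y + w) z (j + w + y) (cmp (x + w) y (i + w) (cmp x w l f k) g) h)"
        by (intro cmp_sgn_left) (simp_all add: cmp_in' f g h k)
      finally show ?thesis by (simp add: sgn_act_sgn_act add_ac)
    qed
    then have "(\<Sum>i\<in>?I. \<Sum>j=i + 1..x. \<Sum>l=0..i - 1. T i j l) =
        (\<Sum>i\<in>?I. \<Sum>j=i + 1..x. \<Sum>l=0..i - 1. sgn_act (z * w + y * w) (?U l i j))"
      by simp
    also have "\<dots> = (\<Sum>i\<in>?I. \<Sum>l=0..i - 1. \<Sum>j=i + 1..x. sgn_act (z * w + y * w) (?U l i j))"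
      by (intro sum.cong refl sum.swap)
    also have "\<dots> = (\<Sum>l\<in>?I. \<Sum>i=l + 1..x. \<Sum>j=i + 1..x. sgn_act (z * w + y * w) (?U l i j))"
      by (rule sum_triangle_swap)
    finally show ?thesis by (simp add: brace3_def sgn_act_sum)
  qed
  finally show ?thesis by (simp add: add_ac)
qed

theorem brace1_brace2:
  assumes f: "f \<in> W x" and k: "k \<in> W w" and g: "g \<in> W y" and h: "h \<in> W z"
  shows "brace2 (x + w) y z (brace1 x w f k) g h =
    brace1 x (w + y + z) f (brace2 w y z k g h) + brace2 x (w + y) z f (brace1 w y k g) h
    + sgn_act (w * y) (brace2 x y (w + z) f g (brace1 w z k h))
    + brace3 x w y z f k g h + sgn_act (w * y) (brace3 x y w z f g k h)
    + sgn_act (w * y + w * z) (brace3 x y z w f g h k)"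
proof (cases "k = 0 \<or> g = 0")
  case True
  then show ?thesis using f g h k by (auto simp: brace1_in brace2_in)
next
  case False
  then have w: "-1 \<le> w" and y: "-1 \<le> y" using trivial_degree[OF k] trivial_degree[OF g] by auto
  note [intro] = cmp_in' f g h k
  define T where "T i j l = cmp (x + w + y) z (l + y) (cmp (x + w) y j (cmp x w i f k) g) h" for i j l
  let ?I = "{0..x}"
  have "brace2 (x + w) y z (brace1 x w f k) g h =
      (\<Sum>j=0..x + w. \<Sum>l=j + 1..x + w. \<Sum>i\<in>?I. T i j l)"
    unfolding brace1_def brace2_def T_def
    by (intro sum.cong refl, subst cmp_sum_left, blast, blast, rule cmp_sum_left) auto
  also have "\<dots> = (\<Sum>j=0..x + w. \<Sum>i\<in>?I. \<Sum>l=j + 1..x + w. T i j l)"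
    by (intro sum.cong refl sum.swap)
  also have "\<dots> = (\<Sum>i\<in>?I. \<Sum>j=0..x + w. \<Sum>l=j + 1..x + w. T i j l)"
    by (rule sum.swap)
  \<comment> \<open>With \<open>k\<close> in slot \<open>i\<close> of \<open>f\<close>, each of
    \<open>g\<close> and \<open>h\<close> lies before, inside or after \<open>k\<close>. Since
    \<open>h\<close> lies to the right of \<open>g\<close>, six cases remain.\<close>
  also have "\<dots> = (\<Sum>i\<in>?I.
      (\<Sum>j=0..i - 1. (\<Sum>l=j + 1..i - 1. T i j l) + (\<Sum>l=0..w. T i j (i + l))
         + (\<Sum>l=i + 1..x. T i j (l + w)))
      + (\<Sum>j=0..w. (\<Sum>l=j + 1..w. T i (i + j) (i + l)) + (\<Sum>l=i + 1..x. T i (i + j) (l + w)))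
      + (\<Sum>j=i + 1..x. \<Sum>l=j + 1..x. T i (j + w) (l + w)))"
    (is "_ = (\<Sum>i\<in>_. ?R i)")
  proof (rule sum.cong[OF refl])
    fix i assume i: "i \<in> ?I"
    have "(\<Sum>j=0..x + w. \<Sum>l=j + 1..x + w. T i j l) =
        (\<Sum>j=0..i - 1. \<Sum>l=j + 1..x + w. T i j l)
      + (\<Sum>j=0..w. \<Sum>l=i + j + 1..x + w. T i (i + j) l)
      + (\<Sum>j=i + 1..x. \<Sum>l=j + w + 1..x + w. T i (j + w) l)"
      using i w by (intro sum_slots) auto
    also have "(\<Sum>j=0..i - 1. \<Sum>l=j + 1..x + w. T i j l) =
        (\<Sum>j=0..i - 1. (\<Sum>l=j + 1..i - 1. T i j l) + (\<Sum>l=0..w. T i j (i + l))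
         + (\<Sum>l=i + 1..x. T i j (l + w)))"
      using i w by (intro sum.cong refl sum_slots) auto
    also have "(\<Sum>j=0..w. \<Sum>l=i + j + 1..x + w. T i (i + j) l) =
        (\<Sum>j=0..w. (\<Sum>l=j + 1..w. T i (i + j) (i + l)) + (\<Sum>l=i + 1..x. T i (i + j) (l + w)))"
      using i by (intro sum.cong refl sum_slots_inside) auto
    also have "(\<Sum>j=i + 1..x. \<Sum>l=j + w + 1..x + w. T i (j + w) l) =
        (\<Sum>j=i + 1..x. \<Sum>l=j + 1..x. T i (j + w) (l + w))"
    proof (rule sum.cong[OF refl])
      show "(\<Sum>l=j + w + 1..x + w. T i (j + w) l) = (\<Sum>l=j + 1..x. T i (j + w) (l + w))" for j
        using sum_shift_int[of "T i (j + w)" "j + 1" w x] by (simp add: add_ac)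
    qed
    finally show "(\<Sum>j=0..x + w. \<Sum>l=j + 1..x + w. T i j l) = ?R i" .
  qed
  also have "\<dots> =
      (\<Sum>i\<in>?I. \<Sum>j=0..i - 1. \<Sum>l=j + 1..i - 1. T i j l)
    + (\<Sum>i\<in>?I. \<Sum>j=0..i - 1. \<Sum>l=0..w. T i j (i + l))
    + (\<Sum>i\<in>?I. \<Sum>j=0..i - 1. \<Sum>l=i + 1..x. T i j (l + w))
    + (\<Sum>i\<in>?I. \<Sum>j=0..w. \<Sum>l=j + 1..w. T i (i + j) (i + l))
    + (\<Sum>i\<in>?I. \<Sum>j=0..w. \<Sum>l=i + 1..x. T i (i + j) (l + w))
    + (\<Sum>i\<in>?I. \<Sum>j=i + 1..x. \<Sum>l=j + 1..x. T i (j + w) (l + w))"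
    by (simp add: sum.distrib add_ac)
  also have "(\<Sum>i\<in>?I. \<Sum>j=i + 1..x. \<Sum>l=j + 1..x. T i (j + w) (l + w)) = brace3 x w y z f k g h"
    by (simp add: brace3_def T_def)
  also have "(\<Sum>i\<in>?I. \<Sum>j=0..w. \<Sum>l=i + 1..x. T i (i + j) (l + w)) =
      brace2 x (w + y) z f (brace1 w y k g) h"
  proof -
    have "(\<Sum>j=0..w. \<Sum>l=i + 1..x. T i (i + j) (l + w)) =
        (\<Sum>l=i + 1..x. cmp (x + (w + y)) z (l + (w + y)) (cmp x (w + y) i f (brace1 w y k g)) h)" for i
    proof -
      have "T i (i + j) (l + w) = cmp (x + (w + y)) z (l + (w + y)) (cmp x (w + y) i f (cmp w y j k g)) h"
        if "j \<in> {0..w}" for j l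
      proof -
        have "cmp (x + w) y (i + j) (cmp x w i f k) g = cmp x (w + y) i f (cmp w y j k g)"
          using that by (intro cmp_inside') auto
        then show ?thesis by (simp add: T_def add_ac)
      qed
      then have "(\<Sum>j=0..w. \<Sum>l=i + 1..x. T i (i + j) (l + w)) = (\<Sum>j=0..w. \<Sum>l=i + 1..x.
          cmp (x + (w + y)) z (l + (w + y)) (cmp x (w + y) i f (cmp w y j k g)) h)"
        by simp
      also have "\<dots> = (\<Sum>l=i + 1..x. \<Sum>j=0..w.
          cmp (x + (w + y)) z (l + (w + y)) (cmp x (w + y) i f (cmp w y j k g)) h)"
        by (rule sum.swap)
      also have "\<dots> = (\<Sum>l=i + 1..x.
          cmp (x + (w + y)) z (l + (w + y)) (cmp x (w + y) i f (brace1 w y k g)) h)"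
        unfolding brace1_def
        by (intro sum.cong refl, subst cmp_sum_right, blast, blast, subst cmp_sum_left) auto
      finally show ?thesis .
    qed
    then show ?thesis by (simp add: brace2_def)
  qed
  also have "(\<Sum>i\<in>?I. \<Sum>j=0..w. \<Sum>l=j + 1..w. T i (i + j) (i + l)) =
      brace1 x (w + y + z) f (brace2 w y z k g h)"
  proof -
    have "(\<Sum>j=0..w. \<Sum>l=j + 1..w. T i (i + j) (i + l)) =
        cmp x (w + y + z) i f (brace2 w y z k g h)" for i
    proof -
      have "T i (i + j) (i + l) = cmp x (w + y + z) i f (cmp (w + y) z (l + y) (cmp w y j k g) h)"
        if "j \<in> {0..w}" "l \<in> {j + 1..w}" for j l
      proof -
        have "cmp (x + w) y (i + j) (cmp x w i f k) g = cmp x (w + y) i f (cmp w y j k g)"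
          using that by (intro cmp_inside') auto
        then have "T i (i + j) (i + l) = cmp (x + w + y) z (i + l + y) (cmp x (w + y) i f (cmp w y j k g)) h"
          by (simp add: T_def)
        also have "\<dots> = cmp x (w + y + z) i f (cmp (w + y) z (l + y) (cmp w y j k g) h)"
          using that y by (intro cmp_inside') auto
        finally show ?thesis .
      qed
      then have "(\<Sum>j=0..w. \<Sum>l=j + 1..w. T i (i + j) (i + l)) = (\<Sum>j=0..w. \<Sum>l=j + 1..w.
          cmp x (w + y + z) i f (cmp (w + y) z (l + y) (cmp w y j k g) h))"
        by simp
      also have "\<dots> = cmp x (w + y + z) i f (brace2 w y z k g h)"
        unfolding brace2_def by (subst cmp_sum_right, blast, blast intro: W_sum, subst cmp_sum_right) auto
      finally show ?thesis .
    qed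
    then show ?thesis by (simp add: brace1_def)
  qed
  also have "(\<Sum>i\<in>?I. \<Sum>j=0..i - 1. \<Sum>l=i + 1..x. T i j (l + w)) =
      sgn_act (w * y) (brace3 x y w z f g k h)"
  proof -
    let ?U = "\<lambda>j i l. cmp (x + y + w) z (l + y + w) (cmp (x + y) w (i + y) (cmp x y j f g) k) h"
    have "T i j (l + w) = sgn_act (w * y) (?U j i l)" if "j \<in> {0..i - 1}" for i j l
    proof -
      have "cmp (x + w) y j (cmp x w i f k) g = sgn_act (w * y) (cmp (x + y) w (i + y) (cmp x y j f g) k)"
        using that by (intro cmp_parallel') auto
      then have "T i j (l + w) =
          cmp (x + w + y) z (l + w + y) (sgn_act (w * y) (cmp (x + y) w (i + y) (cmp x y j f g) k)) h"
        by (simp add: T_def)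
      also have "\<dots> = sgn_act (w * y) (cmp (x + w + y) z (l + w + y) (cmp (x + y) w (i + y) (cmp x y j f g) k) h)"
        by (intro cmp_sgn_left) (simp_all add: cmp_in' f g h k)
      finally show ?thesis by (simp add: add_ac)
    qed
    then have "(\<Sum>i\<in>?I. \<Sum>j=0..i - 1. \<Sum>l=i + 1..x. T i j (l + w)) =
        (\<Sum>i\<in>?I. \<Sum>j=0..i - 1. \<Sum>l=i + 1..x. sgn_act (w * y) (?U j i l))"
      by simp
    also have "\<dots> = (\<Sum>j\<in>?I. \<Sum>i=j + 1..x. \<Sum>l=i + 1..x. sgn_act (w * y) (?U j i l))"
      by (rule sum_triangle_swap)
    finally show ?thesis by (simp add: brace3_def sgn_act_sum)
  qed
  also have "(\<Sum>i\<in>?I. \<Sum>j=0..i - 1. \<Sum>l=0..w. T i j (i + l)) =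
      sgn_act (w * y) (brace2 x y (w + z) f g (brace1 w z k h))"
  proof -
    let ?U = "\<lambda>j i. cmp (x + y) (w + z) (i + y) (cmp x y j f g) (brace1 w z k h)"
    have "(\<Sum>l=0..w. T i j (i + l)) = sgn_act (w * y) (?U j i)" if "j \<in> {0..i - 1}" for i j
    proof -
      have "T i j (i + l) = sgn_act (w * y) (cmp (x + y) (w + z) (i + y) (cmp x y j f g) (cmp w z l k h))"
        if l: "l \<in> {0..w}" for l
      proof -
        have "cmp (x + w) y j (cmp x w i f k) g = sgn_act (w * y) (cmp (x + y) w (i + y) (cmp x y j f g) k)"
          using \<open>j \<in> {0..i - 1}\<close> by (intro cmp_parallel') auto
        then have "T i j (i + l) =
            cmp (x + w + y) z (i + l + y) (sgn_act (w * y) (cmp (x + y) w (i + y) (cmp x y j f g) k)) h"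
          by (simp add: T_def)
        also have "\<dots> = sgn_act (w * y) (cmp (x + w + y) z (i + l + y) (cmp (x + y) w (i + y) (cmp x y j f g) k) h)"
          by (intro cmp_sgn_left) (simp_all add: cmp_in' f g h k)
        also have "cmp (x + w + y) z (i + l + y) (cmp (x + y) w (i + y) (cmp x y j f g) k) h =
            cmp (x + y) (w + z) (i + y) (cmp x y j f g) (cmp w z l k h)"
          using l by (intro cmp_inside') auto
        finally show ?thesis .
      qed
      then have "(\<Sum>l=0..w. T i j (i + l)) =
          (\<Sum>l=0..w. sgn_act (w * y) (cmp (x + y) (w + z) (i + y) (cmp x y j f g) (cmp w z l k h)))"
        by simp
      also have "\<dots> = sgn_act (w * y) (?U j i)"
        unfolding brace1_def by (subst cmp_sum_right) (auto simp: sgn_act_sum)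
      finally show ?thesis .
    qed
    then have "(\<Sum>i\<in>?I. \<Sum>j=0..i - 1. \<Sum>l=0..w. T i j (i + l)) =
        (\<Sum>i\<in>?I. \<Sum>j=0..i - 1. sgn_act (w * y) (?U j i))"
      by simp
    also have "\<dots> = (\<Sum>j\<in>?I. \<Sum>i=j + 1..x. sgn_act (w * y) (?U j i))"
      by (rule sum_triangle_swap)
    finally show ?thesis by (simp add: brace2_def sgn_act_sum)
  qed
  also have "(\<Sum>i\<in>?I. \<Sum>j=0..i - 1. \<Sum>l=j + 1..i - 1. T i j l) =
      sgn_act (w * y + w * z) (brace3 x y z w f g h k)"
  proof -
    let ?U = "\<lambda>j l i. cmp (x + y + z) w (i + y + z) (cmp (x + y) z (l + y) (cmp x y j f g) h) k"
    have "T i j l = sgn_act (w * y + w * z) (?U j l i)"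
      if "j \<in> {0..i - 1}" "l \<in> {j + 1..i - 1}" for i j l
    proof -
      have "cmp (x + w) y j (cmp x w i f k) g = sgn_act (w * y) (cmp (x + y) w (i + y) (cmp x y j f g) k)"
        using that by (intro cmp_parallel') auto
      then have "T i j l =
          cmp (x + w + y) z (l + y) (sgn_act (w * y) (cmp (x + y) w (i + y) (cmp x y j f g) k)) h"
        by (simp add: T_def)
      also have "\<dots> = sgn_act (w * y) (cmp (x + w + y) z (l + y) (cmp (x + y) w (i + y) (cmp x y j f g) k) h)"
        by (intro cmp_sgn_left) (simp_all add: cmp_in' f g h k)
      also have "cmp (x + w + y) z (l + y) (cmp (x + y) w (i + y) (cmp x y j f g) k) h =
          sgn_act (w * z) (?U j l i)"
        using that by (intro cmp_parallel') auto
      finally show ?thesis by (simp add: sgn_act_sgn_act)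
    qed
    then have "(\<Sum>i\<in>?I. \<Sum>j=0..i - 1. \<Sum>l=j + 1..i - 1. T i j l) =
        (\<Sum>i\<in>?I. \<Sum>j=0..i - 1. \<Sum>l=j + 1..i - 1. sgn_act (w * y + w * z) (?U j l i))"
      by simp
    also have "\<dots> = (\<Sum>j\<in>?I. \<Sum>i=j + 1..x. \<Sum>l=j + 1..i - 1. sgn_act (w * y + w * z) (?U j l i))"
      by (rule sum_triangle_swap)
    also have "\<dots> = (\<Sum>j\<in>?I. \<Sum>l=j + 1..x. \<Sum>i=l + 1..x. sgn_act (w * y + w * z) (?U j l i))"
      by (intro sum.cong refl sum_triangle_swap)
    finally show ?thesis by (simp add: brace3_def sgn_act_sum)
  qed
  finally show ?thesis by (simp add: add_ac)
qed

section \<open>Linearity of the braces\<close>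

lemma brace1_add_left: "\<lbrakk>f \<in> W x; f' \<in> W x; g \<in> W y\<rbrakk> \<Longrightarrow>
    brace1 x y (f + f') g = brace1 x y f g + brace1 x y f' g"
  by (simp add: brace1_def cmp_add_left sum.distrib)

lemma brace1_add_right: "\<lbrakk>f \<in> W x; g \<in> W y; g' \<in> W y\<rbrakk> \<Longrightarrow>
    brace1 x y f (g + g') = brace1 x y f g + brace1 x y f g'"
  by (simp add: brace1_def cmp_add_right sum.distrib)

lemma brace1_minus_left: "\<lbrakk>f \<in> W x; g \<in> W y\<rbrakk> \<Longrightarrow> brace1 x y (- f) g = - brace1 x y f g"
  by (simp add: brace1_def cmp_minus_left sum_negf)

lemma brace1_minus_right: "\<lbrakk>f \<in> W x; g \<in> W y\<rbrakk> \<Longrightarrow> brace1 x y f (- g) = - brace1 x y f g"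
  by (simp add: brace1_def cmp_minus_right sum_negf)

lemma brace1_diff_left: "\<lbrakk>f \<in> W x; f' \<in> W x; g \<in> W y\<rbrakk> \<Longrightarrow>
    brace1 x y (f - f') g = brace1 x y f g - brace1 x y f' g"
  using brace1_add_left[of f x "- f'" g y] by (simp add: W_neg brace1_minus_left)

lemma brace1_diff_right: "\<lbrakk>f \<in> W x; g \<in> W y; g' \<in> W y\<rbrakk> \<Longrightarrow>
    brace1 x y f (g - g') = brace1 x y f g - brace1 x y f g'"
  using brace1_add_right[of f x g y "- g'"] by (simp add: W_neg brace1_minus_right)

lemma brace1_scale: "\<lbrakk>f \<in> W x; g \<in> W y\<rbrakk> \<Longrightarrow> brace1 x y (sc l f) g = sc l (brace1 x y f g)"
   "\<lbrakk>f \<in> W x; g \<in> W y\<rbrakk> \<Longrightarrow> brace1 x y f (sc l g) = sc l (brace1 x y f g)"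
  by (simp_all add: brace1_def cmp_scale_left cmp_scale_right scale_sum_right)

lemma brace2_add:
  "\<lbrakk>f \<in> W x; g \<in> W y; g' \<in> W y; h \<in> W z\<rbrakk> \<Longrightarrow>
    brace2 x y z f (g + g') h = brace2 x y z f g h + brace2 x y z f g' h"
  "\<lbrakk>f \<in> W x; g \<in> W y; h \<in> W z; h' \<in> W z\<rbrakk> \<Longrightarrow>
    brace2 x y z f g (h + h') = brace2 x y z f g h + brace2 x y z f g h'"
  by (simp_all add: brace2_def cmp_add_left cmp_add_right cmp_in sum.distrib)

lemma brace2_minus:
  "\<lbrakk>f \<in> W x; g \<in> W y; h \<in> W z\<rbrakk> \<Longrightarrow> brace2 x y z (- f) g h = - brace2 x y z f g h"
  "\<lbrakk>f \<in> W x; g \<in> W y; h \<in> W z\<rbrakk> \<Longrightarrow> brace2 x y z f (- g) h = - brace2 x y z f g h"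
  "\<lbrakk>f \<in> W x; g \<in> W y; h \<in> W z\<rbrakk> \<Longrightarrow> brace2 x y z f g (- h) = - brace2 x y z f g h"
  by (simp_all add: brace2_def cmp_minus_left cmp_minus_right cmp_in sum_negf)

lemma brace2_diff:
  "\<lbrakk>f \<in> W x; g \<in> W y; g' \<in> W y; h \<in> W z\<rbrakk> \<Longrightarrow>
    brace2 x y z f (g - g') h = brace2 x y z f g h - brace2 x y z f g' h"
  "\<lbrakk>f \<in> W x; g \<in> W y; h \<in> W z; h' \<in> W z\<rbrakk> \<Longrightarrow>
    brace2 x y z f g (h - h') = brace2 x y z f g h - brace2 x y z f g h'"
  using brace2_add(1)[of f x g y "- g'" h z] brace2_add(2)[of f x g y h z "- h'"]
  by (simp_all add: W_neg brace2_minus)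

lemma brace2_scale:
  "\<lbrakk>f \<in> W x; g \<in> W y; h \<in> W z\<rbrakk> \<Longrightarrow> brace2 x y z f (sc l g) h = sc l (brace2 x y z f g h)"
  "\<lbrakk>f \<in> W x; g \<in> W y; h \<in> W z\<rbrakk> \<Longrightarrow> brace2 x y z f g (sc l h) = sc l (brace2 x y z f g h)"
  by (simp_all add: brace2_def cmp_scale_left cmp_scale_right cmp_in scale_sum_right)

lemmas brace_linear = brace1_minus_left brace1_minus_right brace1_diff_left brace1_diff_right
  brace2_minus brace2_diff brace1_add_left brace1_add_right brace2_add

text \<open>Three arguments do not fit into the two slots of \<open>\<alpha>\<close>. This removes
  the threefold braces from the expansion of every brace with \<open>\<alpha>\<close>
  outermost.\<close>

lemma brace3_al: "brace3 1 y z w f g h k = 0"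
  by (auto simp: brace3_def intro!: sum.neutral)

lemma brace1_al_al: "brace1 1 1 al al = 0"
proof -
  have "{0..1::int} = {0, 1}" by auto
  then show ?thesis using al_al by (simp add: brace1_def)
qed

text \<open>The only pair of distinct slots of \<open>\<alpha>\<close> is (0, 1), so the double
  brace is a single iterated insertion; this links it to the cup product.\<close>

lemma brace2_al: "brace2 1 y z al g h = cmp (1 + y) z (1 + y) (cmp 1 y 0 al g) h"
proof -
  have "{0..1::int} = {0, 1}" by auto
  then show ?thesis by (simp add: brace2_def)
qed

section \<open>Bracket, differential, cup product and the homotopies between them\<close>

definition lie :: "int \<Rightarrow> int \<Rightarrow> 'v \<Rightarrow> 'v \<Rightarrow> 'v"
  where "lie x y f g = brace1 x y f g - sgn_act (x * y) (brace1 y x g f)"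

definition dlt :: "int \<Rightarrow> 'v \<Rightarrow> 'v"
  where "dlt x f = lie x 1 f al"

text \<open>In \<open>\<alpha>{f, g}\<close> the element \<open>g\<close> is inserted into slot
  \<open>x + 1\<close> of the composite of \<open>\<alpha>\<close> and \<open>f\<close>, which
  carries the sign with exponent \<open>(x + 1) * y\<close>. The same sign here cancels it, and the
  unsigned product of the complex remains.\<close>

definition cupp :: "int \<Rightarrow> int \<Rightarrow> 'v \<Rightarrow> 'v \<Rightarrow> 'v"
  where "cupp x y f g = sgn_act ((x + 1) * y) (brace2 1 x y al f g)"

lemma lie_in: "\<lbrakk>f \<in> W x; g \<in> W y; u = x + y\<rbrakk> \<Longrightarrow> lie x y f g \<in> W u"
  by (simp add: lie_def W_diff W_sgn brace1_in)

lemma dlt_in: "\<lbrakk>f \<in> W x; u = x + 1\<rbrakk> \<Longrightarrow> dlt x f \<in> W u"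
  by (simp add: dlt_def lie_in al_in)

lemma cupp_in: "\<lbrakk>f \<in> W x; g \<in> W y; u = x + y + 1\<rbrakk> \<Longrightarrow> cupp x y f g \<in> W u"
  by (simp add: cupp_def W_sgn brace2_in al_in)

lemma lie_linear:
  "\<lbrakk>f \<in> W x; f' \<in> W x; g \<in> W y\<rbrakk> \<Longrightarrow> lie x y (f + f') g = lie x y f g + lie x y f' g"
  "\<lbrakk>f \<in> W x; f' \<in> W x; g \<in> W y\<rbrakk> \<Longrightarrow> lie x y (f - f') g = lie x y f g - lie x y f' g"
  "\<lbrakk>f \<in> W x; g \<in> W y\<rbrakk> \<Longrightarrow> lie x y (- f) g = - lie x y f g"
  "\<lbrakk>f \<in> W x; g \<in> W y\<rbrakk> \<Longrightarrow> lie x y (sc l f) g = sc l (lie x y f g)"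
  "\<lbrakk>f \<in> W x; g \<in> W y; g' \<in> W y\<rbrakk> \<Longrightarrow> lie x y f (g + g') = lie x y f g + lie x y f g'"
  "\<lbrakk>f \<in> W x; g \<in> W y; g' \<in> W y\<rbrakk> \<Longrightarrow> lie x y f (g - g') = lie x y f g - lie x y f g'"
  "\<lbrakk>f \<in> W x; g \<in> W y\<rbrakk> \<Longrightarrow> lie x y f (- g) = - lie x y f g"
  "\<lbrakk>f \<in> W x; g \<in> W y\<rbrakk> \<Longrightarrow> lie x y f (sc l g) = sc l (lie x y f g)"
  by (simp_all add: lie_def brace_linear brace1_add_left brace1_add_right brace1_scale sgn_act_def
      scale_right_diff_distrib scale_right_distrib)

lemma dlt_linear:
  "\<lbrakk>f \<in> W x; f' \<in> W x\<rbrakk> \<Longrightarrow> dlt x (f + f') = dlt x f + dlt x f'"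
  "\<lbrakk>f \<in> W x; f' \<in> W x\<rbrakk> \<Longrightarrow> dlt x (f - f') = dlt x f - dlt x f'"
  "f \<in> W x \<Longrightarrow> dlt x (- f) = - dlt x f"
  "f \<in> W x \<Longrightarrow> dlt x (sc l f) = sc l (dlt x f)"
  by (simp_all add: dlt_def lie_linear al_in)

lemma cupp_linear:
  "\<lbrakk>f \<in> W x; f' \<in> W x; g \<in> W y\<rbrakk> \<Longrightarrow> cupp x y (f + f') g = cupp x y f g + cupp x y f' g"
  "\<lbrakk>f \<in> W x; f' \<in> W x; g \<in> W y\<rbrakk> \<Longrightarrow> cupp x y (f - f') g = cupp x y f g - cupp x y f' g"
  "\<lbrakk>f \<in> W x; g \<in> W y\<rbrakk> \<Longrightarrow> cupp x y (- f) g = - cupp x y f g"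
  "\<lbrakk>f \<in> W x; g \<in> W y\<rbrakk> \<Longrightarrow> cupp x y (sc l f) g = sc l (cupp x y f g)"
  "\<lbrakk>f \<in> W x; g \<in> W y; g' \<in> W y\<rbrakk> \<Longrightarrow> cupp x y f (g + g') = cupp x y f g + cupp x y f g'"
  "\<lbrakk>f \<in> W x; g \<in> W y; g' \<in> W y\<rbrakk> \<Longrightarrow> cupp x y f (g - g') = cupp x y f g - cupp x y f g'"
  "\<lbrakk>f \<in> W x; g \<in> W y\<rbrakk> \<Longrightarrow> cupp x y f (- g) = - cupp x y f g"
  "\<lbrakk>f \<in> W x; g \<in> W y\<rbrakk> \<Longrightarrow> cupp x y f (sc l g) = sc l (cupp x y f g)"
  by (simp_all add: cupp_def brace_linear brace2_add brace2_scale sgn_act_def al_in)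

lemma pre_lie':
  "\<lbrakk>f \<in> W x; g \<in> W y; h \<in> W z; u = x + y; v = y + z\<rbrakk> \<Longrightarrow>
    brace1 u z (brace1 x y f g) h =
    brace1 x v f (brace1 y z g h) + brace2 x y z f g h + sgn_act (y * z) (brace2 x z y f h g)"
  by (simp add: pre_lie)

lemma lie_antisym: "lie x y f g = - sgn_act (x * y) (lie y x g f)"
  by (simp add: lie_def sgn_act_def mult.commute)

text \<open>\<open>pre_lie\<close>, applied to the six orders of the three elements, rewrites each
  brace nested on the left as one nested on the right plus two double braces. The right nested ones
  cancel in pairs, and so do the double braces. The signs depend only on the parities of the
  degrees, which leaves eight cases.\<close>

lemma lie_jacobi:
  assumes f: "f \<in> W x" and g: "g \<in> W y" and h: "h \<in> W z"
  shows "sgn_act (x * z) (lie x (y + z) f (lie y z g h)) + sgn_act (y * x) (lie y (z + x) g (lie z x h f))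
    + sgn_act (z * y) (lie z (x + y) h (lie x y f g)) = 0"
proof -
  note [simp] = f g h brace1_in
  have PL: "brace1 (x + y) z (brace1 x y f g) h =
      brace1 x (y + z) f (brace1 y z g h) + brace2 x y z f g h + sgn_act (y * z) (brace2 x z y f h g)"
    "brace1 (x + y) z (brace1 y x g f) h =
      brace1 y (z + x) g (brace1 x z f h) + brace2 y x z g f h + sgn_act (x * z) (brace2 y z x g h f)"
    "brace1 (z + x) y (brace1 x z f h) g =
      brace1 x (y + z) f (brace1 z y h g) + brace2 x z y f h g + sgn_act (z * y) (brace2 x y z f g h)"
    "brace1 (z + x) y (brace1 z x h f) g =
      brace1 z (x + y) h (brace1 x y f g) + brace2 z x y h f g + sgn_act (x * y) (brace2 z y x h g f)"
    "brace1 (y + z) x (brace1 y z g h) f =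
      brace1 y (z + x) g (brace1 z x h f) + brace2 y z x g h f + sgn_act (z * x) (brace2 y x z g f h)"
    "brace1 (y + z) x (brace1 z y h g) f =
      brace1 z (x + y) h (brace1 y x g f) + brace2 z y x h g f + sgn_act (y * x) (brace2 z x y h f g)"
    by (rule pre_lie'; simp)+
  show ?thesis
    by (cases "even x"; cases "even y"; cases "even z";
        simp add: lie_def sgn_act_def brace_linear W_diff W_neg W_add PL;
        (simp add: algebra_simps)?)
qed

text \<open>The Jacobi identity rearranged so that bracketing with \<open>h\<close> on the right is
  a graded derivation; with \<open>\<alpha>\<close> for \<open>h\<close> it becomes the Leibniz rule
  for the differential.\<close>

lemma lie_lie:
  assumes f: "f \<in> W x" and g: "g \<in> W y" and h: "h \<in> W z"
  shows "lie (x + y) z (lie x y f g) h =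
    lie x (y + z) f (lie y z g h) + sgn_act (y * z) (lie (x + z) y (lie x z f h) g)"
proof -
  note [simp] = f g h lie_in
  have 1: "lie z (x + y) h (lie x y f g) = - sgn_act (z * (x + y)) (lie (x + y) z (lie x y f g) h)"
    by (rule lie_antisym)
  have "lie y (z + x) g (lie z x h f) = - sgn_act (y * (z + x)) (lie (z + x) y (lie z x h f) g)"
    by (rule lie_antisym)
  also have "lie z x h f = - sgn_act (z * x) (lie x z f h)"
    by (rule lie_antisym)
  finally have 2: "lie y (z + x) g (- sgn_act (z * x) (lie x z f h)) =
      - sgn_act (y * (z + x)) (lie (z + x) y (- sgn_act (z * x) (lie x z f h)) g)" .
  have 3: "lie z x h f = - sgn_act (z * x) (lie x z f h)"
    by (rule lie_antisym)
  show ?thesis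
    using lie_jacobi[OF f g h] unfolding 1 2 3
    by (cases "even x"; cases "even y"; cases "even z";
        simp add: sgn_act_def lie_linear add.commute[of z x] add_eq_0_iff2;
        (simp add: algebra_simps)?)
qed

text \<open>The Jacobi identity yields only that twice \<open>dlt (dlt f)\<close> vanishes, which
  says nothing in characteristic 2. So \<open>pre_lie\<close> and
  \<open>\<alpha>{\<alpha>} = 0\<close> are used directly.\<close>

lemma dlt_dlt: "f \<in> W x \<Longrightarrow> dlt (x + 1) (dlt x f) = 0"
proof -
  assume f: "f \<in> W x"
  note [simp] = f al_in brace1_in
  have "brace1 (x + 1) 1 (brace1 x 1 f al) al = brace1 x (1 + 1) f (brace1 1 1 al al)
      + brace2 x 1 1 f al al + sgn_act (1 * 1) (brace2 x 1 1 f al al)"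
    by (rule pre_lie; simp)
  \<comment> \<open>The two copies of \<open>f{\<alpha>, \<alpha>}\<close> cancel because
    \<open>\<alpha>\<close> is odd.\<close>
  then have 1: "brace1 (x + 1) 1 (brace1 x 1 f al) al = 0"
    by (simp add: brace1_al_al sgn_act_def)
  have 2: "brace1 (x + 1) 1 (brace1 1 x al f) al = brace1 1 (x + 1) al (brace1 x 1 f al)
      + brace2 1 x 1 al f al + sgn_act (x * 1) (brace2 1 1 x al al f)"
    by (rule pre_lie'; simp)
  have "brace1 (1 + 1) x (brace1 1 1 al al) f = brace1 1 (x + 1) al (brace1 1 x al f)
      + brace2 1 1 x al al f + sgn_act (1 * x) (brace2 1 x 1 al f al)"
    by (rule pre_lie'; simp)
  then have 3: "brace1 1 (x + 1) al (brace1 1 x al f) = - brace2 1 1 x al al f - sgn_act x (brace2 1 x 1 al f al)"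
    by (simp add: brace1_al_al algebra_simps eq_neg_iff_add_eq_0)
  show ?thesis
    by (cases "even x";
        simp add: dlt_def lie_def sgn_act_def brace_linear W_neg 1 2 3;
        (simp add: algebra_simps)?)
qed

lemma dlt_lie:
  assumes f: "f \<in> W x" and g: "g \<in> W y"
  shows "dlt (x + y) (lie x y f g) = lie x (y + 1) f (dlt y g) + sgn_act y (lie (x + 1) y (dlt x f) g)"
  unfolding dlt_def using lie_lie[OF f g al_in] by simp

text \<open>Expanding \<open>\<alpha>{\<alpha>}{f, g} = 0\<close> expresses
  \<open>\<alpha>{\<alpha>{f, g}}\<close> through \<open>\<alpha>{\<alpha>{f}, g}\<close> and
  \<open>\<alpha>{f, \<alpha>{g}}\<close>. These supply the parts \<open>\<alpha>{f}\<close> and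
  \<open>\<alpha>{g}\<close> of the differentials of \<open>f\<close> and \<open>g\<close>; the
  parts \<open>f{\<alpha>}\<close> and \<open>g{\<alpha>}\<close> come from
  \<open>\<alpha>{f, g}{\<alpha>}\<close>.\<close>

lemma dlt_brace2_al:
  assumes f: "f \<in> W x" and g: "g \<in> W y"
  shows "dlt (x + y + 1) (brace2 1 x y al f g) =
    brace2 1 x (y + 1) al f (dlt y g) + sgn_act y (brace2 1 (x + 1) y al (dlt x f) g)"
proof -
  note [simp] = f g al_in brace1_in brace2_in
  have 1: "brace1 (x + y + 1) 1 (brace2 1 x y al f g) al = brace2 1 x (y + 1) al f (brace1 y 1 g al)
      + sgn_act y (brace2 1 (x + 1) y al (brace1 x 1 f al) g)"
    using brace2_brace1[OF al_in f g al_in] by (simp add: brace3_al add_ac)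
  have "0 = brace1 1 (x + y + 1) al (brace2 1 x y al f g)
      + brace2 1 (x + 1) y al (brace1 1 x al f) g + sgn_act x (brace2 1 x (y + 1) al f (brace1 1 y al g))"
    using brace1_brace2[OF al_in al_in f g] by (simp add: brace3_al add_ac brace1_al_al)
  then have 2: "brace1 1 (x + y + 1) al (brace2 1 x y al f g) =
      - brace2 1 (x + 1) y al (brace1 1 x al f) g - sgn_act x (brace2 1 x (y + 1) al f (brace1 1 y al g))"
    by (simp add: algebra_simps eq_neg_iff_add_eq_0)
  show ?thesis
    by (cases "even x"; cases "even y";
        simp add: dlt_def lie_def sgn_act_def brace_linear W_neg 1 2;
        (simp add: algebra_simps)?)
qed

lemma dlt_cupp:
  assumes f: "f \<in> W x" and g: "g \<in> W y"
  shows "dlt (x + y + 1) (cupp x y f g) =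
    sgn_act (x + 1) (cupp x (y + 1) f (dlt y g)) + cupp (x + 1) y (dlt x f) g"
  using dlt_brace2_al[OF f g] f g
  by (cases "even x"; cases "even y";
        simp add: cupp_def sgn_act_def dlt_linear brace2_in al_in add_ac;
        (simp add: algebra_simps)?)

text \<open>Associativity holds already on cochains. In \<open>\<alpha>{\<alpha>{f, g}, h}\<close>
  the inner \<open>\<alpha>\<close> sits in slot 0 of the outer one; \<open>al_al\<close> moves it
  to slot 1, and \<open>cmp_parallel\<close> then moves it past \<open>f\<close>. Up to sign the
  result is \<open>\<alpha>{f, \<alpha>{g, h}}\<close>.\<close>

lemma cupp_assoc:
  assumes f: "f \<in> W x" and g: "g \<in> W y" and h: "h \<in> W z"
  shows "cupp (x + y + 1) z (cupp x y f g) h = cupp x (y + z + 1) f (cupp y z g h)"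
proof -
  note [simp] = f g h al_in cmp_in'
  show ?thesis
  proof (cases "f = 0 \<or> g = 0")
    case True
    then show ?thesis by (auto simp: cupp_def brace2_in W_sgn)
  next
    case False
    then have x: "-1 \<le> x" and y: "-1 \<le> y" using trivial_degree[OF f] trivial_degree[OF g] by auto
    let ?f = "cmp 1 x 0 al f"
    have f': "?f \<in> W (1 + x)" by simp
    have "cmp 1 (x + y + 1) 0 al (brace2 1 x y al f g) =
        cmp 1 (x + y + 1) 0 al (cmp (1 + x) y (1 + x) ?f g)"
      by (simp add: brace2_al)
    also have "\<dots> = cmp (x + 2) y (1 + x) (cmp 1 (1 + x) 0 al ?f) g"
      using x by (intro cmp_inside'[symmetric]) auto
    also have "cmp 1 (1 + x) 0 al ?f = cmp 2 x 0 (cmp 1 1 0 al al) f"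
      by (intro cmp_inside'[symmetric]) auto
    also have "cmp 1 1 0 al al = - cmp 1 1 1 al al"
      using al_al by (simp add: eq_neg_iff_add_eq_0)
    also have "cmp 2 x 0 (- cmp 1 1 1 al al) f = - cmp 2 x 0 (cmp 1 1 1 al al) f"
      by (intro cmp_minus_left) auto
    also have "cmp 2 x 0 (cmp 1 1 1 al al) f = sgn_act x (cmp (1 + x) 1 (1 + x) ?f al)"
      using cmp_parallel'[OF al_in al_in f, of 0 1 2 "1 + x" "1 + x"] by simp
    also have "- sgn_act x (cmp (1 + x) 1 (1 + x) ?f al) = sgn_act (x + 1) (cmp (1 + x) 1 (1 + x) ?f al)"
      by (simp add: sgn_act_def)
    also have "cmp (x + 2) y (1 + x) (sgn_act (x + 1) (cmp (1 + x) 1 (1 + x) ?f al)) g =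
        sgn_act (x + 1) (cmp (x + 2) y (1 + x) (cmp (1 + x) 1 (1 + x) ?f al) g)"
      by (intro cmp_sgn_left) simp_all
    also have "cmp (x + 2) y (1 + x) (cmp (1 + x) 1 (1 + x) ?f al) g =
        cmp (1 + x) (1 + y) (1 + x) ?f (cmp 1 y 0 al g)"
      by (intro cmp_inside') auto
    finally have 1: "cmp 1 (x + y + 1) 0 al (brace2 1 x y al f g) =
        sgn_act (x + 1) (cmp (1 + x) (1 + y) (1 + x) ?f (cmp 1 y 0 al g))" .
    have e: "1 + (x + y + 1) = x + y + 2" by simp
    have "brace2 1 (x + y + 1) z al (brace2 1 x y al f g) h =
        cmp (x + y + 2) z (x + y + 2) (sgn_act (x + 1) (cmp (1 + x) (1 + y) (1 + x) ?f (cmp 1 y 0 al g))) h"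
      using e by (simp only: brace2_al[of "x + y + 1"] 1)
    also have "\<dots> = sgn_act (x + 1) (cmp (x + y + 2) z (x + y + 2) (cmp (1 + x) (1 + y) (1 + x) ?f (cmp 1 y 0 al g)) h)"
      by (intro cmp_sgn_left) simp_all
    also have "cmp (x + y + 2) z (x + y + 2) (cmp (1 + x) (1 + y) (1 + x) ?f (cmp 1 y 0 al g)) h =
        cmp (1 + x) (y + z + 1) (1 + x) ?f (cmp (1 + y) z (1 + y) (cmp 1 y 0 al g) h)"
      using y by (intro cmp_inside') auto
    also have "\<dots> = brace2 1 x (y + z + 1) al f (brace2 1 y z al g h)"
      by (simp add: brace2_al)
    finally have 2: "brace2 1 (x + y + 1) z al (brace2 1 x y al f g) h =
        sgn_act (x + 1) (brace2 1 x (y + z + 1) al f (brace2 1 y z al g h))" .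
    show ?thesis
      by (cases "even x"; cases "even y"; cases "even z";
        simp add: cupp_def sgn_act_def 2 brace_linear brace2_in W_neg;
        (simp add: algebra_simps)?)
  qed
qed

text \<open>For a cocycle, \<open>f{\<alpha>}\<close> and \<open>\<alpha>{f}\<close> agree up to
  sign. After this substitution, \<open>pre_lie\<close> for \<open>f{g}{\<alpha>}\<close>,
  \<open>f{\<alpha>}{g}\<close> and \<open>\<alpha>{f}{g}\<close> makes everything cancel except the
  double braces with \<open>\<alpha>\<close> outermost, which are the two cup products.\<close>

lemma dlt_brace1:
  assumes f: "f \<in> W x" and g: "g \<in> W y" and df: "dlt x f = 0" and dg: "dlt y g = 0"
  shows "dlt (x + y) (brace1 x y f g) =
    sgn_act (x + y) (brace2 1 x y al f g + sgn_act (x * y) (brace2 1 y x al g f))"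
proof -
  note [simp] = f g al_in brace1_in brace2_in
  have f_al: "brace1 x 1 f al = sgn_act x (brace1 1 x al f)"
    and g_al: "brace1 y 1 g al = sgn_act y (brace1 1 y al g)"
    using df dg by (simp_all add: dlt_def lie_def)
  have 1: "brace1 (x + y) 1 (brace1 x y f g) al = brace1 x (y + 1) f (brace1 y 1 g al)
      + brace2 x y 1 f g al + sgn_act y (brace2 x 1 y f al g)"
    using pre_lie[OF f g al_in] by simp
  have 2: "brace1 (x + 1) y (brace1 x 1 f al) g = brace1 x (y + 1) f (brace1 1 y al g)
      + brace2 x 1 y f al g + sgn_act y (brace2 x y 1 f g al)"
    using pre_lie[OF f al_in g] by (simp add: add_ac)
  have 3: "brace2 x y 1 f g al = sgn_act y (brace1 (x + 1) y (brace1 x 1 f al) g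
      - brace1 x (y + 1) f (brace1 1 y al g) - brace2 x 1 y f al g)"
    using 2 by (simp add: sgn_act_def)
  have 4: "brace1 1 (x + y) al (brace1 x y f g) =
      brace1 (x + 1) y (brace1 1 x al f) g - brace2 1 x y al f g - sgn_act (x * y) (brace2 1 y x al g f)"
    using pre_lie[OF al_in f g] by (simp add: add_ac)
  show ?thesis
    by (cases "even x"; cases "even y";
        simp add: dlt_def lie_def 1 3 4 f_al g_al sgn_act_def brace_linear;
        (simp add: algebra_simps)?)
qed

lemma cupp_commute:
  assumes "f \<in> W x" "g \<in> W y" "dlt x f = 0" "dlt y g = 0"
  shows "cupp x y f g - sgn_act ((x + 1) * (y + 1)) (cupp y x g f) =
    sgn_act (x * y + x) (dlt (x + y) (brace1 x y f g))"
  unfolding dlt_brace1[OF assms]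
  by (cases "even x"; cases "even y";
        simp add: cupp_def sgn_act_def;
        (simp add: algebra_simps)?)

text \<open>The threefold braces of \<open>h\<close> with \<open>f\<close>, \<open>g\<close> and
  \<open>\<alpha>\<close> occur both in \<open>h{f, g}{\<alpha>}\<close> and in
  \<open>h{\<alpha>}{f, g}\<close>. As \<open>h\<close> is a cocycle, \<open>h{\<alpha>}\<close> may
  be replaced by \<open>\<alpha>{h}\<close> up to sign, and \<open>\<alpha>{h}{f, g}\<close> expands
  without threefold braces.\<close>

lemma dlt_brace2:
  assumes h: "h \<in> W z" and f: "f \<in> W x" and g: "g \<in> W y"
    and dh: "dlt z h = 0" and df: "dlt x f = 0" and dg: "dlt y g = 0"
  shows "dlt (x + y + z) (brace2 z x y h f g) =
    sgn_act (x + y + z) (brace2 1 (x + z) y al (brace1 z x h f) g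
       + sgn_act (x * z) (brace2 1 x (y + z) al f (brace1 z y h g)))
    - sgn_act (x + y) (brace1 z (x + y + 1) h (brace2 1 x y al f g))"
proof -
  note [simp] = f g h al_in brace1_in brace2_in
  have f_al: "brace1 x 1 f al = sgn_act x (brace1 1 x al f)"
    and g_al: "brace1 y 1 g al = sgn_act y (brace1 1 y al g)"
    and h_al: "brace1 z 1 h al = sgn_act z (brace1 1 z al h)"
    using df dg dh by (simp_all add: dlt_def lie_def)
  have 1: "brace1 (x + y + z) 1 (brace2 z x y h f g) al =
      brace2 z x (y + 1) h f (brace1 y 1 g al) + sgn_act y (brace2 z (x + 1) y h (brace1 x 1 f al) g)
      + brace3 z x y 1 h f g al + sgn_act y (brace3 z x 1 y h f al g)
      + sgn_act (x + y) (brace3 z 1 x y h al f g)"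
    using brace2_brace1[OF h f g al_in] by (simp add: add_ac)
  have 2: "brace2 (z + 1) x y (brace1 z 1 h al) f g =
      brace1 z (x + y + 1) h (brace2 1 x y al f g) + brace2 z (x + 1) y h (brace1 1 x al f) g
      + sgn_act x (brace2 z x (y + 1) h f (brace1 1 y al g))
      + brace3 z 1 x y h al f g + sgn_act x (brace3 z x 1 y h f al g)
      + sgn_act (x + y) (brace3 z x y 1 h f g al)"
    using brace1_brace2[OF h al_in f g] by (simp add: add_ac)
  have 3: "brace3 z x y 1 h f g al = sgn_act (x + y) (brace2 (z + 1) x y (brace1 z 1 h al) f g
      - brace1 z (x + y + 1) h (brace2 1 x y al f g) - brace2 z (x + 1) y h (brace1 1 x al f) g
      - sgn_act x (brace2 z x (y + 1) h f (brace1 1 y al g))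
      - brace3 z 1 x y h al f g - sgn_act x (brace3 z x 1 y h f al g))"
    unfolding 2 by (simp add: sgn_act_def)
  have 4: "brace1 1 (x + y + z) al (brace2 z x y h f g) =
      brace2 (z + 1) x y (brace1 1 z al h) f g - brace2 1 (x + z) y al (brace1 z x h f) g
      - sgn_act (x * z) (brace2 1 x (y + z) al f (brace1 z y h g))"
    using brace1_brace2[OF al_in h f g] by (simp add: brace3_al ac_simps)
  show ?thesis
    by (cases "even x"; cases "even y"; cases "even z";
        simp add: dlt_def lie_def 1 3 4 f_al g_al h_al sgn_act_def brace_linear;
        (simp add: algebra_simps)?)
qed

text \<open>The summand of the bracket that inserts \<open>h\<close> into
  \<open>\<alpha>{f, g}\<close> satisfies the derivation rule exactly. The defect stems from the
  summand that inserts the product into \<open>h\<close>, and \<open>dlt_brace2\<close> identifies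
  it as a boundary.\<close>

lemma lie_cupp:
  assumes f: "f \<in> W x" and g: "g \<in> W y" and h: "h \<in> W z"
    and d: "dlt x f = 0" "dlt y g = 0" "dlt z h = 0"
  shows "lie (x + y + 1) z (cupp x y f g) h - cupp (x + z) y (lie x z f h) g
      - sgn_act ((x + 1) * z) (cupp x (y + z) f (lie y z g h)) =
    sgn_act (x * y + x + (x + y + 1) * z) (dlt (x + y + z) (brace2 z x y h f g))"
proof -
  note [simp] = f g h al_in brace1_in brace2_in
  have 1: "brace1 (x + y + 1) z (brace2 1 x y al f g) h = brace2 1 x (y + z) al f (brace1 y z g h)
      + sgn_act (y * z) (brace2 1 (x + z) y al (brace1 x z f h) g)"
    using brace2_brace1[OF al_in f g h] by (simp add: brace3_al add_ac)
  show ?thesis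
    unfolding dlt_brace2[OF h f g d(3,1,2)]
    by (cases "even x"; cases "even y"; cases "even z";
        simp add: cupp_def lie_def sgn_act_def brace_linear W_neg W_diff W_add 1;
        (simp add: algebra_simps)?)
qed

end

section \<open>Cohomology as a subquotient\<close>

lemma field_field_ring: "Ring.field (field_ring :: 'k::field ring)"
proof -
  have "cring (field_ring :: 'k ring)"
  proof (rule cringI)
    show "abelian_group (field_ring :: 'k ring)"
    proof (rule abelian_groupI)
      show "\<exists>y\<in>carrier field_ring. y \<oplus>\<^bsub>field_ring\<^esub> x = \<zero>\<^bsub>field_ring\<^esub>" for x :: 'k
        by (rule bexI[of _ "- x"]) (auto simp: field_ring_def)
    qed (auto simp: field_ring_def)
    show "Group.comm_monoid (field_ring :: 'k ring)"
      by unfold_locales (auto simp: field_ring_def mult_ac)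
  qed (auto simp: field_ring_def algebra_simps)
  then show ?thesis
  proof (rule cring.cring_fieldI2)
    show "\<exists>b\<in>carrier field_ring. a \<otimes>\<^bsub>field_ring\<^esub> b = \<one>\<^bsub>field_ring\<^esub>"
      if "a \<noteq> \<zero>\<^bsub>field_ring\<^esub>" for a :: 'k
      using that by (intro bexI[of _ "inverse a"]) (auto simp: field_ring_def)
  qed (auto simp: field_ring_def)
qed

section \<open>Vector spaces and their subquotients as module records\<close>

definition vmod :: "('k \<Rightarrow> 'v::ab_group_add \<Rightarrow> 'v) \<Rightarrow> 'v set \<Rightarrow> ('k, 'v) Module.module"
  where "vmod s A = \<lparr>carrier = A, mult = undefined, one = undefined, zero = 0, add = (+), smult = s\<rparr>"

lemma vmod_simps [simp]:
  "carrier (vmod s A) = A" "\<zero>\<^bsub>vmod s A\<^esub> = 0" "x \<oplus>\<^bsub>vmod s A\<^esub> y = x + y" "l \<odot>\<^bsub>vmod s A\<^esub> x = s l x"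
  by (simp_all add: vmod_def)

context vector_space begin

lemma module_vmod:
  assumes A: "subspace A"
  shows "Module.module field_ring (vmod scale A)"
proof (rule moduleI)
  show "cring field_ring"
    using field_field_ring by (rule fieldE(1))
  show "abelian_group (vmod scale A)"
  proof (rule abelian_groupI)
    show "\<exists>y\<in>carrier (vmod scale A). y \<oplus>\<^bsub>vmod scale A\<^esub> x = \<zero>\<^bsub>vmod scale A\<^esub>" if "x \<in> carrier (vmod scale A)" for x
      using that A by (intro bexI[of _ "- x"]) (auto simp: subspace_neg)
  qed (use A in \<open>auto simp: subspace_0 subspace_add add_ac\<close>)
qed (use A in \<open>auto simp: subspace_scale field_ring_def scale_left_distrib scale_right_distrib\<close>)

lemma coset_vmod: "N +>\<^bsub>vmod scale A\<^esub> x = (\<lambda>n. n + x) ` N"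
  by (auto simp: a_r_coset_def')

lemma coset_eq_iff:
  assumes "subspace N"
  shows "N +>\<^bsub>vmod scale A\<^esub> x = N +>\<^bsub>vmod scale A\<^esub> y \<longleftrightarrow> x - y \<in> N"
proof
  assume "N +>\<^bsub>vmod scale A\<^esub> x = N +>\<^bsub>vmod scale A\<^esub> y"
  moreover have "x \<in> N +>\<^bsub>vmod scale A\<^esub> x"
    using subspace_0[OF assms] by (force simp: coset_vmod)
  ultimately show "x - y \<in> N" by (auto simp: coset_vmod)
next
  assume d: "x - y \<in> N"
  have "n + x \<in> (\<lambda>n. n + y) ` N" if "n \<in> N" for n
    using subspace_add[OF assms that d] by (intro image_eqI[of _ _ "n + (x - y)"]) auto
  moreover have "n + y \<in> (\<lambda>n. n + x) ` N" if "n \<in> N" for n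
    using subspace_diff[OF assms that d] by (intro image_eqI[of _ _ "n - (x - y)"]) auto
  ultimately show "N +>\<^bsub>vmod scale A\<^esub> x = N +>\<^bsub>vmod scale A\<^esub> y" by (auto simp: coset_vmod)
qed

lemma subquotient_vmod:
  fixes l :: 'a
  assumes N: "subspace N"
  shows "carrier (subquotient (vmod scale A) Z N) = (\<lambda>z. N +>\<^bsub>vmod scale A\<^esub> z) ` Z"
    and "\<zero>\<^bsub>subquotient (vmod scale A) Z N\<^esub> = N +>\<^bsub>vmod scale A\<^esub> 0"
    and "(N +>\<^bsub>vmod scale A\<^esub> x) \<oplus>\<^bsub>subquotient (vmod scale A) Z N\<^esub> (N +>\<^bsub>vmod scale A\<^esub> y) = N +>\<^bsub>vmod scale A\<^esub> (x + y)"
    and "l \<odot>\<^bsub>subquotient (vmod scale A) Z N\<^esub> (N +>\<^bsub>vmod scale A\<^esub> x) = N +>\<^bsub>vmod scale A\<^esub> (scale l x)"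
proof -
  show "carrier (subquotient (vmod scale A) Z N) = (\<lambda>z. N +>\<^bsub>vmod scale A\<^esub> z) ` Z"
    by (auto simp: subquotient_def)
  show "\<zero>\<^bsub>subquotient (vmod scale A) Z N\<^esub> = N +>\<^bsub>vmod scale A\<^esub> 0"
    by (simp add: subquotient_def coset_vmod)
  show "(N +>\<^bsub>vmod scale A\<^esub> x) \<oplus>\<^bsub>subquotient (vmod scale A) Z N\<^esub> (N +>\<^bsub>vmod scale A\<^esub> y) = N +>\<^bsub>vmod scale A\<^esub> (x + y)"
  proof -
    have "n + (x + y) \<in> {u. \<exists>h\<in>N. \<exists>k\<in>N. u = h + x + (k + y)}" if "n \<in> N" for n
      using that subspace_0[OF N] by (intro CollectI bexI[of _ n] bexI[of _ 0]) (auto simp: algebra_simps)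
    moreover have "h + x + (k + y) \<in> (\<lambda>n. n + (x + y)) ` N" if "h \<in> N" "k \<in> N" for h k
      using subspace_add[OF N that] by (intro image_eqI[of _ _ "h + k"]) (auto simp: algebra_simps)
    ultimately show ?thesis
      by (auto simp: subquotient_def set_add_def' coset_vmod)
  qed
  let ?c = "\<lambda>u. N +>\<^bsub>vmod scale A\<^esub> u"
  \<comment> \<open>All cosets in the union that defines scalar multiplication on the quotient
    coincide.\<close>
  have 1: "?c (scale l u) = ?c (scale l x)" if "u \<in> ?c x" for u
    unfolding coset_eq_iff[OF N] using that subspace_scale[OF N]
    by (auto simp: coset_vmod scale_right_distrib)
  have 2: "x \<in> ?c x"
    using subspace_0[OF N] by (force simp: coset_vmod)
  have "l \<odot>\<^bsub>subquotient (vmod scale A) Z N\<^esub> ?c x = (\<Union>u\<in>?c x. ?c (scale l u))"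
    by (simp add: subquotient_def)
  also have "\<dots> = (\<Union>u\<in>?c x. ?c (scale l x))"
    by (rule SUP_cong[OF refl 1])
  also have "\<dots> = ?c (scale l x)"
    using 2 by (intro SUP_const) blast
  finally show "l \<odot>\<^bsub>subquotient (vmod scale A) Z N\<^esub> ?c x = ?c (scale l x)" .
qed

lemma module_subquotient:
  assumes N: "subspace N" and Z: "subspace Z"
  shows "Module.module field_ring (subquotient (vmod scale A) Z N)"
proof (rule moduleI)
  let ?Q = "subquotient (vmod scale A) Z N"
  note sq = subquotient_vmod[OF N]
  show "cring field_ring"
    using field_field_ring by (rule fieldE(1))
  show "abelian_group ?Q"
  proof (rule abelian_groupI)
    show "\<exists>y\<in>carrier ?Q. y \<oplus>\<^bsub>?Q\<^esub> x = \<zero>\<^bsub>?Q\<^esub>"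
      if x: "x \<in> carrier ?Q" for x
    proof -
      obtain z where z: "z \<in> Z" "x = N +>\<^bsub>vmod scale A\<^esub> z" using x by (auto simp: sq)
      then show ?thesis
        using subspace_neg[OF Z z(1)] by (intro bexI[of _ "N +>\<^bsub>vmod scale A\<^esub> (- z)"]) (auto simp: sq)
    qed
  qed (use subspace_0[OF Z] subspace_add[OF Z] in \<open>auto simp: sq add_ac\<close>)
qed (use subspace_scale[OF Z] in \<open>auto simp: subquotient_vmod[OF N] field_ring_def
    scale_left_distrib scale_right_distrib\<close>)

lemma a_inv_subquotient:
  assumes N: "subspace N" and Z: "subspace Z" and x: "x \<in> Z"
  shows "\<ominus>\<^bsub>subquotient (vmod scale A) Z N\<^esub> (N +>\<^bsub>vmod scale A\<^esub> x) = N +>\<^bsub>vmod scale A\<^esub> (- x)"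
  using module_subquotient[OF N Z, of A] x subspace_neg[OF Z x]
  by (intro abelian_group.minus_equality) (auto simp: Module.module_def subquotient_vmod[OF N])

lemma msgn_subquotient:
  "\<lbrakk>subspace N; subspace Z; x \<in> Z\<rbrakk> \<Longrightarrow>
    msgn (subquotient (vmod scale A) Z N) e (N +>\<^bsub>vmod scale A\<^esub> x) = N +>\<^bsub>vmod scale A\<^esub> sgn_act e x"
  by (simp add: msgn_def sgn_act_def a_inv_subquotient)

text \<open>The operation on cosets evaluates \<open>F\<close> on chosen representatives. By
  bilinearity, a change of representatives alters the value by terms of the kind covered by
  \<open>F_bd\<close>, so the resulting coset is independent of the choice.\<close>

lemma induced_bilinear:
  assumes N: "subspace N1" "subspace N2" "subspace N3"
    and Z: "subspace Z1" "subspace Z2" "subspace Z3"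
    and sub: "N1 \<subseteq> Z1" "N2 \<subseteq> Z2"
    and F_in: "\<And>f g. f \<in> Z1 \<Longrightarrow> g \<in> Z2 \<Longrightarrow> F f g \<in> Z3"
    and F_bd: "\<And>f g. f \<in> N1 \<Longrightarrow> g \<in> Z2 \<Longrightarrow> F f g \<in> N3" "\<And>f g. f \<in> Z1 \<Longrightarrow> g \<in> N2 \<Longrightarrow> F f g \<in> N3"
    and F_add: "\<And>f f' g. f \<in> Z1 \<Longrightarrow> f' \<in> Z1 \<Longrightarrow> g \<in> Z2 \<Longrightarrow> F (f + f') g = F f g + F f' g"
      "\<And>f g g'. f \<in> Z1 \<Longrightarrow> g \<in> Z2 \<Longrightarrow> g' \<in> Z2 \<Longrightarrow> F f (g + g') = F f g + F f g'"
    and F_scale: "\<And>f g l. f \<in> Z1 \<Longrightarrow> g \<in> Z2 \<Longrightarrow> F (scale l f) g = scale l (F f g)"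
      "\<And>f g l. f \<in> Z1 \<Longrightarrow> g \<in> Z2 \<Longrightarrow> F f (scale l g) = scale l (F f g)"
  shows "\<exists>H. (\<forall>f\<in>Z1. \<forall>g\<in>Z2. H (N1 +>\<^bsub>vmod scale A1\<^esub> f) (N2 +>\<^bsub>vmod scale A2\<^esub> g) = N3 +>\<^bsub>vmod scale A3\<^esub> F f g) \<and>
    module_bilinear field_ring (subquotient (vmod scale A1) Z1 N1) (subquotient (vmod scale A2) Z2 N2)
      (subquotient (vmod scale A3) Z3 N3) H"
proof -
  let ?c1 = "\<lambda>f. N1 +>\<^bsub>vmod scale A1\<^esub> f" and ?Q1 = "subquotient (vmod scale A1) Z1 N1"
  let ?c2 = "\<lambda>f. N2 +>\<^bsub>vmod scale A2\<^esub> f" and ?Q2 = "subquotient (vmod scale A2) Z2 N2"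
  let ?c3 = "\<lambda>f. N3 +>\<^bsub>vmod scale A3\<^esub> f" and ?Q3 = "subquotient (vmod scale A3) Z3 N3"
  define r1 where "r1 X = (SOME f. f \<in> Z1 \<and> ?c1 f = X)" for X
  define r2 where "r2 X = (SOME f. f \<in> Z2 \<and> ?c2 f = X)" for X
  define H where "H X Y = ?c3 (F (r1 X) (r2 Y))" for X Y
  have H: "H (?c1 f) (?c2 g) = ?c3 (F f g)"
    if f: "f \<in> Z1" and g: "g \<in> Z2" for f g
  proof -
    let ?f = "r1 (?c1 f)" and ?g = "r2 (?c2 g)"
    have "?f \<in> Z1 \<and> ?c1 ?f = ?c1 f"
      unfolding r1_def
      by (rule someI[where P = "\<lambda>u. u \<in> Z1 \<and> ?c1 u = ?c1 f" and x = f]) (simp add: f)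
    then have f': "?f \<in> Z1" "?f - f \<in> N1" by (simp_all only: coset_eq_iff[OF N(1)])
    have "?g \<in> Z2 \<and> ?c2 ?g = ?c2 g"
      unfolding r2_def
      by (rule someI[where P = "\<lambda>u. u \<in> Z2 \<and> ?c2 u = ?c2 g" and x = g]) (simp add: g)
    then have g': "?g \<in> Z2" "?g - g \<in> N2" by (simp_all only: coset_eq_iff[OF N(2)])
    have "F ?f ?g = F (f + (?f - f)) ?g" by simp
    also have "\<dots> = F f ?g + F (?f - f) ?g" using f g' f' sub by (intro F_add) auto
    also have "F f ?g = F f (g + (?g - g))" by simp
    also have "\<dots> = F f g + F f (?g - g)" using f g g' sub by (intro F_add) auto
    finally have "F ?f ?g - F f g = F f (?g - g) + F (?f - f) ?g" by simp
    moreover have "F f (?g - g) + F (?f - f) ?g \<in> N3"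
      using f g' f' by (intro subspace_add N F_bd)
    ultimately show ?thesis by (simp only: H_def coset_eq_iff[OF N(3)])
  qed
  show ?thesis
  proof (intro exI[of _ H] conjI ballI H)
    show "module_bilinear field_ring ?Q1 ?Q2
      ?Q3 H"
      unfolding module_bilinear_def subquotient_vmod(1)[OF N(1)] subquotient_vmod(1)[OF N(2)]
        subquotient_vmod(1)[OF N(3)] ball_simps
    proof (intro conjI ballI)
      fix l :: 'a and f g assume f: "f \<in> Z1" and g: "g \<in> Z2"
      show "H (?c1 f) (?c2 g) \<in> ?c3 ` Z3"
        using f g by (simp add: H F_in)
      show "H (l \<odot>\<^bsub>?Q1\<^esub> (?c1 f)) (?c2 g) =
          l \<odot>\<^bsub>?Q3\<^esub> H (?c1 f) (?c2 g)"
        by (simp only: H f g F_scale subspace_scale[OF Z(1)] subquotient_vmod(4)[OF N(1)] subquotient_vmod(4)[OF N(3)])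
      show "H (?c1 f) (l \<odot>\<^bsub>?Q2\<^esub> (?c2 g)) =
          l \<odot>\<^bsub>?Q3\<^esub> H (?c1 f) (?c2 g)"
        by (simp only: H f g F_scale subspace_scale[OF Z(2)] subquotient_vmod(4)[OF N(2)] subquotient_vmod(4)[OF N(3)])
      fix f' assume f': "f' \<in> Z1"
      show "H ((?c1 f) \<oplus>\<^bsub>?Q1\<^esub> (?c1 f'))
            (?c2 g) =
          H (?c1 f) (?c2 g) \<oplus>\<^bsub>?Q3\<^esub>
          H (?c1 f') (?c2 g)"
        by (simp only: H f f' g F_add subspace_add[OF Z(1)] subquotient_vmod(3)[OF N(1)] subquotient_vmod(3)[OF N(3)])
    next
      fix f g g' assume f: "f \<in> Z1" and g: "g \<in> Z2" "g' \<in> Z2"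
      show "H (?c1 f)
            ((?c2 g) \<oplus>\<^bsub>?Q2\<^esub> (?c2 g')) =
          H (?c1 f) (?c2 g) \<oplus>\<^bsub>?Q3\<^esub>
          H (?c1 f) (?c2 g')"
        by (simp only: H f g F_add subspace_add[OF Z(2)] subquotient_vmod(3)[OF N(2)] subquotient_vmod(3)[OF N(3)])
    qed
  qed
qed

end

section \<open>The Gerstenhaber structure on the cohomology of a suspended comp algebra\<close>

context suspended_comp_algebra begin

text \<open>From here on the index is the number \<open>n\<close> of inputs, the degree in the
  complex, rather than the suspended degree \<open>n - 1\<close>.\<close>

definition cyc :: "int \<Rightarrow> 'v set"
  where "cyc n = {f \<in> W (n - 1). dlt (n - 1) f = 0}"

text \<open>For \<open>n < 1\<close> the space \<open>W (n - 2)\<close> is zero, so the formula also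
  covers the lowest degrees.\<close>

definition bdr :: "int \<Rightarrow> 'v set"
  where "bdr n = dlt (n - 2) ` W (n - 2)"

definition coh :: "int \<Rightarrow> ('k, 'v set) Module.module"
  where "coh n = subquotient (vmod sc (W (n - 1))) (cyc n) (bdr n)"

definition cls :: "int \<Rightarrow> 'v \<Rightarrow> 'v set"
  where "cls n f = bdr n +>\<^bsub>vmod sc (W (n - 1))\<^esub> f"

lemma subspace_cyc: "subspace (cyc n)"
  using dlt_linear[of _ "n - 1"] dlt_linear(4)[of 0 "n - 1" 0]
  by (auto simp: subspace_def cyc_def W_add W_scale)

lemma subspace_bdr: "subspace (bdr n)"
proof -
  have "dlt (n - 2) 0 = 0" using dlt_linear(4)[of 0 "n - 2" 0] by simp
  then have "0 \<in> bdr n" by (force simp: bdr_def intro: image_eqI[of _ _ 0])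
  moreover have "x + y \<in> bdr n" if "x \<in> bdr n" "y \<in> bdr n" for x y
    using that by (auto simp: bdr_def dlt_linear(1)[symmetric] W_add)
  moreover have "sc l x \<in> bdr n" if "x \<in> bdr n" for l x
    using that by (auto simp: bdr_def dlt_linear(4)[symmetric] W_scale)
  ultimately show ?thesis by (auto simp: subspace_def)
qed

lemma bdr_subset_cyc: "bdr n \<subseteq> cyc n"
  using dlt_dlt[of _ "n - 2"] dlt_in[of _ "n - 2" "n - 1"]
  by (auto simp: bdr_def cyc_def)

lemma bdrI: "f \<in> W x \<Longrightarrow> x = n - 2 \<Longrightarrow> g = sgn_act e (dlt x f) \<Longrightarrow> g \<in> bdr n"
  using dlt_linear(3)[of f x] by (auto simp: bdr_def sgn_act_def W_neg intro!: image_eqI[of _ _ "if even e then f else - f"])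

lemma cls_eqI: "f - g \<in> bdr n \<Longrightarrow> cls n f = cls n g"
  by (simp add: cls_def coset_eq_iff subspace_bdr)

lemmas coh_simps = subquotient_vmod[OF subspace_bdr, of "W (n - 1)" "cyc n" n for n,
  folded coh_def cls_def]

lemma a_inv_coh: "f \<in> cyc n \<Longrightarrow> \<ominus>\<^bsub>coh n\<^esub> (cls n f) = cls n (- f)"
  by (simp add: coh_def cls_def a_inv_subquotient subspace_bdr subspace_cyc)

lemma msgn_coh: "f \<in> cyc n \<Longrightarrow> msgn (coh n) e (cls n f) = cls n (sgn_act e f)"
  by (simp add: coh_def cls_def msgn_subquotient subspace_bdr subspace_cyc)

lemma cyc_sgn: "f \<in> cyc n \<Longrightarrow> sgn_act e f \<in> cyc n"
  by (simp add: sgn_act_def subspace_neg subspace_cyc)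

lemma lie_cyc:
  assumes "f \<in> cyc m" "g \<in> cyc n" "u = m + n - 1"
  shows "lie (m - 1) (n - 1) f g \<in> cyc u"
  unfolding assms(3) using assms(1,2) dlt_lie[of f "m - 1" g "n - 1"] lie_linear(8)[of f "m - 1" 0 n 0]
    lie_linear(4)[of 0 m g "n - 1" 0]
  by (auto simp: cyc_def lie_in algebra_simps)

lemma cupp_cyc:
  assumes "f \<in> cyc m" "g \<in> cyc n" "u = m + n"
  shows "cupp (m - 1) (n - 1) f g \<in> cyc u"
  using assms dlt_cupp[of f "m - 1" g "n - 1"] cupp_linear(8)[of f "m - 1" 0 n 0]
    cupp_linear(4)[of 0 m g "n - 1" 0]
  by (auto simp: cyc_def cupp_in algebra_simps)

text \<open>By \<open>dlt_lie\<close>, bracketing a primitive of the boundary with the cocycle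
  gives, up to sign, a primitive of the bracket.\<close>

lemma lie_bdr:
  "f \<in> bdr m \<Longrightarrow> g \<in> cyc n \<Longrightarrow> lie (m - 1) (n - 1) f g \<in> bdr (m + n - 1)"
  "f \<in> cyc m \<Longrightarrow> g \<in> bdr n \<Longrightarrow> lie (m - 1) (n - 1) f g \<in> bdr (m + n - 1)"
proof -
  assume "f \<in> bdr m" and g: "g \<in> cyc n"
  then obtain h where h: "h \<in> W (m - 2)" "f = dlt (m - 2) h" by (auto simp: bdr_def)
  have "lie (m - 1) (n - 1) f g = sgn_act (n - 1) (dlt ((m - 2) + (n - 1)) (lie (m - 2) (n - 1) h g))"
    using h g dlt_lie[of h "m - 2" g "n - 1"] lie_linear(8)[of h "m - 2" 0 n 0]
    by (simp add: cyc_def sgn_act_def)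
  then show "lie (m - 1) (n - 1) f g \<in> bdr (m + n - 1)"
    using h g by (intro bdrI[OF lie_in]) (auto simp: cyc_def)
next
  assume f: "f \<in> cyc m" and "g \<in> bdr n"
  then obtain h where h: "h \<in> W (n - 2)" "g = dlt (n - 2) h" by (auto simp: bdr_def)
  have "lie (m - 1) (n - 1) f g = sgn_act 0 (dlt ((m - 1) + (n - 2)) (lie (m - 1) (n - 2) f h))"
    using h f dlt_lie[of f "m - 1" h "n - 2"] lie_linear(4)[of 0 m h "n - 2" 0]
    by (simp add: cyc_def sgn_act_def)
  then show "lie (m - 1) (n - 1) f g \<in> bdr (m + n - 1)"
    using h f by (intro bdrI[OF lie_in]) (auto simp: cyc_def)
qed

lemma cupp_bdr:
  "f \<in> bdr m \<Longrightarrow> g \<in> cyc n \<Longrightarrow> cupp (m - 1) (n - 1) f g \<in> bdr (m + n)"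
  "f \<in> cyc m \<Longrightarrow> g \<in> bdr n \<Longrightarrow> cupp (m - 1) (n - 1) f g \<in> bdr (m + n)"
proof -
  assume "f \<in> bdr m" and g: "g \<in> cyc n"
  then obtain h where h: "h \<in> W (m - 2)" "f = dlt (m - 2) h" by (auto simp: bdr_def)
  have "cupp (m - 1) (n - 1) f g = sgn_act 0 (dlt ((m - 2) + (n - 1) + 1) (cupp (m - 2) (n - 1) h g))"
    using h g dlt_cupp[of h "m - 2" g "n - 1"] cupp_linear(8)[of h "m - 2" 0 n 0]
    by (simp add: cyc_def sgn_act_def)
  then show "cupp (m - 1) (n - 1) f g \<in> bdr (m + n)"
    using h g by (intro bdrI[OF cupp_in]) (auto simp: cyc_def)
next
  assume f: "f \<in> cyc m" and "g \<in> bdr n"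
  then obtain h where h: "h \<in> W (n - 2)" "g = dlt (n - 2) h" by (auto simp: bdr_def)
  have "cupp (m - 1) (n - 1) f g = sgn_act m (dlt ((m - 1) + (n - 2) + 1) (cupp (m - 1) (n - 2) f h))"
    using h f dlt_cupp[of f "m - 1" h "n - 2"] cupp_linear(4)[of 0 m h "n - 2" 0]
    by (simp add: cyc_def sgn_act_def)
  then show "cupp (m - 1) (n - 1) f g \<in> bdr (m + n)"
    using h f by (intro bdrI[OF cupp_in]) (auto simp: cyc_def)
qed

lemma cyc_W: "f \<in> cyc n \<Longrightarrow> f \<in> W (n - 1)"
  by (simp add: cyc_def)

lemma cyc_dlt: "f \<in> cyc n \<Longrightarrow> dlt (n - 1) f = 0"
  by (simp add: cyc_def)

lemma ex_cupH:
  "\<exists>H. (\<forall>f\<in>cyc m. \<forall>g\<in>cyc n. H (cls m f) (cls n g) = cls (m + n) (cupp (m - 1) (n - 1) f g)) \<and>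
    module_bilinear field_ring (coh m) (coh n) (coh (m + n)) H"
  unfolding coh_def cls_def
  by (rule induced_bilinear)
    (use subspace_bdr subspace_cyc bdr_subset_cyc in \<open>auto simp: cupp_cyc cupp_bdr cupp_linear cyc_W\<close>)

lemma ex_brH:
  "\<exists>H. (\<forall>f\<in>cyc m. \<forall>g\<in>cyc n. H (cls m f) (cls n g) = cls (m + n - 1) (lie (m - 1) (n - 1) f g)) \<and>
    module_bilinear field_ring (coh m) (coh n) (coh (m + n - 1)) H"
  unfolding coh_def cls_def
  by (rule induced_bilinear)
    (use subspace_bdr subspace_cyc bdr_subset_cyc in \<open>auto simp: lie_cyc lie_bdr lie_linear cyc_W\<close>)

text \<open>Associativity, antisymmetry and the Jacobi identity are inherited from cochains. Graded
  commutativity and the derivation rule hold modulo the boundaries of \<open>f{g}\<close> and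
  \<open>h{f, g}\<close>.\<close>

theorem gerstenhaber_cohomology:
  "\<exists>cupH brH. (\<forall>m n. \<forall>f\<in>cyc m. \<forall>g\<in>cyc n.
      cupH m n (cls m f) (cls n g) = cls (m + n) (cupp (m - 1) (n - 1) f g) \<and>
      brH m n (cls m f) (cls n g) = cls (m + n - 1) (lie (m - 1) (n - 1) f g)) \<and>
    gerstenhaber_algebra field_ring coh cupH brH"
proof -
  obtain cupH where
    cupH: "\<And>m n f g. f \<in> cyc m \<Longrightarrow> g \<in> cyc n \<Longrightarrow>
      cupH m n (cls m f) (cls n g) = cls (m + n) (cupp (m - 1) (n - 1) f g)"
    and cupH_bil: "\<And>m n. module_bilinear field_ring (coh m) (coh n) (coh (m + n)) (cupH m n)"
    using ex_cupH by metis
  obtain brH where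
    brH: "\<And>m n f g. f \<in> cyc m \<Longrightarrow> g \<in> cyc n \<Longrightarrow>
      brH m n (cls m f) (cls n g) = cls (m + n - 1) (lie (m - 1) (n - 1) f g)"
    and brH_bil: "\<And>m n. module_bilinear field_ring (coh m) (coh n) (coh (m + n - 1)) (brH m n)"
    using ex_brH by metis
  have cohE: "\<exists>f\<in>cyc n. X = cls n f" if "X \<in> carrier (coh n)" for X n
    using that by (auto simp: coh_simps)
  have "gerstenhaber_algebra field_ring coh cupH brH"
  proof (intro gerstenhaber_algebra.intro graded_vector_space.intro gerstenhaber_algebra_axioms.intro)
    show "Ring.field field_ring" by (rule field_field_ring)
    show "Module.module field_ring (coh n)" for n
      unfolding coh_def by (intro module_subquotient subspace_bdr subspace_cyc)
    show "carrier (coh n) = {\<zero>\<^bsub>coh n\<^esub>}" if "n < 0" for n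
    proof -
      have "cyc n = {0}" using that subspace_0[OF subspace_cyc[of n]] W_trivial[of "n - 1"] by (auto simp: cyc_def)
      then show ?thesis by (simp add: coh_simps)
    qed
    show "module_bilinear field_ring (coh m) (coh n) (coh (m + n)) (cupH m n)" for m n
      by (rule cupH_bil)
    show "module_bilinear field_ring (coh m) (coh n) (coh (m + n - 1)) (brH m n)" for m n
      by (rule brH_bil)
    fix m n X Y assume X: "X \<in> carrier (coh m)" and Y: "Y \<in> carrier (coh n)"
    obtain f g where f: "f \<in> cyc m" "X = cls m f" and g: "g \<in> cyc n" "Y = cls n g"
      using cohE X Y by metis
    note fg = cyc_W[OF f(1)] cyc_W[OF g(1)] cyc_dlt[OF f(1)] cyc_dlt[OF g(1)]
    show "cupH m n X Y = msgn (coh (m + n)) (m * n) (cupH n m Y X)"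
    proof -
      have "cupp (m - 1) (n - 1) f g - sgn_act (m * n) (cupp (n - 1) (m - 1) g f) \<in> bdr (m + n)"
        using cupp_commute[OF fg] by (intro bdrI[OF brace1_in[OF fg(1,2)]]) auto
      then have "cls (m + n) (cupp (m - 1) (n - 1) f g) = cls (m + n) (sgn_act (m * n) (cupp (n - 1) (m - 1) g f))"
        by (rule cls_eqI)
      then show ?thesis
        using f g by (simp add: cupH msgn_coh cupp_cyc add.commute[of n m])
    qed
    show "brH m n X Y = \<ominus>\<^bsub>coh (m + n - 1)\<^esub> msgn (coh (m + n - 1)) ((m - 1) * (n - 1)) (brH n m Y X)"
      using f g lie_antisym[of "m - 1" "n - 1" f g]
      by (simp add: brH msgn_coh a_inv_coh cyc_sgn lie_cyc add.commute[of n m])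
    fix p Q assume Q: "Q \<in> carrier (coh p)"
    obtain h where h: "h \<in> cyc p" "Q = cls p h" using cohE Q by metis
    note fgh = fg(1,2) cyc_W[OF h(1)] fg(3,4) cyc_dlt[OF h(1)]
    show "cupH (m + n) p (cupH m n X Y) Q = cupH m (n + p) X (cupH n p Y Q)"
      using f g h cupp_assoc[OF fgh(1-3)] by (simp add: cupH cupp_cyc algebra_simps)
    show "msgn (coh (m + n + p - 2)) ((m - 1) * (p - 1)) (brH m (n + p - 1) X (brH n p Y Q))
        \<oplus>\<^bsub>coh (m + n + p - 2)\<^esub>
      msgn (coh (m + n + p - 2)) ((n - 1) * (m - 1)) (brH n (p + m - 1) Y (brH p m Q X))
        \<oplus>\<^bsub>coh (m + n + p - 2)\<^esub>
      msgn (coh (m + n + p - 2)) ((p - 1) * (n - 1)) (brH p (m + n - 1) Q (brH m n X Y))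
      = \<zero>\<^bsub>coh (m + n + p - 2)\<^esub>"
    proof -
      have 1: "brH m (n + p - 1) X (brH n p Y Q) =
          cls (m + n + p - 2) (lie (m - 1) ((n - 1) + (p - 1)) f (lie (n - 1) (p - 1) g h))"
        and 2: "brH n (p + m - 1) Y (brH p m Q X) =
          cls (m + n + p - 2) (lie (n - 1) ((p - 1) + (m - 1)) g (lie (p - 1) (m - 1) h f))"
        and 3: "brH p (m + n - 1) Q (brH m n X Y) =
          cls (m + n + p - 2) (lie (p - 1) ((m - 1) + (n - 1)) h (lie (m - 1) (n - 1) f g))"
        using f g h by (simp_all add: brH lie_cyc algebra_simps)
      have c: "lie (m - 1) ((n - 1) + (p - 1)) f (lie (n - 1) (p - 1) g h) \<in> cyc (m + n + p - 2)"
         "lie (n - 1) ((p - 1) + (m - 1)) g (lie (p - 1) (m - 1) h f) \<in> cyc (m + n + p - 2)"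
         "lie (p - 1) ((m - 1) + (n - 1)) h (lie (m - 1) (n - 1) f g) \<in> cyc (m + n + p - 2)"
        using lie_cyc[OF f(1) lie_cyc[OF g(1) h(1) refl] refl] lie_cyc[OF g(1) lie_cyc[OF h(1) f(1) refl] refl]
          lie_cyc[OF h(1) lie_cyc[OF f(1) g(1) refl] refl]
        by (simp_all add: algebra_simps)
      show ?thesis
        unfolding 1 2 3 using lie_jacobi[OF fgh(1-3)] by (simp only: msgn_coh c coh_simps)
    qed
    show "brH (m + n) p (cupH m n X Y) Q = cupH (m + p - 1) n (brH m p X Q) Y
        \<oplus>\<^bsub>coh (m + n + p - 1)\<^esub>
      msgn (coh (m + n + p - 1)) (m * (p - 1)) (cupH m (n + p - 1) X (brH n p Y Q))"
    proof -
      let ?l = "lie ((m - 1) + (n - 1) + 1) (p - 1) (cupp (m - 1) (n - 1) f g) h"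
        and ?r = "cupp ((m - 1) + (p - 1)) (n - 1) (lie (m - 1) (p - 1) f h) g"
        and ?s = "cupp (m - 1) ((n - 1) + (p - 1)) f (lie (n - 1) (p - 1) g h)"
      have 1: "brH (m + n) p (cupH m n X Y) Q = cls (m + n + p - 1) ?l"
        and 2: "cupH (m + p - 1) n (brH m p X Q) Y = cls (m + n + p - 1) ?r"
        and 3: "cupH m (n + p - 1) X (brH n p Y Q) = cls (m + n + p - 1) ?s"
        using f g h by (simp_all add: brH cupH lie_cyc cupp_cyc algebra_simps)
      have c: "?s \<in> cyc (m + n + p - 1)"
        using cupp_cyc[OF f(1) lie_cyc[OF g(1) h(1) refl] refl] by (simp add: algebra_simps)
      have "?l - (?r + sgn_act (m * (p - 1)) ?s) \<in> bdr (m + n + p - 1)"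
      proof (rule bdrI)
        show "brace2 (p - 1) (m - 1) (n - 1) h f g \<in> W ((m - 1) + (n - 1) + (p - 1))"
          by (rule brace2_in[OF fgh(3,1,2)]) simp
        show "?l - (?r + sgn_act (m * (p - 1)) ?s) =
            sgn_act ((m - 1) * (n - 1) + (m - 1) + ((m - 1) + (n - 1) + 1) * (p - 1))
              (dlt ((m - 1) + (n - 1) + (p - 1)) (brace2 (p - 1) (m - 1) (n - 1) h f g))"
          unfolding lie_cupp[OF fgh, symmetric] by (simp add: diff_diff_eq)
      qed simp
      then show ?thesis
        unfolding 1 2 3 msgn_coh[OF c] coh_simps by (rule cls_eqI)
    qed
  qed
  then show ?thesis using cupH brH by blast
qed

end

section \<open>Multilinear maps on tensor products\<close>

lemma tensor_lift_zero [simp]: "tensor_lift s t (\<lambda>x y. 0) u = 0"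
  by (simp add: tensor_lift_def split_def)

lemma tensor_lift_add:
  "tensor_lift s t (\<lambda>x y. \<beta> x y + \<gamma> x y) u = tensor_lift s t \<beta> u + tensor_lift s t \<gamma> u"
  by (simp add: tensor_lift_def split_def sum_list_addf)

lemma tensor_lift_swap:
  "tensor_lift s t (\<lambda>x y. tensor_lift s' t' (\<lambda>z w. F x y z w) v) u =
   tensor_lift s' t' (\<lambda>z w. tensor_lift s t (\<lambda>x y. F x y z w) u) v"
proof -
  have "(\<Sum>p\<leftarrow>xs. \<Sum>q\<leftarrow>ys. G p q) = (\<Sum>q\<leftarrow>ys. \<Sum>p\<leftarrow>xs. G p q)"
    for xs ys and G :: "'p \<Rightarrow> 'q \<Rightarrow> 'u::ab_group_add"
    by (induction xs) (auto simp: sum_list_addf)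
  then show ?thesis by (simp add: tensor_lift_def split_def)
qed

lemma linear_tensor_lift:
  "Vector_Spaces.linear r r' \<phi> \<Longrightarrow> \<phi> (tensor_lift s t \<beta> u) = tensor_lift s t (\<lambda>x y. \<phi> (\<beta> x y)) u"
  by (simp add: tensor_lift_def split_def linear_sum_list)

lemma tensor_lift_apply: "(tensor_lift s t G u) \<beta> = tensor_lift s t (\<lambda>x y. G x y \<beta>) u"
  by (simp add: tensor_lift_def split_def sum_list_fun_apply)

lemma linear_iff_add_scale:
  "Vector_Spaces.linear s t f \<longleftrightarrow> vector_space s \<and> vector_space t \<and>
    (\<forall>x y. f (x + y) = f x + f y) \<and> (\<forall>l x. f (s l x) = t l (f x))"
  by (auto simp: Vector_Spaces.linear_def module_hom_def module_hom_axioms_def Modules.module_def vector_space_def)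

lemma linear_zero: "vector_space s \<Longrightarrow> vector_space t \<Longrightarrow> Vector_Spaces.linear s t (\<lambda>x. 0)"
proof -
  assume "vector_space s" "vector_space t"
  then interpret s: vector_space s + t: vector_space t .
  show ?thesis by unfold_locales auto
qed

lemma linear_id: "vector_space s \<Longrightarrow> Vector_Spaces.linear s s (\<lambda>x. x)"
  by (simp add: linear_iff_add_scale)

lemma linear_add_fun:
  assumes "Vector_Spaces.linear s t f" "Vector_Spaces.linear s t g"
  shows "Vector_Spaces.linear s t (\<lambda>x. f x + g x)"
proof -
  interpret vector_space t using assms(1) by (simp add: linear_iff_add_scale)
  show ?thesis using assms by (simp add: linear_iff_add_scale scale_right_distrib add_ac)
qed

lemma linear_tensor_lift_param:
  assumes "vector_space q" "vector_space r" "\<And>x y. Vector_Spaces.linear q r (\<lambda>p. F p x y)"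
  shows "Vector_Spaces.linear q r (\<lambda>p. tensor_lift s t (F p) u)"
proof -
  have "Vector_Spaces.linear q r (\<lambda>p. \<Sum>(x, y)\<leftarrow>xs. F p x y)" for xs
    by (induction xs) (use assms in \<open>auto simp: split_def linear_zero intro!: linear_add_fun\<close>)
  then show ?thesis by (simp add: tensor_lift_def)
qed

text \<open>Tensors are functionals on forms with values in \<open>k\<close>. Identities with values
  in another vector space are reduced to this case by composition with linear functionals.\<close>

lemma vector_space_eqI:
  fixes u :: "'k::field \<Rightarrow> 'u::ab_group_add \<Rightarrow> 'u"
  assumes "vector_space u" "\<And>\<phi>. Vector_Spaces.linear u (*) \<phi> \<Longrightarrow> \<phi> x = \<phi> y"
  shows "x = y"
proof (rule ccontr)
  assume "x \<noteq> y"
  then obtain \<phi> where \<phi>: "Vector_Spaces.linear u (*) \<phi>" "\<phi> (x - y) \<noteq> 0"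
    using linear_functional_separates[OF assms(1), of "x - y"] by auto
  interpret Vector_Spaces.linear u "(*)" \<phi> by (fact \<phi>(1))
  show False using assms(2)[OF \<phi>(1)] \<phi>(2) by (simp add: diff)
qed

lemma tensor_spaceD: "u \<in> tensor_space s t \<Longrightarrow> tensor_lift s t (tens s t) u = u"
  unfolding tensor_lift_def tensor_space_def by (rule someI2_ex) auto

lemma tensor_space_apply:
  "u \<in> tensor_space s t \<Longrightarrow> bilin s t (*) \<beta> \<Longrightarrow> u \<beta> = tensor_lift s t \<beta> u"
  by (subst tensor_spaceD[symmetric]) (auto simp: tensor_lift_apply tens_def)

lemma bilin_comp: "bilin s t u F \<Longrightarrow> Vector_Spaces.linear u r \<phi> \<Longrightarrow> bilin s t r (\<lambda>x y. \<phi> (F x y))"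
  by (auto simp: bilin_def intro: linear_comp)

lemma bilin_target: "bilin s t u F \<Longrightarrow> vector_space u"
  by (auto simp: bilin_def linear_iff_add_scale)

text \<open>The chosen representation of \<open>\<Phi> p\<close> need not depend linearly on
  \<open>p\<close>. But a linear functional applied to the lift gives the value of the tensor
  \<open>\<Phi> p\<close> at a bilinear form, and this is linear in \<open>p\<close>.\<close>

lemma linear_tensor_lift_arg:
  fixes u :: "'k::field \<Rightarrow> 'u::ab_group_add \<Rightarrow> 'u"
  assumes F: "bilin s t u F" and \<Phi>: "Vector_Spaces.linear q scale_tensor \<Phi>" "\<And>p. \<Phi> p \<in> tensor_space s t"
  shows "Vector_Spaces.linear q u (\<lambda>p. tensor_lift s t F (\<Phi> p))"
proof -
  have u: "vector_space u" using F by (rule bilin_target)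
  have lift: "\<phi> (tensor_lift s t F (\<Phi> p)) = \<Phi> p (\<lambda>x y. \<phi> (F x y))"
    if "Vector_Spaces.linear u (*) \<phi>" for \<phi> p
    by (simp add: linear_tensor_lift[OF that] tensor_space_apply[OF \<Phi>(2) bilin_comp[OF F that]])
  show ?thesis
    unfolding linear_iff_add_scale
  proof (intro conjI allI u)
    show "vector_space q" using \<Phi> by (simp add: linear_iff_add_scale)
    show "tensor_lift s t F (\<Phi> (x + y)) = tensor_lift s t F (\<Phi> x) + tensor_lift s t F (\<Phi> y)" for x y
    proof (rule vector_space_eqI[OF u])
      fix \<phi> assume \<phi>: "Vector_Spaces.linear u (*) \<phi>"
      interpret Vector_Spaces.linear u "(*)" \<phi> by (fact \<phi>)
      show "\<phi> (tensor_lift s t F (\<Phi> (x + y))) = \<phi> (tensor_lift s t F (\<Phi> x) + tensor_lift s t F (\<Phi> y))"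
        using \<Phi>(1) unfolding add lift[OF \<phi>] by (simp add: linear_iff_add_scale)
    qed
    show "tensor_lift s t F (\<Phi> (q l x)) = u l (tensor_lift s t F (\<Phi> x))" for l x
    proof (rule vector_space_eqI[OF u])
      fix \<phi> assume \<phi>: "Vector_Spaces.linear u (*) \<phi>"
      interpret Vector_Spaces.linear u "(*)" \<phi> by (fact \<phi>)
      show "\<phi> (tensor_lift s t F (\<Phi> (q l x))) = \<phi> (u l (tensor_lift s t F (\<Phi> x)))"
        using \<Phi>(1) unfolding scale lift[OF \<phi>] by (simp add: linear_iff_add_scale scale_tensor_def)
    qed
  qed
qed

section \<open>Moving an element of \<open>C\<close> past a list\<close>

text \<open>A variant of \<open>pass\<close> in which the diagonal is a finite list and the
  recursion starts at the front. It allows induction on the list, and the blocks of a diagonal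
  become parts of a concatenation.\<close>

primrec pass_list ::
  "('k::field, 'a::ab_group_add, 'b, 'c::ab_group_add) entwining_data \<Rightarrow> 'c \<Rightarrow> 'a list \<Rightarrow>
   ('a list \<Rightarrow> 'c \<Rightarrow> 'u::ab_group_add) \<Rightarrow> 'u"
  where
    "pass_list D c [] F = F [] c"
  | "pass_list D c (x # xs) F =
      liftAC D (\<lambda>x' c'. pass_list D c' xs (\<lambda>xs'. F (x' # xs'))) (psi D c x)"

lemma pass_list_append:
  "pass_list D c (xs @ ys) F = pass_list D c xs (\<lambda>us d. pass_list D d ys (\<lambda>vs. F (us @ vs)))"
  by (induction xs arbitrary: c F) simp_all

lemma pass_list_cong:
  "(\<And>us d. length us = length xs \<Longrightarrow> F us d = G us d) \<Longrightarrow> pass_list D c xs F = pass_list D c xs G"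
proof (induction xs arbitrary: c F G)
  case (Cons x xs)
  have "pass_list D c' xs (\<lambda>xs'. F (x' # xs')) = pass_list D c' xs (\<lambda>xs'. G (x' # xs'))" for x' c'
    by (rule Cons.IH) (simp add: Cons.prems)
  then show ?case by simp
qed simp

lemma pass_list_zero [simp]: "pass_list D c xs (\<lambda>us d. 0) = 0"
  by (induction xs arbitrary: c) simp_all

lemma pass_list_add:
  "pass_list D c xs (\<lambda>us d. F us d + G us d) = pass_list D c xs F + pass_list D c xs G"
  by (induction xs arbitrary: c F G) (simp_all add: tensor_lift_add)

lemma tensor_lift_pass_list:
  "tensor_lift s t (\<lambda>x y. pass_list D c xs (\<lambda>us d. F x y us d)) u =
   pass_list D c xs (\<lambda>us d. tensor_lift s t (\<lambda>x y. F x y us d) u)"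
proof (induction xs arbitrary: c F)
  case (Cons x xs)
  have "tensor_lift s t (\<lambda>x1 y. pass_list D c (x # xs) (\<lambda>us d. F x1 y us d)) u =
      liftAC D (\<lambda>x' c'. tensor_lift s t (\<lambda>x1 y. pass_list D c' xs (\<lambda>xs' d. F x1 y (x' # xs') d)) u) (psi D c x)"
    by (simp add: tensor_lift_swap[of s t])
  then show ?case by (simp add: Cons)
qed simp

lemma pass_list_swap:
  "pass_list D c xs (\<lambda>us d. pass_list D e ys (\<lambda>vs e'. F us d vs e')) =
   pass_list D e ys (\<lambda>vs e'. pass_list D c xs (\<lambda>us d. F us d vs e'))"
  by (induction xs arbitrary: c F) (simp_all add: tensor_lift_pass_list)

lemma linear_pass_list_out:
  "Vector_Spaces.linear r r' \<phi> \<Longrightarrow> \<phi> (pass_list D c xs F) = pass_list D c xs (\<lambda>us d. \<phi> (F us d))"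
  by (induction xs arbitrary: c F) (simp_all add: linear_tensor_lift)

lemma pass_list_apply: "(pass_list D c xs F) \<beta> = pass_list D c xs (\<lambda>us d. F us d \<beta>)"
  by (induction xs arbitrary: c F) (simp_all add: tensor_lift_apply)

definition subst_diag :: "(nat \<Rightarrow> 'a) \<Rightarrow> 'a list \<Rightarrow> nat \<Rightarrow> 'a"
  where "subst_diag a xs = (\<lambda>p. if 1 \<le> p \<and> p \<le> length xs then xs ! (p - 1) else a p)"

lemma subst_diag_Nil [simp]: "subst_diag a [] = a"
  by (auto simp: subst_diag_def)

lemma pass_eq_pass_list:
  "pass D i c a F = pass_list D c (map a [1..<Suc i]) (\<lambda>us d. F (subst_diag a us) d)"
proof (induction i arbitrary: F)
  case 0
  then show ?case by simp
next
  case (Suc i)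
  have 1: "(subst_diag a us)(Suc i := x) = subst_diag a (us @ [x])" if "length us = i" for us x
    using that by (auto simp: subst_diag_def fun_eq_iff nth_append le_Suc_eq Suc_le_eq)
  have "map a [1..<Suc (Suc i)] = map a [1..<Suc i] @ [a (Suc i)]" by simp
  then show ?case
    by (simp only: pass.simps Suc pass_list_append pass_list.simps)
      (intro pass_list_cong, simp add: 1)
qed

context entwining_structure_over begin

text \<open>Sweedler sums: \<open>SC c F\<close> is the sum of \<open>F c\<^sub>1 c\<^sub>2\<close>, and \<open>SA c a F\<close> is the sum of \<open>F a\<^sub>\<psi> c\<^sup>\<psi>\<close>.
  They are sums over a fixed list of pure tensors, so they can be interchanged and are additive in
  \<open>F\<close> even if \<open>F\<close> is not bilinear.\<close>

abbreviation "SC c F \<equiv> liftCC D F (comult D c)"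
abbreviation "SA c a F \<equiv> liftAC D F (psi D c a)"
abbreviation "SP \<equiv> pass_list D"
abbreviation "E \<equiv> equivariant_cochains D"

lemma vector_spaces [simp, intro!]: "vector_space (scA D)" "vector_space (scB D)" "vector_space (scC D)"
  by unfold_locales

section \<open>The axioms of coalgebras and entwinings inside Sweedler sums\<close>

text \<open>The axiom equates two threefold tensors. Evaluating both at \<open>k\<close>-valued
  forms obtained by composition with linear functionals extends it to trilinear maps into any vector
  space.\<close>

lemma coassoc_lift:
  fixes u :: "'k \<Rightarrow> 'u::ab_group_add \<Rightarrow> 'u"
  assumes F: "trilin (scC D) (scC D) (scC D) u F"
  shows "SC c (\<lambda>x z. SC x (\<lambda>x1 x2. F x1 x2 z)) = SC c (\<lambda>x z. SC z (\<lambda>z1 z2. F x z1 z2))"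
proof (rule vector_space_eqI)
  show "vector_space u" using F by (auto simp: trilin_def linear_iff_add_scale)
  fix \<phi> assume \<phi>: "Vector_Spaces.linear u (*) \<phi>"
  let ?\<beta> = "\<lambda>x y z. \<phi> (F x y z)"
  have "trilin (scC D) (scC D) (scC D) (*) ?\<beta>"
    using F by (auto simp: trilin_def bilin_def intro!: linear_comp[OF _ \<phi>])
  then show "\<phi> (SC c (\<lambda>x z. SC x (\<lambda>x1 x2. F x1 x2 z))) = \<phi> (SC c (\<lambda>x z. SC z (\<lambda>z1 z2. F x z1 z2)))"
    using arg_cong[OF C.coassoc[of c], of "\<lambda>T. T ?\<beta>"]
    by (simp add: tensor_lift_apply tens3_def linear_tensor_lift[OF \<phi>])
qed

lemma psi_comult_lift:
  fixes u :: "'k \<Rightarrow> 'u::ab_group_add \<Rightarrow> 'u"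
  assumes F: "trilin (scA D) (scC D) (scC D) u F"
  shows "SA c a (\<lambda>a' c'. SC c' (\<lambda>c1 c2. F a' c1 c2)) =
    SC c (\<lambda>c1 c2. SA c2 a (\<lambda>a' c2'. SA c1 a' (\<lambda>a'' c1'. F a'' c1' c2')))"
proof (rule vector_space_eqI)
  show "vector_space u" using F by (auto simp: trilin_def linear_iff_add_scale)
  fix \<phi> assume \<phi>: "Vector_Spaces.linear u (*) \<phi>"
  let ?\<beta> = "\<lambda>x y z. \<phi> (F x y z)"
  have "trilin (scA D) (scC D) (scC D) (*) ?\<beta>"
    using F by (auto simp: trilin_def bilin_def intro!: linear_comp[OF _ \<phi>])
  then show "\<phi> (SA c a (\<lambda>a' c'. SC c' (\<lambda>c1 c2. F a' c1 c2))) =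
      \<phi> (SC c (\<lambda>c1 c2. SA c2 a (\<lambda>a' c2'. SA c1 a' (\<lambda>a'' c1'. F a'' c1' c2'))))"
    using arg_cong[OF psi_comult[of c a], of "\<lambda>T. T ?\<beta>"]
    by (simp add: tensor_lift_apply tens3_def linear_tensor_lift[OF \<phi>])
qed

lemma psi_apply: "bilin (scA D) (scC D) (*) \<beta> \<Longrightarrow> psi D c a \<beta> = SA c a \<beta>"
  by (rule tensor_space_apply[OF psi_in])

lemma psi_mult_lift:
  fixes u :: "'k \<Rightarrow> 'u::ab_group_add \<Rightarrow> 'u"
  assumes F: "bilin (scA D) (scC D) u F"
  shows "SA c (a * b) F = SA c a (\<lambda>a' d. SA d b (\<lambda>b' e. F (a' * b') e))"
proof (rule vector_space_eqI)
  show "vector_space u" using F by (rule bilin_target)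
  fix \<phi> assume \<phi>: "Vector_Spaces.linear u (*) \<phi>"
  have b: "bilin (scA D) (scC D) (*) (\<lambda>x y. \<phi> (F x y))" by (rule bilin_comp[OF F \<phi>])
  have "\<phi> (SA c (a * b) F) = psi D c (a * b) (\<lambda>x y. \<phi> (F x y))"
    by (simp add: linear_tensor_lift[OF \<phi>] psi_apply[OF b])
  also have "\<dots> = \<phi> (SA c a (\<lambda>a' d. SA d b (\<lambda>b' e. F (a' * b') e)))"
    unfolding psi_mult by (simp add: tensor_lift_apply tens_def b linear_tensor_lift[OF \<phi>])
  finally show "\<phi> (SA c (a * b) F) = \<phi> (SA c a (\<lambda>a' d. SA d b (\<lambda>b' e. F (a' * b') e)))" .
qed

lemma psi_zeta_lift:
  fixes u :: "'k \<Rightarrow> 'u::ab_group_add \<Rightarrow> 'u"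
  assumes F: "bilin (scA D) (scC D) u F"
  shows "SA c (zeta D b) F = F (zeta D b) c"
  using tensor_lift_sum[OF F, of "[(zeta D b, c)]"] by (simp add: psi_zeta)

lemma SC_counit_left:
  assumes "Vector_Spaces.linear (scC D) u K"
  shows "SC c (\<lambda>x y. u (counit D x) (K y)) = K c"
proof -
  have "SC c (\<lambda>x y. u (counit D x) (K y)) = K (SC c (\<lambda>x y. scC D (counit D x) y))"
    unfolding linear_tensor_lift[OF assms] using assms by (simp add: linear_iff_add_scale)
  then show ?thesis by (simp add: C.counit_left)
qed

lemma SC_counit_right:
  assumes "Vector_Spaces.linear (scC D) u K"
  shows "SC c (\<lambda>x y. u (counit D y) (K x)) = K c"
proof -
  have "SC c (\<lambda>x y. u (counit D y) (K x)) = K (SC c (\<lambda>x y. scC D (counit D y) x))"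
    unfolding linear_tensor_lift[OF assms] using assms by (simp add: linear_iff_add_scale)
  then show ?thesis by (simp add: C.counit_right)
qed

lemma SA_counit:
  assumes "Vector_Spaces.linear (scA D) u K"
  shows "SA c a (\<lambda>x d. u (counit D d) (K x)) = u (counit D c) (K a)"
proof -
  have "SA c a (\<lambda>x d. u (counit D d) (K x)) = K (SA c a (\<lambda>x d. scA D (counit D d) x))"
    unfolding linear_tensor_lift[OF assms] using assms by (simp add: linear_iff_add_scale)
  then show ?thesis using assms by (simp add: psi_counit linear_iff_add_scale)
qed

section \<open>Multilinearity of nested Sweedler sums\<close>

definition multilinear :: "('k \<Rightarrow> 'u::ab_group_add \<Rightarrow> 'u) \<Rightarrow> ('a list \<Rightarrow> 'u) \<Rightarrow> bool"
  where "multilinear u G \<longleftrightarrow> (\<forall>ys zs. Vector_Spaces.linear (scA D) u (\<lambda>x. G (ys @ x # zs)))"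

text \<open>Describes a list with a parameter in exactly one entry. Being stable under adding
  entries on either side, it lets linearity in an entry be established by following the syntax of
  the list.\<close>

definition linear_slot :: "('k \<Rightarrow> 'q::ab_group_add \<Rightarrow> 'q) \<Rightarrow> ('q \<Rightarrow> 'a list) \<Rightarrow> bool"
  where "linear_slot q \<gamma> \<longleftrightarrow> (\<exists>ys g zs. Vector_Spaces.linear q (scA D) g \<and> \<gamma> = (\<lambda>p. ys @ g p # zs))"

lemma multilinear_append:
  assumes "multilinear u G" shows "multilinear u (\<lambda>us. G (vs @ us))"
  unfolding multilinear_def
proof (intro allI)
  show "Vector_Spaces.linear (scA D) u (\<lambda>x. G (vs @ ys @ x # zs))" for ys zs
    using assms[unfolded multilinear_def, rule_format, of "vs @ ys" zs] by simp
qed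

lemma linear_slotI:
  "Vector_Spaces.linear q (scA D) g \<Longrightarrow> linear_slot q (\<lambda>p. g p # zs)"
  unfolding linear_slot_def by (rule exI[of _ "[]"]) auto

lemma linear_slot_Cons: "linear_slot q \<gamma> \<Longrightarrow> linear_slot q (\<lambda>p. y # \<gamma> p)"
  unfolding linear_slot_def by (metis append_Cons)

lemma linear_slot_append: "linear_slot q \<gamma> \<Longrightarrow> linear_slot q (\<lambda>p. ys @ \<gamma> p)"
  unfolding linear_slot_def by (metis append_assoc)

lemma linear_slot_append2: "linear_slot q \<gamma> \<Longrightarrow> linear_slot q (\<lambda>p. \<gamma> p @ zs)"
  unfolding linear_slot_def by (metis append_assoc append_Cons)

lemma multilinear_slot:
  assumes "multilinear u G" "linear_slot q \<gamma>"
  shows "Vector_Spaces.linear q u (\<lambda>p. G (\<gamma> p))"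
proof -
  obtain ys g zs where g: "Vector_Spaces.linear q (scA D) g" "\<gamma> = (\<lambda>p. ys @ g p # zs)"
    using assms(2) by (auto simp: linear_slot_def)
  have "Vector_Spaces.linear (scA D) u (\<lambda>x. G (ys @ x # zs))"
    using assms(1) by (auto simp: multilinear_def)
  from linear_comp[OF g(1) this] show ?thesis by (simp add: g(2))
qed

lemma linear_SC_arg:
  assumes "Vector_Spaces.linear q (scC D) g" "\<And>x. Vector_Spaces.linear (scC D) u (F x)"
    "\<And>y. Vector_Spaces.linear (scC D) u (\<lambda>x. F x y)"
  shows "Vector_Spaces.linear q u (\<lambda>p. SC (g p) F)"
proof -
  have "bilin (scC D) (scC D) u F" using assms by (simp add: bilin_def)
  from linear_tensor_lift_arg[OF this C.comult_linear C.comult_in]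
  show ?thesis by (rule linear_comp[OF assms(1)])
qed

lemma linear_SA_arg1:
  assumes "Vector_Spaces.linear q (scC D) g" "\<And>x. Vector_Spaces.linear (scC D) u (F x)"
    "\<And>y. Vector_Spaces.linear (scA D) u (\<lambda>x. F x y)"
  shows "Vector_Spaces.linear q u (\<lambda>p. SA (g p) a F)"
proof -
  have "bilin (scA D) (scC D) u F" using assms by (simp add: bilin_def)
  moreover have "Vector_Spaces.linear (scC D) scale_tensor (\<lambda>c. psi D c a)"
    using psi_bilin by (simp add: bilin_def)
  ultimately have "Vector_Spaces.linear (scC D) u (\<lambda>c. SA c a F)"
    by (rule linear_tensor_lift_arg[OF _ _ psi_in])
  then show ?thesis by (rule linear_comp[OF assms(1)])
qed

lemma linear_SA_arg2:
  assumes "Vector_Spaces.linear q (scA D) g" "\<And>x. Vector_Spaces.linear (scC D) u (F x)"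
    "\<And>y. Vector_Spaces.linear (scA D) u (\<lambda>x. F x y)"
  shows "Vector_Spaces.linear q u (\<lambda>p. SA c (g p) F)"
proof -
  have "bilin (scA D) (scC D) u F" using assms by (simp add: bilin_def)
  moreover have "Vector_Spaces.linear (scA D) scale_tensor (\<lambda>a. psi D c a)"
    using psi_bilin by (simp add: bilin_def)
  ultimately have "Vector_Spaces.linear (scA D) u (\<lambda>a. SA c a F)"
    by (rule linear_tensor_lift_arg[OF _ _ psi_in])
  then show ?thesis by (rule linear_comp[OF assms(1)])
qed

lemma linear_pass_list_param:
  assumes "vector_space q" "vector_space u" "\<And>us d. Vector_Spaces.linear q u (\<lambda>p. F p us d)"
  shows "Vector_Spaces.linear q u (\<lambda>p. SP c xs (F p))"
  using assms(3)
proof (induction xs arbitrary: c F)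
  case (Cons x xs)
  then show ?case using assms(1,2) by (auto intro!: linear_tensor_lift_param)
qed simp

lemma linear_pass_list_arg:
  assumes g: "Vector_Spaces.linear q (scC D) g" and F: "\<And>us. Vector_Spaces.linear (scC D) u (F us)"
    "\<And>d. multilinear u (\<lambda>us. F us d)"
  shows "Vector_Spaces.linear q u (\<lambda>p. SP (g p) xs F)"
proof -
  have u: "vector_space u" using F(1) by (auto simp: linear_iff_add_scale)
  have "Vector_Spaces.linear (scC D) u (\<lambda>c. SP c xs F)"
    using F
  proof (induction xs arbitrary: F)
    case (Cons x xs)
    show ?case
      unfolding pass_list.simps
    proof (rule linear_SA_arg1)
      show "Vector_Spaces.linear (scC D) u (\<lambda>c'. SP c' xs (\<lambda>xs'. F (x' # xs')))" for x'
      proof (rule Cons.IH)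
        show "multilinear u (\<lambda>us. F (x' # us) d)" for d
          using multilinear_append[OF Cons.prems(2), of "[x']"] by simp
      qed (rule Cons.prems)
      show "Vector_Spaces.linear (scA D) u (\<lambda>x'. SP c' xs (\<lambda>xs'. F (x' # xs')))" for c'
        by (intro linear_pass_list_param[OF _ u] multilinear_slot[OF Cons.prems(2)] linear_slotI
            linear_id vector_spaces)
    qed (intro linear_id vector_spaces)
  qed simp
  then show ?thesis by (rule linear_comp[OF g])
qed

lemma linear_pass_list_slot:
  assumes g: "linear_slot q \<gamma>" and F: "\<And>us. Vector_Spaces.linear (scC D) u (F us)"
    "\<And>d. multilinear u (\<lambda>us. F us d)"
  shows "Vector_Spaces.linear q u (\<lambda>p. SP c (\<gamma> p) F)"
proof (rule multilinear_slot[OF _ g])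
  have u: "vector_space u" using F(1) by (auto simp: linear_iff_add_scale)
  show "multilinear u (\<lambda>xs. SP c xs F)"
    unfolding multilinear_def pass_list_append pass_list.simps
  proof (intro allI linear_pass_list_param[OF _ u] vector_spaces linear_SA_arg2 linear_id)
    show "Vector_Spaces.linear (scC D) u (\<lambda>c'. SP c' zs (\<lambda>xs'. F (us @ x # xs')))" for us x zs
    proof (rule linear_pass_list_arg)
      show "multilinear u (\<lambda>xs'. F (us @ x # xs') d)" for d
        using multilinear_append[OF F(2), of "us @ [x]"] by simp
    qed (intro linear_id vector_spaces F(1))+
    show "Vector_Spaces.linear (scA D) u (\<lambda>x. F (us @ x # xs') d)" for us xs' d
      using F(2)[of d] by (simp add: multilinear_def)
  qed
qed

lemma multilinearI:
  "(\<And>ys zs. Vector_Spaces.linear (scA D) u (\<lambda>x. G (ys @ x # zs))) \<Longrightarrow> multilinear u G"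
  by (simp add: multilinear_def)

definition multicochain :: "('k \<Rightarrow> 'u::ab_group_add \<Rightarrow> 'u) \<Rightarrow> ('c \<Rightarrow> 'a list \<Rightarrow> 'u) \<Rightarrow> bool"
  where "multicochain u \<phi> \<longleftrightarrow>
    (\<forall>xs. Vector_Spaces.linear (scC D) u (\<lambda>c. \<phi> c xs)) \<and> (\<forall>c. multilinear u (\<phi> c))"

lemma multicochain_arg:
  "multicochain u \<phi> \<Longrightarrow> Vector_Spaces.linear q (scC D) g \<Longrightarrow> Vector_Spaces.linear q u (\<lambda>p. \<phi> (g p) xs)"
  unfolding multicochain_def by (rule linear_comp[of _ _ g]) auto

lemma multicochain_slot:
  "multicochain u \<phi> \<Longrightarrow> linear_slot q \<gamma> \<Longrightarrow> Vector_Spaces.linear q u (\<lambda>p. \<phi> c (\<gamma> p))"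
  unfolding multicochain_def by (rule multilinear_slot) auto

lemma bilin_arg1: "bilin s t u F \<Longrightarrow> Vector_Spaces.linear q s g \<Longrightarrow> Vector_Spaces.linear q u (\<lambda>p. F (g p) y)"
  unfolding bilin_def by (rule linear_comp[of _ _ g]) auto

lemma bilin_arg2: "bilin s t u F \<Longrightarrow> Vector_Spaces.linear q t g \<Longrightarrow> Vector_Spaces.linear q u (\<lambda>p. F x (g p))"
  unfolding bilin_def by (rule linear_comp[of _ _ g]) auto

text \<open>Introduction rules by which linearity of a nested Sweedler sum in one of its parameters
  is established along the syntax of the term. They discharge the side conditions of the lifting
  lemmas.\<close>

lemmas linear_rules = linear_id vector_spaces linear_SC_arg linear_SA_arg1 linear_SA_arg2
  linear_tensor_lift_param linear_pass_list_arg linear_pass_list_slot linear_pass_list_param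
  multilinearI linear_slotI linear_slot_Cons linear_slot_append linear_slot_append2

text \<open>Compatibility of \<open>\<psi>\<close> with the coproduct, iterated along the list. The
  second component passes first and leaves a changed list, which the first component then
  passes.\<close>

lemma pass_list_comult:
  assumes u: "vector_space u"
    and K1: "\<And>us c2. Vector_Spaces.linear (scC D) u (\<lambda>c1. K us c1 c2)"
    and K2: "\<And>us c1. Vector_Spaces.linear (scC D) u (\<lambda>c2. K us c1 c2)"
    and K3: "\<And>c1 c2. multilinear u (\<lambda>us. K us c1 c2)"
  shows "SP c xs (\<lambda>us d. SC d (K us)) =
    SC c (\<lambda>c1 c2. SP c2 xs (\<lambda>us d2. SP c1 us (\<lambda>vs d1. K vs d1 d2)))"
  using K1 K2 K3
proof (induction xs arbitrary: c K)
  case Nil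
  then show ?case by simp
next
  case (Cons x xs)
  note K = linear_comp[OF _ Cons.prems(1)] linear_comp[OF _ Cons.prems(2)] multilinear_slot[OF Cons.prems(3)]
  have "SP c' xs (\<lambda>us d. SC d (K (x' # us))) =
    SC c' (\<lambda>c1 c2. SP c2 xs (\<lambda>us d2. SP c1 us (\<lambda>vs d1. K (x' # vs) d1 d2)))" for x' c'
    by (rule Cons.IH) (intro linear_rules K u)+
  then have "SP c (x # xs) (\<lambda>us d. SC d (K us)) = SA c x (\<lambda>x' c'.
      SC c' (\<lambda>c1 c2. SP c2 xs (\<lambda>us d2. SP c1 us (\<lambda>vs d1. K (x' # vs) d1 d2))))"
    by simp
  also have "\<dots> = SC c (\<lambda>c1 c2. SA c2 x (\<lambda>a' c2'. SA c1 a' (\<lambda>a'' c1'.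
      SP c2' xs (\<lambda>us d2. SP c1' us (\<lambda>vs d1. K (a'' # vs) d1 d2)))))"
  proof (rule psi_comult_lift)
    show "trilin (scA D) (scC D) (scC D) u
      (\<lambda>x' c1 c2. SP c2 xs (\<lambda>us d2. SP c1 us (\<lambda>vs d1. K (x' # vs) d1 d2)))"
      unfolding trilin_def bilin_def by (intro conjI allI linear_rules K u)+
  qed
  also have "\<dots> = SC c (\<lambda>c1 c2. SP c2 (x # xs) (\<lambda>us d2. SP c1 us (\<lambda>vs d1. K vs d1 d2)))"
    by (simp add: tensor_lift_pass_list)
  finally show ?case .
qed

section \<open>Equivariance and compositions on lists\<close>

definition list_equivariant :: "nat \<Rightarrow> ('c \<Rightarrow> 'a list \<Rightarrow> 'a) \<Rightarrow> bool"
  where "list_equivariant n \<phi> \<longleftrightarrow> (\<forall>c xs. length xs = n \<longrightarrow>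
    SC c (\<lambda>c1 c2. SP c2 xs (\<lambda>us d. tens (scA D) (scC D) (\<phi> c1 us) d)) =
    SC c (\<lambda>c1 c2. psi D c1 (\<phi> c2 xs)))"

lemma list_equivariant_lift:
  fixes u :: "'k \<Rightarrow> 'u::ab_group_add \<Rightarrow> 'u"
  assumes \<phi>: "list_equivariant n \<phi>" and F: "bilin (scA D) (scC D) u F" and xs: "length xs = n"
  shows "SC c (\<lambda>c1 c2. SP c2 xs (\<lambda>us d. F (\<phi> c1 us) d)) =
    SC c (\<lambda>c1 c2. SA c1 (\<phi> c2 xs) F)"
proof (rule vector_space_eqI)
  show "vector_space u" using F by (rule bilin_target)
  fix \<theta> assume \<theta>: "Vector_Spaces.linear u (*) \<theta>"
  have b: "bilin (scA D) (scC D) (*) (\<lambda>x y. \<theta> (F x y))" by (rule bilin_comp[OF F \<theta>])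
  have "SC c (\<lambda>c1 c2. SP c2 xs (\<lambda>us d. tens (scA D) (scC D) (\<phi> c1 us) d)) (\<lambda>x y. \<theta> (F x y)) =
    SC c (\<lambda>c1 c2. psi D c1 (\<phi> c2 xs)) (\<lambda>x y. \<theta> (F x y))"
    using \<phi> xs by (simp add: list_equivariant_def)
  then show "\<theta> (SC c (\<lambda>c1 c2. SP c2 xs (\<lambda>us d. F (\<phi> c1 us) d))) =
    \<theta> (SC c (\<lambda>c1 c2. SA c1 (\<phi> c2 xs) F))"
    by (simp add: linear_tensor_lift[OF \<theta>] linear_pass_list_out[OF \<theta>] tensor_lift_apply
        pass_list_apply psi_apply[OF b] tens_def b)
qed

text \<open>Coassociativity and compatibility of \<open>\<psi>\<close> with the coproduct bring both copies of \<open>c\<close> next to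
  the block \<open>ys\<close>, where equivariance of \<open>\<eta>\<close> applies.\<close>
lemma equivariant_past_block:
  assumes \<eta>: "multicochain (scA D) \<eta>" "list_equivariant (length ys) \<eta>" and u: "vector_space u"
    and G1: "\<And>vs x e. Vector_Spaces.linear (scC D) u (\<lambda>c. G c vs x e)"
    and G2: "\<And>c x e. multilinear u (\<lambda>vs. G c vs x e)"
    and G3: "\<And>c vs e. Vector_Spaces.linear (scA D) u (\<lambda>x. G c vs x e)"
    and G4: "\<And>c vs x. Vector_Spaces.linear (scC D) u (\<lambda>e. G c vs x e)"
  shows "SC c (\<lambda>c1 c2. SC c1 (\<lambda>c11 c12. SP c2 xs (\<lambda>us d. SP c12 us (\<lambda>vs e.
      SA e (\<eta> d ys) (\<lambda>x e'. G c11 vs x e'))))) =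
    SC c (\<lambda>c1 c2. SC c1 (\<lambda>c11 c12. SP c2 xs (\<lambda>us d. SP d ys (\<lambda>ys' d'.
      SP c12 us (\<lambda>vs e. G c11 vs (\<eta> e ys') d')))))"
proof -
  note rules = linear_rules u multicochain_arg[OF \<eta>(1)] multicochain_slot[OF \<eta>(1)]
    linear_comp[OF _ G1] multilinear_slot[OF G2] linear_comp[OF _ G3] linear_comp[OF _ G4]
  have "SC c (\<lambda>c1 c2. SC c1 (\<lambda>c11 c12. SP c2 xs (\<lambda>us d. SP c12 us (\<lambda>vs e.
      SA e (\<eta> d ys) (\<lambda>x e'. G c11 vs x e'))))) =
    SC c (\<lambda>c1 c2. SC c2 (\<lambda>d1 d2. SP d2 xs (\<lambda>us d. SP d1 us (\<lambda>vs e.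
      SA e (\<eta> d ys) (\<lambda>x e'. G c1 vs x e')))))"
    by (rule coassoc_lift[where u = u], unfold trilin_def bilin_def) (intro conjI allI rules)+
  also have "\<dots> = SC c (\<lambda>c1 c2. SP c2 xs (\<lambda>vs e. SC e (\<lambda>e1 e2.
      SA e1 (\<eta> e2 ys) (\<lambda>x e'. G c1 vs x e'))))"
    by (subst pass_list_comult[OF u]) (intro rules refl)+
  also have "\<dots> = SC c (\<lambda>c1 c2. SP c2 xs (\<lambda>vs e. SC e (\<lambda>e1 e2.
      SP e2 ys (\<lambda>ys' d'. G c1 vs (\<eta> e1 ys') d'))))"
  proof -
    have "SC e (\<lambda>e1 e2. SA e1 (\<eta> e2 ys) (\<lambda>x e'. G c1 vs x e')) =
        SC e (\<lambda>e1 e2. SP e2 ys (\<lambda>ys' d'. G c1 vs (\<eta> e1 ys') d'))" for c1 vs e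
      by (rule list_equivariant_lift[OF \<eta>(2) _ refl, symmetric, where u = u], unfold bilin_def)
        (intro conjI allI rules)+
    then show ?thesis by (simp only:)
  qed
  also have "\<dots> = SC c (\<lambda>c1 c2. SC c2 (\<lambda>d1 d2. SP d2 xs (\<lambda>us d. SP d1 us (\<lambda>vs e.
      SP d ys (\<lambda>ys' d'. G c1 vs (\<eta> e ys') d')))))"
    by (subst pass_list_comult[OF u]) (intro rules refl)+
  also have "\<dots> = SC c (\<lambda>c1 c2. SC c1 (\<lambda>c11 c12. SP c2 xs (\<lambda>us d. SP c12 us (\<lambda>vs e.
      SP d ys (\<lambda>ys' d'. G c11 vs (\<eta> e ys') d')))))"
    by (rule coassoc_lift[symmetric, where u = u], unfold trilin_def bilin_def) (intro conjI allI rules)+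
  also have "\<dots> = SC c (\<lambda>c1 c2. SC c1 (\<lambda>c11 c12. SP c2 xs (\<lambda>us d. SP d ys (\<lambda>ys' d'.
      SP c12 us (\<lambda>vs e. G c11 vs (\<eta> e ys') d')))))"
    by (subst pass_list_swap) (rule refl)
  finally show ?thesis .
qed

text \<open>On the left-hand side a copy of \<open>c\<close> passes the value of
  \<open>\<eta>\<close> on its way to \<open>\<gamma>\<close>. By
  \<open>equivariant_past_block\<close> it may pass the arguments \<open>ys\<close> instead, whereby
  \<open>\<eta>\<close> and \<open>\<gamma>\<close> exchange their copies of
  \<open>c\<close>.\<close>

lemma list_parallel:
  assumes \<phi>: "multicochain (scA D) \<phi>" and \<gamma>: "multicochain (scA D) \<gamma>"
    and \<eta>: "multicochain (scA D) \<eta>" "list_equivariant (length ys) \<eta>"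
  shows "SC c (\<lambda>c1 c2. SP c2 xs (\<lambda>us d. SC c1 (\<lambda>c11 c12.
      SP c12 (us @ \<eta> d ys # zs1) (\<lambda>vs e. \<phi> c11 (vs @ \<gamma> e ys2 # zs2))))) =
    SC c (\<lambda>c1 c2. SP c2 xs (\<lambda>us d. SP d ys (\<lambda>ys' d'. SP d' zs1 (\<lambda>zs1' d''.
      SC c1 (\<lambda>c11 c12. SP c12 us (\<lambda>vs e. \<phi> c11 (vs @ \<eta> e ys' # zs1' @ \<gamma> d'' ys2 # zs2)))))))"
proof -
  note rules = linear_rules multicochain_arg[OF \<phi>] multicochain_slot[OF \<phi>] multicochain_arg[OF \<gamma>]
    multicochain_slot[OF \<gamma>]
  have "SC c (\<lambda>c1 c2. SP c2 xs (\<lambda>us d. SC c1 (\<lambda>c11 c12.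
      SP c12 (us @ \<eta> d ys # zs1) (\<lambda>vs e. \<phi> c11 (vs @ \<gamma> e ys2 # zs2))))) =
    SC c (\<lambda>c1 c2. SC c1 (\<lambda>c11 c12. SP c2 xs (\<lambda>us d. SP c12 us (\<lambda>vs e.
      SA e (\<eta> d ys) (\<lambda>x e'. SP e' zs1 (\<lambda>zs1' e''. \<phi> c11 (vs @ x # zs1' @ \<gamma> e'' ys2 # zs2)))))))"
    by (simp add: tensor_lift_pass_list pass_list_append)
  also have "\<dots> = SC c (\<lambda>c1 c2. SC c1 (\<lambda>c11 c12. SP c2 xs (\<lambda>us d. SP d ys (\<lambda>ys' d'.
      SP c12 us (\<lambda>vs e. SP d' zs1 (\<lambda>zs1' d''. \<phi> c11 (vs @ \<eta> e ys' # zs1' @ \<gamma> d'' ys2 # zs2)))))))"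
    by (rule equivariant_past_block[OF \<eta>, of "scA D"]) (intro rules)+
  also have "\<dots> = SC c (\<lambda>c1 c2. SP c2 xs (\<lambda>us d. SP d ys (\<lambda>ys' d'. SP d' zs1 (\<lambda>zs1' d''.
      SC c1 (\<lambda>c11 c12. SP c12 us (\<lambda>vs e. \<phi> c11 (vs @ \<eta> e ys' # zs1' @ \<gamma> d'' ys2 # zs2)))))))"
    by (subst (2) pass_list_swap) (simp add: tensor_lift_pass_list)
  finally show ?thesis .
qed

text \<open>A consequence of coassociativity and \<open>pass_list_comult\<close> for arbitrary
  multilinear maps: splitting \<open>c\<close> before or after it passes \<open>xs\<close> amounts
  to the same.\<close>

lemma list_inside:
  assumes \<phi>: "multicochain (scA D) \<phi>" and \<gamma>: "multicochain (scA D) \<gamma>" and \<eta>: "multicochain (scA D) \<eta>"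
  shows "SC c (\<lambda>c1 c2. SP c2 xs (\<lambda>us d. SP d xs2 (\<lambda>us2 d2. SC c1 (\<lambda>c11 c12.
      SP c12 us (\<lambda>vs e. \<phi> c11 (vs @ \<gamma> e (us2 @ \<eta> d2 ys # zs) # zs2)))))) =
    SC c (\<lambda>c1 c2. SP c2 xs (\<lambda>us d. \<phi> c1 (us @ SC d (\<lambda>d1 d2. SP d2 xs2 (\<lambda>us2 e.
      \<gamma> d1 (us2 @ \<eta> e ys # zs))) # zs2)))"
proof -
  note rules = linear_rules multicochain_arg[OF \<phi>] multicochain_slot[OF \<phi>] multicochain_arg[OF \<gamma>]
    multicochain_slot[OF \<gamma>] multicochain_arg[OF \<eta>] multicochain_slot[OF \<eta>]
  have pull: "\<phi> c1 (us @ SC d (\<lambda>d1 d2. SP d2 xs2 (\<lambda>us2 e. \<gamma> d1 (us2 @ \<eta> e ys # zs))) # zs2) =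
      SC d (\<lambda>d1 d2. SP d2 xs2 (\<lambda>us2 e. \<phi> c1 (us @ \<gamma> d1 (us2 @ \<eta> e ys # zs) # zs2)))" for c1 us d
  proof -
    have L: "Vector_Spaces.linear (scA D) (scA D) (\<lambda>x. \<phi> c1 (us @ x # zs2))"
      by (intro rules)
    show ?thesis
      by (simp only: linear_tensor_lift[OF L] linear_pass_list_out[OF L])
  qed
  have "SC c (\<lambda>c1 c2. SP c2 xs (\<lambda>us d. SC d (\<lambda>d1 d2. SP d2 xs2 (\<lambda>us2 e.
      \<phi> c1 (us @ \<gamma> d1 (us2 @ \<eta> e ys # zs) # zs2))))) =
    SC c (\<lambda>c1 c2. SC c2 (\<lambda>e1 e2. SP e2 xs (\<lambda>us d2. SP e1 us (\<lambda>vs d1.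
      SP d2 xs2 (\<lambda>us2 e. \<phi> c1 (vs @ \<gamma> d1 (us2 @ \<eta> e ys # zs) # zs2))))))"
    by (subst pass_list_comult[of "scA D"]) (intro rules refl)+
  also have "\<dots> = SC c (\<lambda>c1 c2. SC c1 (\<lambda>c11 c12. SP c2 xs (\<lambda>us d2. SP c12 us (\<lambda>vs d1.
      SP d2 xs2 (\<lambda>us2 e. \<phi> c11 (vs @ \<gamma> d1 (us2 @ \<eta> e ys # zs) # zs2))))))"
    by (rule coassoc_lift[symmetric, where u = "scA D"], unfold trilin_def bilin_def) (intro conjI allI rules)+
  also have "\<dots> = SC c (\<lambda>c1 c2. SP c2 xs (\<lambda>us d. SP d xs2 (\<lambda>us2 d2. SC c1 (\<lambda>c11 c12.
      SP c12 us (\<lambda>vs e. \<phi> c11 (vs @ \<gamma> e (us2 @ \<eta> d2 ys # zs) # zs2))))))"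
    by (subst pass_list_swap) (simp add: tensor_lift_pass_list)
  finally show ?thesis by (simp only: pull)
qed

text \<open>Equivariance of \<open>\<phi>\<close> lets the outer copy of \<open>c\<close> pass a
  list that contains the value of \<open>\<gamma>\<close>; equivariance of \<open>\<gamma>\<close>
  replaces this value by the arguments \<open>ys\<close>. Since the whole argument list is passed at
  once, its three blocks are recovered by \<open>take\<close> and \<open>drop\<close>.\<close>

lemma list_equivariant_comp:
  assumes \<phi>: "multicochain (scA D) \<phi>" "list_equivariant (Suc (length xs + length zs)) \<phi>"
    and \<gamma>: "multicochain (scA D) \<gamma>" "list_equivariant (length ys) \<gamma>"
    and F: "bilin (scA D) (scC D) u F"
  shows "SC c (\<lambda>c1 c2. SP c2 (xs @ ys @ zs) (\<lambda>ws d. F (SC c1 (\<lambda>c11 c12.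
      SP c12 (take (length xs) ws) (\<lambda>vs e.
        \<phi> c11 (vs @ \<gamma> e (take (length ys) (drop (length xs) ws)) # drop (length xs + length ys) ws)))) d)) =
    SC c (\<lambda>c1 c2. SA c1 (SC c2 (\<lambda>c21 c22. SP c22 xs (\<lambda>us d. \<phi> c21 (us @ \<gamma> d ys # zs)))) F)"
proof -
  have u: "vector_space u" using F by (rule bilin_target)
  note rules = linear_rules u multicochain_arg[OF \<phi>(1)] multicochain_slot[OF \<phi>(1)] multicochain_arg[OF \<gamma>(1)]
    multicochain_slot[OF \<gamma>(1)] bilin_arg1[OF F] bilin_arg2[OF F]
  have pull: "SA c1 (SC c2 (\<lambda>c21 c22. SP c22 xs (\<lambda>us d. \<phi> c21 (us @ \<gamma> d ys # zs)))) F =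
      SC c2 (\<lambda>c21 c22. SP c22 xs (\<lambda>us d. SA c1 (\<phi> c21 (us @ \<gamma> d ys # zs)) F))" for c1 c2
  proof -
    have L: "Vector_Spaces.linear (scA D) u (\<lambda>x. SA c1 x F)"
      by (intro rules)
    show ?thesis
      by (simp only: linear_tensor_lift[OF L] linear_pass_list_out[OF L])
  qed
  have pull2: "F (SC c1 (\<lambda>c11 c12. SP c12 vs (H c11))) =
      (\<lambda>d. SC c1 (\<lambda>c11 c12. SP c12 vs (\<lambda>us e. F (H c11 us e) d)))" for c1 vs H
  proof (rule ext)
    fix d
    have L: "Vector_Spaces.linear (scA D) u (\<lambda>x. F x d)"
      by (intro rules)
    show "F (SC c1 (\<lambda>c11 c12. SP c12 vs (H c11))) d =
        SC c1 (\<lambda>c11 c12. SP c12 vs (\<lambda>us e. F (H c11 us e) d))"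
      by (simp only: linear_tensor_lift[OF L] linear_pass_list_out[OF L])
  qed
  have "SC c (\<lambda>c1 c2. SC c2 (\<lambda>c21 c22. SP c22 xs (\<lambda>us d. SA c1 (\<phi> c21 (us @ \<gamma> d ys # zs)) F))) =
      SC c (\<lambda>c1 c2. SC c1 (\<lambda>c11 c12. SP c2 xs (\<lambda>us d. SA c11 (\<phi> c12 (us @ \<gamma> d ys # zs)) F)))"
    by (rule coassoc_lift[symmetric, where u = u], unfold trilin_def bilin_def) (intro conjI allI rules)+
  also have "\<dots> = SC c (\<lambda>c1 c2. SP c2 xs (\<lambda>us d. SC c1 (\<lambda>c11 c12. SA c11 (\<phi> c12 (us @ \<gamma> d ys # zs)) F)))"
    by (simp only: tensor_lift_pass_list)
  also have "\<dots> = SC c (\<lambda>c1 c2. SP c2 xs (\<lambda>us d. SC c1 (\<lambda>c11 c12.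
      SP c12 (us @ \<gamma> d ys # zs) (\<lambda>vs e. F (\<phi> c11 vs) e))))"
  proof -
    have "SC c1 (\<lambda>c11 c12. SA c11 (\<phi> c12 (us @ \<gamma> d ys # zs)) F) =
        SC c1 (\<lambda>c11 c12. SP c12 (us @ \<gamma> d ys # zs) (\<lambda>vs e. F (\<phi> c11 vs) e))"
      if "length us = length xs" for c1 us d
      using that by (intro list_equivariant_lift[OF \<phi>(2) F, symmetric]) simp
    then have "SP c2 xs (\<lambda>us d. SC c1 (\<lambda>c11 c12. SA c11 (\<phi> c12 (us @ \<gamma> d ys # zs)) F)) =
        SP c2 xs (\<lambda>us d. SC c1 (\<lambda>c11 c12. SP c12 (us @ \<gamma> d ys # zs) (\<lambda>vs e. F (\<phi> c11 vs) e)))"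
      for c1 c2
      by (intro pass_list_cong) simp
    then show ?thesis by simp
  qed
  also have "\<dots> = SC c (\<lambda>c1 c2. SC c1 (\<lambda>c11 c12. SP c2 xs (\<lambda>us d. SP c12 us (\<lambda>vs e.
      SA e (\<gamma> d ys) (\<lambda>x e'. SP e' zs (\<lambda>zs' e''. F (\<phi> c11 (vs @ x # zs')) e''))))))"
    by (simp add: tensor_lift_pass_list pass_list_append)
  also have "\<dots> = SC c (\<lambda>c1 c2. SC c1 (\<lambda>c11 c12. SP c2 xs (\<lambda>us d. SP d ys (\<lambda>ys' d'.
      SP c12 us (\<lambda>vs e. SP d' zs (\<lambda>zs' d''. F (\<phi> c11 (vs @ \<gamma> e ys' # zs')) d''))))))"
    by (rule equivariant_past_block[OF \<gamma> u]) (intro rules)+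
  also have "\<dots> = SC c (\<lambda>c1 c2. SP c2 xs (\<lambda>us d. SP d ys (\<lambda>ys' d'. SP d' zs (\<lambda>zs' d''.
      F (SC c1 (\<lambda>c11 c12. SP c12 us (\<lambda>vs e. \<phi> c11 (vs @ \<gamma> e ys' # zs')))) d''))))"
    by (subst (2) pass_list_swap) (simp add: tensor_lift_pass_list pull2)
  also have "\<dots> = SC c (\<lambda>c1 c2. SP c2 (xs @ ys @ zs) (\<lambda>ws d. F (SC c1 (\<lambda>c11 c12.
      SP c12 (take (length xs) ws) (\<lambda>vs e.
        \<phi> c11 (vs @ \<gamma> e (take (length ys) (drop (length xs) ws)) # drop (length xs + length ys) ws)))) d))"
  proof -
    have "SP c2 xs (\<lambda>us d. SP d ys (\<lambda>ys' d'. SP d' zs (\<lambda>zs' d''.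
      F (SC c1 (\<lambda>c11 c12. SP c12 us (\<lambda>vs e. \<phi> c11 (vs @ \<gamma> e ys' # zs')))) d''))) =
      SP c2 (xs @ ys @ zs) (\<lambda>ws d. F (SC c1 (\<lambda>c11 c12.
        SP c12 (take (length xs) ws) (\<lambda>vs e.
        \<phi> c11 (vs @ \<gamma> e (take (length ys) (drop (length xs) ws)) # drop (length xs + length ys) ws)))) d)" for c1 c2
      unfolding pass_list_append by (intro pass_list_cong) simp
    then show ?thesis by simp
  qed
  finally show ?thesis by (simp only: pull)
qed

end

lemma linear_map_zero: "Vector_Spaces.linear s t f \<Longrightarrow> f 0 = 0"
  unfolding linear_iff_add_scale by (metis add_cancel_left_left)

section \<open>Insertions of cochains\<close>

text \<open>Every reindexing of off-diagonal entries multiplies the entries of consecutive blocks.  In this form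
  it is determined by the starting points of the blocks, and a composite of two reindexings is again of
  this form; so identities between them reduce to identities between functions on indices.\<close>

definition blocks :: "(nat \<Rightarrow> nat) \<Rightarrow> (nat \<Rightarrow> nat \<Rightarrow> 'b::comm_monoid_mult) \<Rightarrow> nat \<Rightarrow> nat \<Rightarrow> 'b"
  where "blocks lo b r s = (\<Prod>x\<in>{lo r..<lo (Suc r)}. \<Prod>y\<in>{lo s..<lo (Suc s)}. b x y)"

text \<open>Block \<open>i + 1\<close> consists of the indices that an inserted cochain with
  \<open>n\<close> inputs occupies. For \<open>n = 0\<close> it is empty, and the products over it
  are 1.\<close>

definition block_start :: "nat \<Rightarrow> nat \<Rightarrow> nat \<Rightarrow> nat"
  where "block_start n i r = (if r \<le> i + 1 then r else r + n - 1)"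

lemma mono_block_start: "mono (block_start n i)"
  by (auto simp: mono_def block_start_def)

lemma atLeastLessThan_Suc_self: "{n..<Suc n} = {n}"
  by auto

lemma blocks_shift: "blocks ((+) i) b = shift_off i b"
  by (simp add: blocks_def shift_off_def fun_eq_iff atLeastLessThan_Suc_self)

lemma insert_off_eq_blocks:
  assumes "r < s" shows "insert_off n i b r s = blocks (block_start n i) b r s"
proof -
  consider "s \<le> i" | "s = i + 1" | "i + 1 < s" "r \<le> i" | "i + 1 < s" "r = i + 1" | "i + 1 < r"
    by linarith
  then show ?thesis
  proof cases
    case 1
    then show ?thesis using assms
      by (simp add: blocks_def insert_off_def block_start_def atLeastLessThan_Suc_self)
  next
    case 2
    have "block_start n i r = r" "block_start n i (Suc r) = Suc r" "block_start n i s = i + 1"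
      "block_start n i (Suc s) = Suc (i + n)" using 2 assms by (auto simp: block_start_def)
    then show ?thesis using 2
      by (simp add: blocks_def insert_off_def atLeastLessThan_Suc_self atLeastLessThanSuc_atLeastAtMost)
  next
    case 3
    then have e: "block_start n i r = r" "block_start n i (Suc r) = Suc r" "block_start n i s = s + n - 1"
      "block_start n i (Suc s) = Suc (s + n - 1)" by (auto simp: block_start_def)
    show ?thesis
      unfolding blocks_def e atLeastLessThan_Suc_self using 3 by (simp add: insert_off_def)
  next
    case 4
    then have e: "block_start n i r = i + 1" "block_start n i (Suc r) = Suc (i + n)" "block_start n i s = s + n - 1"
      "block_start n i (Suc s) = Suc (s + n - 1)" by (auto simp: block_start_def)
    show ?thesis
      unfolding blocks_def e atLeastLessThan_Suc_self atLeastLessThanSuc_atLeastAtMost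
      using 4 by (simp add: insert_off_def)
  next
    case 5
    then have e: "block_start n i r = r + n - 1" "block_start n i (Suc r) = Suc (r + n - 1)"
      "block_start n i s = s + n - 1" "block_start n i (Suc s) = Suc (s + n - 1)"
      using assms by (auto simp: block_start_def)
    show ?thesis
      unfolding blocks_def e atLeastLessThan_Suc_self using 5 assms by (simp add: insert_off_def)
  qed
qed

lemma prod_consecutive_blocks:
  fixes F :: "nat \<Rightarrow> 'b::comm_monoid_mult"
  assumes "mono lo"
  shows "(\<Prod>x\<in>{u..<v}. \<Prod>y\<in>{lo x..<lo (Suc x)}. F y) = (\<Prod>y\<in>{lo u..<lo v}. F y)"
proof (cases "u \<le> v")
  case True
  then show ?thesis
  proof (induction v rule: dec_induct)
    case (step w)
    have "{lo u..<lo (Suc w)} = {lo u..<lo w} \<union> {lo w..<lo (Suc w)}"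
      using monoD[OF assms, of u w] monoD[OF assms, of w "Suc w"] step by auto
    then have "(\<Prod>y\<in>{lo u..<lo (Suc w)}. F y) = (\<Prod>y\<in>{lo u..<lo w}. F y) * (\<Prod>y\<in>{lo w..<lo (Suc w)}. F y)"
      by (simp add: prod.union_disjoint)
    then show ?case using step by simp
  qed simp
next
  case False
  then show ?thesis using monoD[OF assms, of v u] by simp
qed

lemma blocks_blocks:
  assumes "mono lo'"
  shows "blocks lo (blocks lo' b) = blocks (lo' \<circ> lo) b"
proof (intro ext)
  fix r s
  have "blocks lo (blocks lo' b) r s = (\<Prod>x\<in>{lo r..<lo (Suc r)}. \<Prod>x'\<in>{lo' x..<lo' (Suc x)}.
      \<Prod>y\<in>{lo s..<lo (Suc s)}. \<Prod>y'\<in>{lo' y..<lo' (Suc y)}. b x' y')"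
    unfolding blocks_def by (intro prod.cong refl prod.swap)
  then show "blocks lo (blocks lo' b) r s = blocks (lo' \<circ> lo) b r s"
    by (simp add: prod_consecutive_blocks[OF assms] blocks_def)
qed

definition in_block :: "(nat \<Rightarrow> nat) \<Rightarrow> nat \<Rightarrow> nat \<Rightarrow> bool"
  where "in_block lo r x \<longleftrightarrow> lo r \<le> x \<and> x < lo (Suc r)"

lemma in_block_unique:
  assumes "mono lo" "in_block lo r x" "in_block lo s x"
  shows "r = s"
  using assms monoD[OF assms(1), of "Suc r" s] monoD[OF assms(1), of "Suc s" r]
  by (cases r s rule: linorder_cases) (auto simp: in_block_def)

text \<open>The entry at \<open>(x, y)\<close> is a factor of exactly one block product, and only
  once, so this product is linear in it. The cofactor is obtained without division, by setting the
  entry to 1.\<close>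

lemma blocks_update:
  fixes t :: "'b::comm_monoid_mult"
  assumes lo: "mono lo" and r: "in_block lo r x" and s: "in_block lo s y"
  shows "blocks lo (b(x := (b x)(y := t))) =
    (blocks lo b)(r := (blocks lo b r)(s := t * blocks lo (b(x := (b x)(y := 1))) r s))"
proof (intro ext)
  fix r' s'
  show "blocks lo (b(x := (b x)(y := t))) r' s' =
    ((blocks lo b)(r := (blocks lo b r)(s := t * blocks lo (b(x := (b x)(y := 1))) r s))) r' s'"
  proof (cases "r' = r \<and> s' = s")
    case True
    let ?X = "{lo r..<lo (Suc r)}" and ?Y = "{lo s..<lo (Suc s)}"
    have x: "x \<in> ?X" and y: "y \<in> ?Y" using r s by (auto simp: in_block_def)
    have "blocks lo (b(x := (b x)(y := t))) r s =
        (t * (\<Prod>y'\<in>?Y - {y}. b x y')) * (\<Prod>x'\<in>?X - {x}. \<Prod>y'\<in>?Y. b x' y')" for t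
    proof -
      have "blocks lo (b(x := (b x)(y := t))) r s = (\<Prod>y'\<in>?Y. if y' = y then t else b x y') *
          (\<Prod>x'\<in>?X - {x}. \<Prod>y'\<in>?Y. b x' y')"
        unfolding blocks_def using x by (subst prod.remove[of _ x]) (auto intro!: prod.cong arg_cong2[of _ _ _ _ "(*)"])
      also have "(\<Prod>y'\<in>?Y. if y' = y then t else b x y') = t * (\<Prod>y'\<in>?Y - {y}. b x y')"
        using y by (subst prod.remove[of _ y]) (auto intro!: prod.cong arg_cong2[of _ _ _ _ "(*)"])
      finally show ?thesis .
    qed
    from this[of t] this[of 1] show ?thesis using True by (simp add: mult.assoc)
  next
    case False
    have "\<not> (in_block lo r' x \<and> in_block lo s' y)"
      using False in_block_unique[OF lo r] in_block_unique[OF lo s] by auto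
    then have "blocks lo (b(x := (b x)(y := t))) r' s' = blocks lo b r' s'"
      unfolding blocks_def in_block_def by (intro prod.cong refl) auto
    then show ?thesis using False by auto
  qed
qed

lemma blocks_update_outside:
  assumes "\<not> (in_block lo r x \<and> in_block lo s y)"
  shows "blocks lo (b(x := (b x)(y := t))) r s = blocks lo b r s"
  using assms unfolding blocks_def in_block_def by (intro prod.cong refl) auto

text \<open>Cochains vanish on lists of the wrong length, so that no length conditions arise in
  statements about multilinearity.\<close>

definition on_list ::
  "nat \<Rightarrow> ('a::zero, 'b, 'c) cochain \<Rightarrow> (nat \<Rightarrow> nat \<Rightarrow> 'b) \<Rightarrow> 'c \<Rightarrow> 'a list \<Rightarrow> 'a"
  where "on_list n f b c xs = (if length xs = n then f c (subst_diag (\<lambda>_. 0) xs) b else 0)"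

lemma map_subst_diag:
  assumes "v \<le> length L"
  shows "map (subst_diag z L) [Suc u..<Suc v] = take (v - u) (drop u L)"
  using assms by (intro nth_equalityI) (auto simp: subst_diag_def simp del: upt_Suc)

lemma map_fun_upd_upt:
  assumes "u \<le> k" "k < v"
  shows "map (a(k := x)) [u..<v] = map a [u..<k] @ x # map a [Suc k..<v]"
proof -
  have "[u..<v] = [u..<k] @ k # [Suc k..<v]"
    using assms upt_add_eq_append[of u k "v - k"] by (simp add: upt_conv_Cons)
  then show ?thesis by auto
qed

context entwining_structure_over begin

section \<open>Cochains as functions of lists\<close>

lemma cochain_cong:
  assumes "f \<in> cochains D n" "\<And>i. 1 \<le> i \<Longrightarrow> i \<le> n \<Longrightarrow> a i = a' i"
    "\<And>i j. 1 \<le> i \<Longrightarrow> i < j \<Longrightarrow> j \<le> n \<Longrightarrow> b i j = b' i j"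
  shows "f c a b = f c a' b'"
  using assms unfolding cochains_def by auto

lemma on_list_cong:
  "f \<in> cochains D n \<Longrightarrow> (\<And>i j. 1 \<le> i \<Longrightarrow> i < j \<Longrightarrow> j \<le> n \<Longrightarrow> b i j = b' i j) \<Longrightarrow>
    on_list n f b = on_list n f b'"
  by (auto simp: on_list_def fun_eq_iff intro: cochain_cong)

lemma on_list_blocks_cong:
  assumes f: "f \<in> cochains D n" and lo: "\<And>r. 1 \<le> r \<Longrightarrow> r \<le> Suc n \<Longrightarrow> lo r = lo' r"
  shows "on_list n f (blocks lo b) = on_list n f (blocks lo' b)"
proof (rule on_list_cong[OF f])
  fix r s assume "1 \<le> r" "r < s" "s \<le> n"
  then have "lo r = lo' r" "lo (Suc r) = lo' (Suc r)" "lo s = lo' s" "lo (Suc s) = lo' (Suc s)"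
    by (auto intro!: lo)
  then show "blocks lo b r s = blocks lo' b r s"
    by (simp only: blocks_def)
qed

lemma on_list_eq:
  assumes f: "f \<in> cochains D n" and "length xs = n" "\<And>p. 1 \<le> p \<Longrightarrow> p \<le> n \<Longrightarrow> a p = xs ! (p - 1)"
    "\<And>i j. 1 \<le> i \<Longrightarrow> i < j \<Longrightarrow> j \<le> n \<Longrightarrow> b i j = b' i j"
  shows "f c a b = on_list n f b' c xs"
proof -
  have "f c a b = f c (subst_diag (\<lambda>_. 0) xs) b'"
    by (rule cochain_cong[OF f]) (simp_all add: subst_diag_def assms)
  then show ?thesis using assms(2) by (simp add: on_list_def)
qed

lemma on_list_map:
  assumes f: "f \<in> cochains D n"
  shows "on_list n f b c (map a [1..<Suc n]) = f c a b"
  by (rule on_list_eq[OF f, symmetric]) (simp_all del: upt_Suc)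

lemma cochain_eqI:
  assumes "f \<in> cochains D n" "g \<in> cochains D n"
    "\<And>b c xs. length xs = n \<Longrightarrow> on_list n f b c xs = on_list n g b c xs"
  shows "f = g"
proof (intro ext)
  fix c a b
  show "f c a b = g c a b"
  proof -
    have "f c a b = on_list n f b c (map a [1..<Suc n])" by (rule on_list_map[OF assms(1), symmetric])
    also have "\<dots> = on_list n g b c (map a [1..<Suc n])" by (rule assms(3)) simp
    also have "\<dots> = g c a b" by (rule on_list_map[OF assms(2)])
    finally show ?thesis .
  qed
qed

lemma zero_cochain: "0 \<in> cochains D n"
  by (simp add: cochains_def linear_zero)

lemma multicochain_on_list:
  assumes f: "f \<in> cochains D n"
  shows "multicochain (scA D) (on_list n f b)"
  unfolding multicochain_def multilinear_def
proof (intro conjI allI)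
  show "Vector_Spaces.linear (scC D) (scA D) (\<lambda>c. on_list n f b c xs)" for xs
    using f by (cases "length xs = n") (simp_all add: on_list_def cochains_def linear_zero)
  show "Vector_Spaces.linear (scA D) (scA D) (\<lambda>x. on_list n f b c (ys @ x # zs))" for c ys zs
  proof (cases "length ys + length zs + 1 = n")
    case True
    have "on_list n f b c (ys @ x # zs) = f c ((subst_diag (\<lambda>_. 0) (ys @ 0 # zs))(length ys + 1 := x)) b" for x
      using True by (intro on_list_eq[OF f, symmetric]) (auto simp: subst_diag_def nth_append nth_Cons')
    moreover have "Vector_Spaces.linear (scA D) (scA D)
        (\<lambda>x. f c ((subst_diag (\<lambda>_. 0) (ys @ 0 # zs))(length ys + 1 := x)) b)"
      using f True by (auto simp: cochains_def)
    ultimately show ?thesis by simp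
  next
    case False
    then show ?thesis by (simp add: on_list_def linear_zero)
  qed
qed

lemma on_list_blocks_update:
  assumes f: "f \<in> cochains D n" and lo: "mono lo" and rs: "1 \<le> r" "r < s" "s \<le> n" "in_block lo r x" "in_block lo s y"
  shows "Vector_Spaces.linear (scB D) (scA D) (\<lambda>t. on_list n f (blocks lo (b(x := (b x)(y := t)))) c xs)"
proof (cases "length xs = n")
  case True
  let ?p = "blocks lo (b(x := (b x)(y := 1))) r s"
  have "Vector_Spaces.linear (scB D) (scB D) (\<lambda>t. t * ?p)"
    by (simp add: linear_iff_add_scale distrib_right B.scale_mult_left)
  moreover have "Vector_Spaces.linear (scB D) (scA D)
      (\<lambda>t. f c (subst_diag (\<lambda>_. 0) xs) ((blocks lo b)(r := (blocks lo b r)(s := t))))"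
    using f rs by (auto simp: cochains_def)
  ultimately have "Vector_Spaces.linear (scB D) (scA D)
      (\<lambda>t. f c (subst_diag (\<lambda>_. 0) xs) ((blocks lo b)(r := (blocks lo b r)(s := t * ?p))))"
    by (rule linear_comp)
  moreover have "on_list n f (blocks lo (b(x := (b x)(y := t)))) c xs =
      f c (subst_diag (\<lambda>_. 0) xs) ((blocks lo b)(r := (blocks lo b r)(s := t * ?p)))" for t
    unfolding on_list_def blocks_update[OF lo rs(4,5), of b t] using True by simp
  ultimately show ?thesis by (simp only:)
qed (simp add: on_list_def linear_zero)

lemma on_list_blocks_const:
  assumes f: "f \<in> cochains D n"
    and "\<And>r s. 1 \<le> r \<Longrightarrow> r < s \<Longrightarrow> s \<le> n \<Longrightarrow> \<not> (in_block lo r x \<and> in_block lo s y)"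
  shows "on_list n f (blocks lo (b(x := (b x)(y := t)))) = on_list n f (blocks lo b)"
  using assms(2) by (intro on_list_cong[OF f] blocks_update_outside) auto

section \<open>Insertions in list form\<close>

lemma dia_eq:
  assumes f: "f \<in> cochains D m" and g: "g \<in> cochains D n" and i: "i < m"
  shows "dia D m n i f g c a b = SC c (\<lambda>c1 c2. SP c2 (map a [1..<Suc i]) (\<lambda>us d.
    on_list m f (blocks (block_start n i) b) c1 (us @
      on_list n g (blocks ((+) i) b) d (map a [Suc i..<Suc (i + n)]) # map a [Suc (i + n)..<m + n])))"
proof -
  have g': "g d (shift_diag i a') (shift_off i b) = on_list n g (blocks ((+) i) b) d (map a' [Suc i..<Suc (i + n)])" for d a'
    by (rule on_list_eq[OF g]) (auto simp: shift_diag_def blocks_shift nth_append simp del: upt_Suc)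
  have "f c1 (insert_diag n i (g d (shift_diag i a) (shift_off i b)) (subst_diag a us)) (insert_off n i b) =
    on_list m f (blocks (block_start n i) b) c1 (us @
      on_list n g (blocks ((+) i) b) d (map a [Suc i..<Suc (i + n)]) # map a [Suc (i + n)..<m + n])"
    if us: "length us = length (map a [1..<Suc i])" for us c1 d
  proof (rule on_list_eq[OF f])
    fix p assume p: "1 \<le> p" "p \<le> m"
    show "insert_diag n i (g d (shift_diag i a) (shift_off i b)) (subst_diag a us) p =
      (us @ on_list n g (blocks ((+) i) b) d (map a [Suc i..<Suc (i + n)]) # map a [Suc (i + n)..<m + n]) ! (p - 1)"
      using us p unfolding g'
      by (auto simp: insert_diag_def subst_diag_def nth_append nth_Cons' simp del: upt_Suc
          intro!: arg_cong[where f = a])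
  qed (use us i in \<open>auto simp: insert_off_eq_blocks simp del: upt_Suc\<close>)
  then have "SP c2 (map a [1..<Suc i]) (\<lambda>us d. f c1 (insert_diag n i (g d (shift_diag i a) (shift_off i b)) (subst_diag a us)) (insert_off n i b)) =
      SP c2 (map a [1..<Suc i]) (\<lambda>us d. on_list m f (blocks (block_start n i) b) c1 (us @
      on_list n g (blocks ((+) i) b) d (map a [Suc i..<Suc (i + n)]) # map a [Suc (i + n)..<m + n]))" for c1 c2
    by (intro pass_list_cong)
  then show ?thesis using i by (simp add: dia_def pass_eq_pass_list del: upt_Suc)
qed

text \<open>Both sides vanish unless \<open>i < m\<close> and \<open>zs\<close> has length
  \<open>m - 1 - i\<close>, so \<open>zs\<close> may be arbitrary. In this form insertions can be
  iterated by concatenating lists.\<close>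

lemma dia_on_list:
  assumes f: "f \<in> cochains D m" and g: "g \<in> cochains D n" and xs: "length xs = i" and ys: "length ys = n"
  shows "on_list (m + n - 1) (dia D m n i f g) b c (xs @ ys @ zs) =
    SC c (\<lambda>c1 c2. SP c2 xs (\<lambda>us d. on_list m f (blocks (block_start n i) b) c1
      (us @ on_list n g (blocks ((+) i) b) d ys # zs)))"
proof (cases "i < m \<and> length zs = m - 1 - i")
  case True
  let ?a = "subst_diag (\<lambda>_. 0) (xs @ ys @ zs)"
  have len: "length (xs @ ys @ zs) = m + n - 1"
    using True xs ys by simp
  have "map ?a [Suc 0..<Suc i] = take (i - 0) (drop 0 (xs @ ys @ zs))"
    by (rule map_subst_diag) (use True in \<open>simp only: len\<close>, linarith)
  then have "map ?a [1..<Suc i] = xs"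
    using xs by (simp del: upt_Suc)
  moreover have "map ?a [Suc i..<Suc (i + n)] = take (i + n - i) (drop i (xs @ ys @ zs))"
    by (rule map_subst_diag) (use True in \<open>simp only: len\<close>, linarith)
  then have "map ?a [Suc i..<Suc (i + n)] = ys"
    using xs ys by (simp del: upt_Suc)
  moreover have "map ?a [Suc (i + n)..<Suc (m + n - 1)] = take (m + n - 1 - (i + n)) (drop (i + n) (xs @ ys @ zs))"
    by (rule map_subst_diag) (simp only: len)
  then have "map ?a [Suc (i + n)..<m + n] = zs"
    using xs ys True by (simp del: upt_Suc)
  moreover note len
  moreover have "dia D m n i f g c ?a b = SC c (\<lambda>c1 c2. SP c2 (map ?a [1..<Suc i]) (\<lambda>us d.
    on_list m f (blocks (block_start n i) b) c1 (us @
      on_list n g (blocks ((+) i) b) d (map ?a [Suc i..<Suc (i + n)]) # map ?a [Suc (i + n)..<m + n])))"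
    using True by (intro dia_eq f g) simp
  ultimately show ?thesis
    by (simp only: on_list_def[of "m + n - 1"] if_True simp_thms)
next
  case False
  have "SP c2 xs (\<lambda>us d. on_list m f (blocks (block_start n i) b) c1
      (us @ on_list n g (blocks ((+) i) b) d ys # zs)) = SP c2 xs (\<lambda>us d. 0)" for c1 c2
    using False xs by (intro pass_list_cong) (auto simp: on_list_def)
  moreover have "on_list (m + n - 1) (dia D m n i f g) b c (xs @ ys @ zs) = 0"
    using False xs ys by (auto simp: on_list_def dia_def)
  ultimately show ?thesis by simp
qed

lemma in_block_shift: "in_block ((+) i) r x \<longleftrightarrow> x = i + r"
  by (auto simp: in_block_def)

lemma in_block_start:
  "in_block (block_start n i) r x \<longleftrightarrow>
    (if r \<le> i then x = r else if r = Suc i then i < x \<and> x \<le> i + n else x + 1 = r + n)"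
  by (auto simp: in_block_def block_start_def)

lemma dia_cochain:
  assumes f: "f \<in> cochains D m" and g: "g \<in> cochains D n"
  shows "dia D m n i f g \<in> cochains D (m + n - 1)"
proof (cases "i < m")
  case i: True
  note mf = multicochain_on_list[OF f] and mg = multicochain_on_list[OF g]
  note rules = linear_rules multicochain_arg[OF mf] multicochain_slot[OF mf]
    multicochain_arg[OF mg] multicochain_slot[OF mg]
  show ?thesis
    unfolding cochains_def
  proof (intro CollectI conjI allI ballI impI)
    show "Vector_Spaces.linear (scC D) (scA D) (\<lambda>c. dia D m n i f g c a b)" for a b
      unfolding dia_eq[OF f g i] by (intro rules)
    fix c a b
    show "Vector_Spaces.linear (scA D) (scA D) (\<lambda>x. dia D m n i f g c (a(k := x)) b)"
      if k: "k \<in> {1..m + n - 1}" for k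
    proof -
      have other: "map (a(k := x)) [u..<v] = map a [u..<v]" if "k < u \<or> v \<le> k" for u v x
        using that by auto
      consider "k \<le> i" | "i < k" "k \<le> i + n" | "i + n < k" by linarith
      then show ?thesis
      proof cases
        case 1
        have "map (a(k := x)) [1..<Suc i] = map a [1..<k] @ x # map a [Suc k..<Suc i]" for x
          using 1 k by (intro map_fun_upd_upt) auto
        moreover have "map (a(k := x)) [Suc i..<Suc (i + n)] = map a [Suc i..<Suc (i + n)]" "map (a(k := x)) [Suc (i + n)..<m + n] = map a [Suc (i + n)..<m + n]" for x
          using 1 by (auto intro!: other)
        ultimately show ?thesis
          unfolding dia_eq[OF f g i] by (simp only:) (intro rules)
      next
        case 2
        have "map (a(k := x)) [Suc i..<Suc (i + n)] = map a [Suc i..<k] @ x # map a [Suc k..<Suc (i + n)]" for x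
          using 2 k by (intro map_fun_upd_upt) auto
        moreover have "map (a(k := x)) [1..<Suc i] = map a [1..<Suc i]" "map (a(k := x)) [Suc (i + n)..<m + n] = map a [Suc (i + n)..<m + n]" for x
          using 2 by (auto intro!: other)
        ultimately show ?thesis
          unfolding dia_eq[OF f g i] by (simp only:) (intro rules)
      next
        case 3
        have "map (a(k := x)) [Suc (i + n)..<m + n] = map a [Suc (i + n)..<k] @ x # map a [Suc k..<m + n]" for x
          using 3 k by (intro map_fun_upd_upt) auto
        moreover have "map (a(k := x)) [1..<Suc i] = map a [1..<Suc i]" "map (a(k := x)) [Suc i..<Suc (i + n)] = map a [Suc i..<Suc (i + n)]" for x
          using 3 by (auto intro!: other)
        ultimately show ?thesis
          unfolding dia_eq[OF f g i] by (simp only:) (intro rules)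
      qed
    qed
    show "Vector_Spaces.linear (scB D) (scA D) (\<lambda>t. dia D m n i f g c a (b(x := (b x)(y := t))))"
      if xy: "1 \<le> x \<and> x < y \<and> y \<le> m + n - 1" for x y
    proof (cases "i < x \<and> y \<le> i + n")
      \<comment> \<open>An entry with both indices in the inserted range affects only
        \<open>g\<close>; every other entry affects only \<open>f\<close>.\<close>
      case True
      then have "on_list m f (blocks (block_start n i) (b(x := (b x)(y := t)))) = on_list m f (blocks (block_start n i) b)" for t
        using xy by (intro on_list_blocks_const[OF f]) (auto simp: in_block_start split: if_splits)
      moreover have "Vector_Spaces.linear (scB D) (scA D)
          (\<lambda>t. on_list n g (blocks ((+) i) (b(x := (b x)(y := t)))) d ys)" for d ys
        using True xy by (intro on_list_blocks_update[OF g, where r = "x - i" and s = "y - i"])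
          (auto simp: in_block_shift mono_def)
      ultimately show ?thesis
        unfolding dia_eq[OF f g i] by (simp only:) (intro rules)
    next
      case False
      \<comment> \<open>\<open>col z\<close> is the index of the block that contains
        \<open>z\<close>.\<close>
      define col where "col z = (if z \<le> i then z else if z \<le> i + n then Suc i else z + 1 - n)" for z
      have "on_list n g (blocks ((+) i) (b(x := (b x)(y := t)))) = on_list n g (blocks ((+) i) b)" for t
        using False xy by (intro on_list_blocks_const[OF g]) (auto simp: in_block_shift)
      moreover have "Vector_Spaces.linear (scB D) (scA D)
          (\<lambda>t. on_list m f (blocks (block_start n i) (b(x := (b x)(y := t)))) c us)" for c us
        using False xy i by (intro on_list_blocks_update[OF f mono_block_start, where r = "col x" and s = "col y"])
          (auto simp: in_block_start col_def)
      ultimately show ?thesis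
        unfolding dia_eq[OF f g i] by (simp only:) (intro rules)
    qed
    fix a' b' assume ab: "(\<forall>i\<in>{1..m + n - 1}. a i = a' i) \<and>
      (\<forall>i j. 1 \<le> i \<and> i < j \<and> j \<le> m + n - 1 \<longrightarrow> b i j = b' i j)"
    have "on_list m f (blocks (block_start n i) b) = on_list m f (blocks (block_start n i) b')"
    proof (rule on_list_cong[OF f])
      fix r s assume "1 \<le> r" "r < s" "s \<le> m"
      moreover from this have "x < y" if "in_block (block_start n i) r x" "in_block (block_start n i) s y" for x y
        using that by (auto simp: in_block_start split: if_splits)
      moreover from \<open>1 \<le> r\<close> have "1 \<le> x" if "in_block (block_start n i) r x" for x
        using that by (auto simp: in_block_start split: if_splits)
      moreover from \<open>s \<le> m\<close> have "y \<le> m + n - 1" if "in_block (block_start n i) s y" for y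
        using that i by (auto simp: in_block_start split: if_splits)
      ultimately show "blocks (block_start n i) b r s = blocks (block_start n i) b' r s"
        unfolding blocks_def using ab by (intro prod.cong refl) (auto simp: in_block_def)
    qed
    moreover have "on_list n g (blocks ((+) i) b) = on_list n g (blocks ((+) i) b')"
      using ab i by (intro on_list_cong[OF g]) (auto simp: blocks_shift shift_off_def)
    moreover have "map a [1..<Suc i] = map a' [1..<Suc i]" "map a [Suc i..<Suc (i + n)] = map a' [Suc i..<Suc (i + n)]"
      "map a [Suc (i + n)..<m + n] = map a' [Suc (i + n)..<m + n]"
      using ab i by (auto simp del: upt_Suc)
    ultimately show "dia D m n i f g c a b = dia D m n i f g c a' b'"
      unfolding dia_eq[OF f g i] by (simp only:)
  qed
next
  case False
  then show ?thesis by (simp add: dia_def zero_cochain)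
qed

lemma equivariant_iff:
  assumes f: "f \<in> cochains D n"
  shows "equivariant D n f \<longleftrightarrow> (\<forall>b. list_equivariant n (on_list n f b))"
proof -
  have 1: "f c (subst_diag a us) b = on_list n f b c us" if "length us = n" for c a us b
    using that by (intro on_list_eq[OF f]) (auto simp: subst_diag_def)
  have 2: "pass D n c2 a (\<lambda>a' d. tens (scA D) (scC D) (f c1 a' b) d) =
      SP c2 (map a [1..<Suc n]) (\<lambda>us d. tens (scA D) (scC D) (on_list n f b c1 us) d)" for c1 c2 a b
    unfolding pass_eq_pass_list by (intro pass_list_cong) (simp add: 1 del: upt_Suc)
  have 3: "map (subst_diag (\<lambda>_. 0) xs) [1..<Suc n] = xs" if "length xs = n" for xs :: "'a list"
    using that map_subst_diag[of n xs _ 0] by (simp del: upt_Suc)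
  show ?thesis
    unfolding equivariant_def list_equivariant_def 2
  proof (intro iffI allI impI)
    fix b c and xs :: "'a list"
    assume "length xs = n" and *: "\<forall>c a b. SC c (\<lambda>c1 c2. SP c2 (map a [1..<Suc n])
        (\<lambda>us. tens (scA D) (scC D) (on_list n f b c1 us))) = SC c (\<lambda>c1 c2. psi D c1 (f c2 a b))"
    then show "SC c (\<lambda>c1 c2. SP c2 xs (\<lambda>us. tens (scA D) (scC D) (on_list n f b c1 us))) =
        SC c (\<lambda>c1 c2. psi D c1 (on_list n f b c2 xs))"
      using *[rule_format, where c = c and a = "subst_diag (\<lambda>_. 0) xs" and b = b] by (simp only: 3) (simp add: on_list_def)
  next
    fix c a b
    assume *: "\<forall>b c xs. length xs = n \<longrightarrow> SC c (\<lambda>c1 c2. SP c2 xs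
        (\<lambda>us. tens (scA D) (scC D) (on_list n f b c1 us))) = SC c (\<lambda>c1 c2. psi D c1 (on_list n f b c2 xs))"
    have "SC c (\<lambda>c1 c2. SP c2 (map a [1..<Suc n]) (\<lambda>us. tens (scA D) (scC D) (on_list n f b c1 us))) =
        SC c (\<lambda>c1 c2. psi D c1 (on_list n f b c2 (map a [1..<Suc n])))"
      by (rule *[rule_format]) simp
    then show "SC c (\<lambda>c1 c2. SP c2 (map a [1..<Suc n]) (\<lambda>us. tens (scA D) (scC D) (on_list n f b c1 us))) =
        SC c (\<lambda>c1 c2. psi D c1 (f c2 a b))"
      by (simp only: on_list_map[OF f])
  qed
qed

lemma dia_outside: "m \<le> i \<Longrightarrow> dia D m n i f g = 0"
  by (simp add: dia_def)

lemma dia_zero_left: "dia D m n i 0 g = 0"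
  by (simp add: dia_def fun_eq_iff pass_eq_pass_list)

lemma zero_equivariant: "equivariant D n 0"
proof -
  have "tens (scA D) (scC D) 0 d = 0" for d
    using linear_map_zero[of "scA D" scale_tensor "\<lambda>x. tens (scA D) (scC D) x d"] bilin_tens[OF vector_spaces(1,3)]
    by (auto simp: bilin_def)
  moreover have "psi D c 0 = 0" for c
    using psi_bilin linear_map_zero[of "scA D" scale_tensor "psi D c"] by (auto simp: bilin_def)
  ultimately show ?thesis by (simp add: equivariant_def pass_eq_pass_list)
qed

lemma dia_equivariant:
  assumes f: "f \<in> cochains D m" "equivariant D m f" and g: "g \<in> cochains D n" "equivariant D n g"
  shows "equivariant D (m + n - 1) (dia D m n i f g)"
proof (cases "i < m")
  case i: True
  show ?thesis
    unfolding equivariant_iff[OF dia_cochain[OF f(1) g(1)]]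
    unfolding list_equivariant_def
  proof (intro allI impI)
    fix b c and L :: "'a list" assume L: "length L = m + n - 1"
    define xs ys zs where "xs = take i L" and "ys = take n (drop i L)" and "zs = drop (i + n) L"
    have L_eq: "L = xs @ ys @ zs"
      by (simp add: xs_def ys_def zs_def drop_drop[symmetric] add.commute[of i] del: drop_drop)
    have len: "length xs = i" "length ys = n" "length zs = m - 1 - i"
      using L i by (auto simp: xs_def ys_def zs_def)
    let ?\<phi> = "on_list m f (blocks (block_start n i) b)" and ?\<gamma> = "on_list n g (blocks ((+) i) b)"
    have \<phi>: "multicochain (scA D) ?\<phi>" "list_equivariant (Suc (length xs + length zs)) ?\<phi>"
      using f i len by (simp_all add: multicochain_on_list equivariant_iff)
    have \<gamma>: "multicochain (scA D) ?\<gamma>" "list_equivariant (length ys) ?\<gamma>"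
      using g len by (simp_all add: multicochain_on_list equivariant_iff)
    have "SP c2 L (\<lambda>ws d. tens (scA D) (scC D) (on_list (m + n - 1) (dia D m n i f g) b c1 ws) d) =
      SP c2 L (\<lambda>ws d. tens (scA D) (scC D) (SC c1 (\<lambda>c11 c12.
      SP c12 (take (length xs) ws) (\<lambda>vs e.
        ?\<phi> c11 (vs @ ?\<gamma> e (take (length ys) (drop (length xs) ws)) # drop (length xs + length ys) ws)))) d)" for c1 c2
    proof (rule pass_list_cong)
      fix ws :: "'a list" and d assume ws: "length ws = length L"
      have ws_eq: "ws = take i ws @ take n (drop i ws) @ drop (i + n) ws"
        by (simp add: drop_drop[symmetric] add.commute[of i] del: drop_drop)
      have "on_list (m + n - 1) (dia D m n i f g) b c1 (take i ws @ take n (drop i ws) @ drop (i + n) ws) =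
        SC c1 (\<lambda>c11 c12. SP c12 (take i ws) (\<lambda>vs e. ?\<phi> c11 (vs @ ?\<gamma> e (take n (drop i ws)) # drop (i + n) ws)))"
        using ws L i by (intro dia_on_list f g) auto
      then show "tens (scA D) (scC D) (on_list (m + n - 1) (dia D m n i f g) b c1 ws) d =
        tens (scA D) (scC D) (SC c1 (\<lambda>c11 c12. SP c12 (take (length xs) ws) (\<lambda>vs e.
        ?\<phi> c11 (vs @ ?\<gamma> e (take (length ys) (drop (length xs) ws)) # drop (length xs + length ys) ws)))) d"
        unfolding len ws_eq[symmetric] by simp
    qed
    then have "SC c (\<lambda>c1 c2. SP c2 L (\<lambda>ws d. tens (scA D) (scC D) (on_list (m + n - 1) (dia D m n i f g) b c1 ws) d)) =
      SC c (\<lambda>c1 c2. SA c1 (SC c2 (\<lambda>c21 c22. SP c22 xs (\<lambda>us d. ?\<phi> c21 (us @ ?\<gamma> d ys # zs)))) (tens (scA D) (scC D)))"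
      using list_equivariant_comp[OF \<phi> \<gamma> bilin_tens, of c] unfolding L_eq by simp
    also have "\<dots> = SC c (\<lambda>c1 c2. psi D c1 (SC c2 (\<lambda>c21 c22. SP c22 xs (\<lambda>us d. ?\<phi> c21 (us @ ?\<gamma> d ys # zs)))))"
      by (simp add: tensor_spaceD[OF psi_in])
    also have "\<dots> = SC c (\<lambda>c1 c2. psi D c1 (on_list (m + n - 1) (dia D m n i f g) b c2 L))"
      unfolding L_eq by (subst dia_on_list[OF f(1) g(1) len(1,2)]) simp
    finally show "SC c (\<lambda>c1 c2. SP c2 L (\<lambda>us d. tens (scA D) (scC D) (on_list (m + n - 1) (dia D m n i f g) b c1 us) d)) =
      SC c (\<lambda>c1 c2. psi D c1 (on_list (m + n - 1) (dia D m n i f g) b c2 L))" .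
  qed
next
  case False
  then show ?thesis by (simp add: dia_outside zero_equivariant)
qed

section \<open>Relations between insertions\<close>

text \<open>As \<open>h\<close> is inserted to the left of \<open>g\<close>, a copy of
  \<open>c\<close> passes the value of \<open>h\<close> on its way to \<open>g\<close>. Equivariance
  of \<open>h\<close> enters here, through \<open>list_parallel\<close>.\<close>

lemma dia_before:
  assumes f: "f \<in> cochains D m" and g: "g \<in> cochains D n" and h: "h \<in> cochains D p" "equivariant D p h"
    and ji: "j < i"
  shows "dia D (m + n - 1) p j (dia D m n i f g) h = dia D (m + p - 1) n (i + p - 1) (dia D m p j f h) g"
proof (cases "i < m")
  case i: True
  \<comment> \<open>Since \<open>j < i < m\<close> implies \<open>m \<ge> 2\<close>, the truncated
    subtractions are harmless.\<close>
  have deg: "m + n - 1 + p - 1 = m + n + p - 2" "m + p - 1 + n - 1 = m + n + p - 2"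
    using i ji by auto
  show ?thesis
  proof (rule cochain_eqI)
    show "dia D (m + n - 1) p j (dia D m n i f g) h \<in> cochains D (m + n + p - 2)"
      using dia_cochain[OF dia_cochain[OF f g] h(1)] deg by simp
    show "dia D (m + p - 1) n (i + p - 1) (dia D m p j f h) g \<in> cochains D (m + n + p - 2)"
      using dia_cochain[OF dia_cochain[OF f h(1)] g] deg by simp
    fix b c and L :: "'a list" assume L: "length L = m + n + p - 2"
    define xs ys zs1 ys2 zs2 where "xs = take j L" and "ys = take p (drop j L)"
      and "zs1 = take (i - j - 1) (drop (j + p) L)" and "ys2 = take n (drop (i + p - 1) L)"
      and "zs2 = drop (i + p - 1 + n) L"
    have "drop (j + p) L = zs1 @ drop (i - j - 1) (drop (j + p) L)"
      by (simp only: zs1_def append_take_drop_id)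
    also have "drop (i - j - 1) (drop (j + p) L) = drop (i + p - 1) L"
      using ji by (simp add: add.commute)
    also have "\<dots> = ys2 @ zs2"
      by (simp add: ys2_def zs2_def drop_drop[symmetric] add.commute[of _ n] del: drop_drop)
    finally have "L = xs @ ys @ zs1 @ ys2 @ zs2"
      using append_take_drop_id[of j L] append_take_drop_id[of p "drop j L"]
      by (simp add: xs_def ys_def add.commute)
    note L_eq = this
    have len: "length xs = j" "length ys = p" "length zs1 = i - j - 1" "length ys2 = n"
      using L i ji by (auto simp: xs_def ys_def zs1_def ys2_def)
    let ?\<phi> = "on_list m f (blocks (block_start p j \<circ> block_start n i) b)"
    let ?\<gamma> = "on_list n g (blocks ((+) (i + p - 1)) b)"
    let ?\<eta> = "on_list p h (blocks ((+) j) b)"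
    \<comment> \<open>Both orders of insertion lead to the same starting points of blocks for each
      of the three cochains.\<close>
    have \<phi>: "on_list m f (blocks (block_start n i) (blocks (block_start p j) b)) = ?\<phi>"
      by (simp add: blocks_blocks mono_block_start)
    have \<phi>': "on_list m f (blocks (block_start p j) (blocks (block_start n (i + p - 1)) b)) = ?\<phi>"
      unfolding blocks_blocks[OF mono_block_start]
      using ji by (intro on_list_blocks_cong[OF f]) (auto simp: block_start_def)
    have \<gamma>: "on_list n g (blocks ((+) i) (blocks (block_start p j) b)) = ?\<gamma>"
      unfolding blocks_blocks[OF mono_block_start]
      using ji by (intro on_list_blocks_cong[OF g]) (auto simp: block_start_def)
    have \<eta>: "on_list p h (blocks ((+) j) (blocks (block_start n (i + p - 1)) b)) = ?\<eta>"
      unfolding blocks_blocks[OF mono_block_start]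
      using ji by (intro on_list_blocks_cong[OF h(1)]) (auto simp: block_start_def)
    have "on_list (m + n + p - 2) (dia D (m + n - 1) p j (dia D m n i f g) h) b c L =
        SC c (\<lambda>c1 c2. SP c2 xs (\<lambda>us d. on_list (m + n - 1) (dia D m n i f g) (blocks (block_start p j) b) c1
          (us @ ?\<eta> d ys # zs1 @ ys2 @ zs2)))"
      using dia_on_list[OF dia_cochain[OF f g] h(1) len(1,2), of i b c "zs1 @ ys2 @ zs2"] deg
      by (simp add: L_eq)
    also have "\<dots> = SC c (\<lambda>c1 c2. SP c2 xs (\<lambda>us d. SC c1 (\<lambda>c11 c12.
      SP c12 (us @ ?\<eta> d ys # zs1) (\<lambda>vs e. ?\<phi> c11 (vs @ ?\<gamma> e ys2 # zs2)))))"
    proof -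
      have "on_list (m + n - 1) (dia D m n i f g) (blocks (block_start p j) b) c1 (us @ ?\<eta> d ys # zs1 @ ys2 @ zs2) =
          SC c1 (\<lambda>c11 c12. SP c12 (us @ ?\<eta> d ys # zs1) (\<lambda>vs e. ?\<phi> c11 (vs @ ?\<gamma> e ys2 # zs2)))"
        if "length us = length xs" for us d c1
        using dia_on_list[OF f g, of "us @ ?\<eta> d ys # zs1" i ys2 "blocks (block_start p j) b" c1 zs2] that len ji
        unfolding \<phi> \<gamma> by simp
      then have "SP c2 xs (\<lambda>us d. on_list (m + n - 1) (dia D m n i f g) (blocks (block_start p j) b) c1
          (us @ ?\<eta> d ys # zs1 @ ys2 @ zs2)) = SP c2 xs (\<lambda>us d. SC c1 (\<lambda>c11 c12.
          SP c12 (us @ ?\<eta> d ys # zs1) (\<lambda>vs e. ?\<phi> c11 (vs @ ?\<gamma> e ys2 # zs2))))" for c1 c2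
        by (intro pass_list_cong)
      then show ?thesis by simp
    qed
    also have "\<dots> = SC c (\<lambda>c1 c2. SP c2 xs (\<lambda>us d. SP d ys (\<lambda>ys' d'. SP d' zs1 (\<lambda>zs1' d''.
      SC c1 (\<lambda>c11 c12. SP c12 us (\<lambda>vs e. ?\<phi> c11 (vs @ ?\<eta> e ys' # zs1' @ ?\<gamma> d'' ys2 # zs2)))))))"
      using f g h len by (intro list_parallel) (simp_all add: multicochain_on_list equivariant_iff)
    also have "\<dots> = SC c (\<lambda>c1 c2. SP c2 (xs @ ys @ zs1) (\<lambda>ws d.
        on_list (m + p - 1) (dia D m p j f h) (blocks (block_start n (i + p - 1)) b) c1 (ws @ ?\<gamma> d ys2 # zs2)))"
    proof -
      have "SC c1 (\<lambda>c11 c12. SP c12 us (\<lambda>vs e. ?\<phi> c11 (vs @ ?\<eta> e ys' # zs1' @ ?\<gamma> d ys2 # zs2))) =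
          on_list (m + p - 1) (dia D m p j f h) (blocks (block_start n (i + p - 1)) b) c1 ((us @ ys' @ zs1') @ ?\<gamma> d ys2 # zs2)"
        if "length us = length xs" "length ys' = length ys" for us ys' zs1' d c1
        using dia_on_list[OF f h(1), of us j ys' "blocks (block_start n (i + p - 1)) b" c1 "zs1' @ ?\<gamma> d ys2 # zs2"] that len
        unfolding \<phi>' \<eta> by simp
      then have "SP c2 xs (\<lambda>us d. SP d ys (\<lambda>ys' d'. SP d' zs1 (\<lambda>zs1' d''.
          SC c1 (\<lambda>c11 c12. SP c12 us (\<lambda>vs e. ?\<phi> c11 (vs @ ?\<eta> e ys' # zs1' @ ?\<gamma> d'' ys2 # zs2)))))) =
        SP c2 (xs @ ys @ zs1) (\<lambda>ws d.
          on_list (m + p - 1) (dia D m p j f h) (blocks (block_start n (i + p - 1)) b) c1 (ws @ ?\<gamma> d ys2 # zs2))" for c1 c2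
        unfolding pass_list_append by (intro pass_list_cong) blast
      then show ?thesis by simp
    qed
    also have "\<dots> = on_list (m + n + p - 2) (dia D (m + p - 1) n (i + p - 1) (dia D m p j f h) g) b c L"
      using dia_on_list[OF dia_cochain[OF f h(1)] g, of "xs @ ys @ zs1" "i + p - 1" ys2 j b c zs2] deg len ji
      by (simp add: L_eq)
    finally show "on_list (m + n + p - 2) (dia D (m + n - 1) p j (dia D m n i f g) h) b c L =
      on_list (m + n + p - 2) (dia D (m + p - 1) n (i + p - 1) (dia D m p j f h) g) b c L" .
  qed
next
  case False
  then show ?thesis by (simp add: dia_outside dia_zero_left)
qed

lemma dia_inside:
  assumes f: "f \<in> cochains D m" and g: "g \<in> cochains D n" and h: "h \<in> cochains D p"
    and ij: "i \<le> j" "j < n + i" and i: "i < m"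
  shows "dia D (m + n - 1) p j (dia D m n i f g) h = dia D m (n + p - 1) i f (dia D n p (j - i) g h)"
proof (rule cochain_eqI)
  have deg: "m + n - 1 + p - 1 = m + n + p - 2" "m + (n + p - 1) - 1 = m + n + p - 2"
    using i ij by auto
  show "dia D (m + n - 1) p j (dia D m n i f g) h \<in> cochains D (m + n + p - 2)"
    using dia_cochain[OF dia_cochain[OF f g] h] deg by simp
  show "dia D m (n + p - 1) i f (dia D n p (j - i) g h) \<in> cochains D (m + n + p - 2)"
    using dia_cochain[OF f dia_cochain[OF g h]] deg by simp
  fix b c and L :: "'a list" assume L: "length L = m + n + p - 2"
  define xs xs2 ys zs zs2 where "xs = take i L" and "xs2 = take (j - i) (drop i L)"
    and "ys = take p (drop j L)" and "zs = take (n + i - j - 1) (drop (j + p) L)"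
    and "zs2 = drop (i + n + p - 1) L"
  have "drop (j + p) L = zs @ drop (n + i - j - 1) (drop (j + p) L)"
    by (simp only: zs_def append_take_drop_id)
  also have "drop (n + i - j - 1) (drop (j + p) L) = zs2"
    using ij by (simp add: zs2_def add_ac)
  finally have "drop j L = ys @ zs @ zs2"
    using append_take_drop_id[of p "drop j L"] by (simp add: ys_def add.commute)
  then have L_eq: "L = xs @ xs2 @ ys @ zs @ zs2"
    using ij append_take_drop_id[of i L] append_take_drop_id[of "j - i" "drop i L"]
    by (simp add: xs_def xs2_def)
  have len: "length xs = i" "length xs2 = j - i" "length ys = p" "length zs = n + i - j - 1"
    using L i ij by (auto simp: xs_def xs2_def ys_def zs_def)
  let ?\<phi> = "on_list m f (blocks (block_start (n + p - 1) i) b)"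
  let ?\<gamma> = "on_list n g (blocks (block_start p (j - i)) (blocks ((+) i) b))"
  let ?\<eta> = "on_list p h (blocks ((+) j) b)"
  have m: "mono ((+) i)" for i :: nat by (simp add: mono_def)
  \<comment> \<open>An insertion of \<open>h\<close> within the block of \<open>g\<close> enlarges
    this block from \<open>n\<close> to \<open>n + p - 1\<close> indices.\<close>
  have \<phi>: "on_list m f (blocks (block_start n i) (blocks (block_start p j) b)) = ?\<phi>"
    unfolding blocks_blocks[OF mono_block_start]
    using ij by (intro on_list_blocks_cong[OF f]) (auto simp: block_start_def)
  have \<gamma>: "on_list n g (blocks ((+) i) (blocks (block_start p j) b)) = ?\<gamma>"
    unfolding blocks_blocks[OF mono_block_start] blocks_blocks[OF m]
    using ij by (intro on_list_blocks_cong[OF g]) (auto simp: block_start_def)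
  have \<eta>: "on_list p h (blocks ((+) (j - i)) (blocks ((+) i) b)) = ?\<eta>"
    unfolding blocks_blocks[OF m]
    using ij by (intro on_list_blocks_cong[OF h]) auto
  have "on_list (m + n + p - 2) (dia D (m + n - 1) p j (dia D m n i f g) h) b c L =
      SC c (\<lambda>c1 c2. SP c2 (xs @ xs2) (\<lambda>ws d. on_list (m + n - 1) (dia D m n i f g) (blocks (block_start p j) b) c1
        (ws @ ?\<eta> d ys # zs @ zs2)))"
    using dia_on_list[OF dia_cochain[OF f g] h, of "xs @ xs2" j ys i b c "zs @ zs2"] deg len ij
    by (simp add: L_eq)
  also have "\<dots> = SC c (\<lambda>c1 c2. SP c2 xs (\<lambda>us d. SP d xs2 (\<lambda>us2 d2. SC c1 (\<lambda>c11 c12.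
      SP c12 us (\<lambda>vs e. ?\<phi> c11 (vs @ ?\<gamma> e (us2 @ ?\<eta> d2 ys # zs) # zs2))))))"
  proof -
    have "on_list (m + n - 1) (dia D m n i f g) (blocks (block_start p j) b) c1 ((us @ us2) @ ?\<eta> d ys # zs @ zs2) =
        SC c1 (\<lambda>c11 c12. SP c12 us (\<lambda>vs e. ?\<phi> c11 (vs @ ?\<gamma> e (us2 @ ?\<eta> d ys # zs) # zs2)))"
      if "length us = length xs" "length us2 = length xs2" for us us2 d c1
      using dia_on_list[OF f g, of us i "us2 @ ?\<eta> d ys # zs" "blocks (block_start p j) b" c1 zs2] that len ij
      unfolding \<phi> \<gamma> by simp
    then have "SP c2 (xs @ xs2) (\<lambda>ws d. on_list (m + n - 1) (dia D m n i f g) (blocks (block_start p j) b) c1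
        (ws @ ?\<eta> d ys # zs @ zs2)) = SP c2 xs (\<lambda>us d. SP d xs2 (\<lambda>us2 d2. SC c1 (\<lambda>c11 c12.
        SP c12 us (\<lambda>vs e. ?\<phi> c11 (vs @ ?\<gamma> e (us2 @ ?\<eta> d2 ys # zs) # zs2)))))" for c1 c2
      unfolding pass_list_append by (intro pass_list_cong)
    then show ?thesis by simp
  qed
  also have "\<dots> = SC c (\<lambda>c1 c2. SP c2 xs (\<lambda>us d. ?\<phi> c1 (us @ SC d (\<lambda>d1 d2. SP d2 xs2 (\<lambda>us2 e.
      ?\<gamma> d1 (us2 @ ?\<eta> e ys # zs))) # zs2)))"
    using f g h by (intro list_inside multicochain_on_list)
  also have "\<dots> = SC c (\<lambda>c1 c2. SP c2 xs (\<lambda>us d. ?\<phi> c1 (us @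
      on_list (n + p - 1) (dia D n p (j - i) g h) (blocks ((+) i) b) d (xs2 @ ys @ zs) # zs2)))"
    using dia_on_list[OF g h len(2,3), of "blocks ((+) i) b" _ zs] unfolding \<eta> by simp
  also have "\<dots> = on_list (m + n + p - 2) (dia D m (n + p - 1) i f (dia D n p (j - i) g h)) b c L"
    using dia_on_list[OF f dia_cochain[OF g h], of xs i "xs2 @ ys @ zs" "j - i" b c zs2] deg len ij
    by (simp add: L_eq)
  finally show "on_list (m + n + p - 2) (dia D (m + n - 1) p j (dia D m n i f g) h) b c L =
    on_list (m + n + p - 2) (dia D m (n + p - 1) i f (dia D n p (j - i) g h)) b c L" .
qed

section \<open>The equivariant complex\<close>

lemma linear_mult_left: "Vector_Spaces.linear q (scA D) g \<Longrightarrow> Vector_Spaces.linear q (scA D) (\<lambda>p. y * g p)"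
  by (rule linear_comp[of _ _ g]) (auto simp: linear_iff_add_scale distrib_left A.scale_mult_right)

lemma linear_mult_right: "Vector_Spaces.linear q (scA D) g \<Longrightarrow> Vector_Spaces.linear q (scA D) (\<lambda>p. g p * y)"
  by (rule linear_comp[of _ _ g]) (auto simp: linear_iff_add_scale distrib_right A.scale_mult_left)

lemma linear_scale: "vector_space u \<Longrightarrow> Vector_Spaces.linear u u (u l)"
  by (auto simp: linear_iff_add_scale vector_space_def mult.commute)

lemma linear_scale_comp: "Vector_Spaces.linear q u g \<Longrightarrow> Vector_Spaces.linear q u (\<lambda>p. u l (g p))"
  by (rule linear_comp[of _ _ g, OF _ linear_scale]) (auto simp: linear_iff_add_scale)

section \<open>The element \<alpha> and the differential\<close>

lemma alpha_cochain: "alpha D \<in> cochains D 2"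
  unfolding cochains_def
proof (intro CollectI conjI allI ballI impI)
  show "Vector_Spaces.linear (scC D) (scA D) (\<lambda>c. alpha D c a b)" for a b
    using C.counit_linear by (simp add: alpha_def linear_iff_add_scale A.scale_left_distrib)
  show "Vector_Spaces.linear (scA D) (scA D) (\<lambda>x. alpha D c (a(i := x)) b)" if "i \<in> {1..2}" for c a b i
  proof -
    have "i = 1 \<or> i = 2" using that by auto
    then show ?thesis
      by (auto simp: alpha_def intro!: linear_scale_comp linear_mult_left linear_mult_right linear_id)
  qed
  show "Vector_Spaces.linear (scB D) (scA D) (\<lambda>y. alpha D c a (b(i := (b i)(j := y))))"
    if "1 \<le> i \<and> i < j \<and> j \<le> 2" for c a b i j
  proof -
    have "i = 1 \<and> j = 2" using that by auto
    then show ?thesis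
      by (auto simp: alpha_def intro!: linear_scale_comp linear_mult_right zeta_linear)
  qed
qed (simp add: alpha_def)

lemma alpha_on_list: "on_list 2 (alpha D) b c [x, y] = scA D (counit D c) (zeta D (b 1 2) * x * y)"
  by (simp add: on_list_def alpha_def subst_diag_def)

text \<open>Both sides equal \<psi> at \<open>c\<close> and the product \<open>z * x * y\<close>,
  where \<open>z\<close> comes from \<open>B\<close>. On the left the counit removes
  \<open>c1\<close>, and multiplicativity of \<psi> together with \<open>psi_zeta\<close>
  reassembles the product; on the right the counit removes \<open>c2\<close>.\<close>

lemma alpha_equivariant: "equivariant D 2 (alpha D)"
  unfolding equivariant_iff[OF alpha_cochain] list_equivariant_def
proof (intro allI impI)
  fix b :: "nat \<Rightarrow> nat \<Rightarrow> 'b" and c and xs :: "'a list" assume "length xs = 2"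
  then obtain x y where xs: "xs = [x, y]"
    by (metis (no_types, lifting) One_nat_def Suc_1 length_0_conv length_Suc_conv)
  define z where "z = zeta D (b 1 2)"
  define T where "T = tens (scA D) (scC D)"
  define K where "K c = SA c x (\<lambda>x' d. SA d y (\<lambda>y' e. T (z * x' * y') e))" for c
  have T: "bilin (scA D) (scC D) scale_tensor T"
    unfolding T_def by (rule bilin_tens) simp_all
  have vt: "vector_space (scale_tensor :: 'k \<Rightarrow> ('k, 'a, 'c) tensor \<Rightarrow> ('k, 'a, 'c) tensor)"
    using T by (rule bilin_target)
  note rules = linear_rules linear_mult_left linear_mult_right bilin_arg1[OF T] bilin_arg2[OF T] vt
  have K: "Vector_Spaces.linear (scC D) scale_tensor K"
    unfolding K_def by (intro rules)
  have T_scale: "T (scA D l v) e = scale_tensor l (T v e)" for l v e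
    using T by (auto simp: bilin_def linear_iff_add_scale)
  have scale_out: "SA c2 x (\<lambda>x' d. SA d y (\<lambda>y' e. scale_tensor l (T (z * x' * y') e))) = scale_tensor l (K c2)"
    for l c2
    unfolding K_def linear_tensor_lift[OF linear_scale[OF vt]] ..
  have "SC c (\<lambda>c1 c2. SP c2 xs (\<lambda>us d. T (on_list 2 (alpha D) b c1 us) d)) =
      SC c (\<lambda>c1 c2. scale_tensor (counit D c1) (K c2))"
    by (simp add: xs alpha_on_list z_def[symmetric] T_scale scale_out del: One_nat_def)
  also have "\<dots> = K c"
    by (rule SC_counit_left[OF K])
  also have "\<dots> = psi D c (z * x * y)"
  proof -
    have "psi D c (z * x * y) = SA c (z * x * y) T"
      by (simp add: T_def tensor_spaceD[OF psi_in])
    also have "\<dots> = SA c (z * x) (\<lambda>p d. SA d y (\<lambda>y' e. T (p * y') e))"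
      by (rule psi_mult_lift[OF T])
    also have "\<dots> = SA c z (\<lambda>z' d0. SA d0 x (\<lambda>x' d. SA d y (\<lambda>y' e. T (z' * x' * y') e)))"
      by (rule psi_mult_lift[where u = scale_tensor], unfold bilin_def) (intro conjI allI rules)+
    also have "\<dots> = K c"
      unfolding z_def K_def
      by (rule psi_zeta_lift[where u = scale_tensor], unfold bilin_def) (intro conjI allI rules)+
    finally show ?thesis ..
  qed
  also have "\<dots> = SC c (\<lambda>c1 c2. scale_tensor (counit D c2) (psi D c1 (z * x * y)))"
    using psi_bilin by (intro SC_counit_right[symmetric]) (simp add: bilin_def)
  also have "\<dots> = SC c (\<lambda>c1 c2. psi D c1 (on_list 2 (alpha D) b c2 xs))"
    using psi_bilin by (simp add: xs alpha_on_list z_def bilin_def linear_iff_add_scale)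
  finally show "SC c (\<lambda>c1 c2. SP c2 xs (\<lambda>us d. tens (scA D) (scC D) (on_list 2 (alpha D) b c1 us) d)) =
      SC c (\<lambda>c1 c2. psi D c1 (on_list 2 (alpha D) b c2 xs))"
    by (simp only: T_def)
qed

text \<open>The differential consists of insertions into \<open>\<alpha>\<close> and insertions of
  \<open>\<alpha>\<close>; this one is its first summand, in which \<open>c\<close> passes the first
  diagonal entry.\<close>

lemma dia_alpha_1:
  assumes f: "f \<in> cochains D n"
  shows "dia D 2 n 1 (alpha D) f c a b =
    SA c (a 1) (\<lambda>x d. zeta D (\<Prod>j\<in>{2..n + 1}. b 1 j) * x * f d (shift_diag 1 a) (shift_off 1 b))"
proof -
  let ?z = "zeta D (\<Prod>j\<in>{2..n + 1}. b 1 j)" and ?f = "\<lambda>d. f d (shift_diag 1 a) (shift_off 1 b)"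
  have f': "Vector_Spaces.linear (scC D) (scA D) ?f" using f by (simp add: cochains_def)
  note rules = linear_rules linear_mult_left linear_mult_right f' linear_comp[OF _ f']
  have pi: "(\<Prod>t\<in>{Suc (Suc 0)..Suc n}. b (Suc 0) t) = (\<Prod>j\<in>{2..n + 1}. b 1 j)"
    by (simp add: numeral_2_eq_2)
  have "dia D 2 n 1 (alpha D) f c a b =
      SC c (\<lambda>c1 c2. SA c2 (a 1) (\<lambda>x d. scA D (counit D c1) (?z * x * ?f d)))"
    by (simp add: dia_def alpha_def insert_diag_def insert_off_def pi numeral_2_eq_2)
  also have "\<dots> = SC c (\<lambda>c1 c2. scA D (counit D c1) (SA c2 (a 1) (\<lambda>x d. ?z * x * ?f d)))"
    unfolding linear_tensor_lift[OF linear_scale[OF vector_spaces(1)]] ..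
  also have "\<dots> = SA c (a 1) (\<lambda>x d. ?z * x * ?f d)"
    by (rule SC_counit_left) (intro rules)
  finally show ?thesis .
qed

lemma dia_alpha_0:
  assumes f: "f \<in> cochains D n"
  shows "dia D 2 n 0 (alpha D) f c a b = zeta D (\<Prod>r\<in>{1..n}. b r (n + 1)) * f c a b * a (n + 1)"
proof -
  let ?z = "zeta D (\<Prod>r\<in>{1..n}. b r (n + 1))"
  have f': "Vector_Spaces.linear (scC D) (scA D) (\<lambda>c. f c a b)" using f by (simp add: cochains_def)
  have "dia D 2 n 0 (alpha D) f c a b = SC c (\<lambda>c1 c2. scA D (counit D c1) (?z * f c2 a b * a (n + 1)))"
    by (simp add: dia_def alpha_def insert_diag_def insert_off_def shift_diag_def shift_off_def)
  also have "\<dots> = ?z * f c a b * a (n + 1)"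
    by (rule SC_counit_left) (intro linear_mult_left linear_mult_right f')
  finally show ?thesis .
qed

lemma pass_list_counit:
  assumes "multilinear u G"
  shows "SP c xs (\<lambda>us d. u (counit D d) (G us)) = u (counit D c) (G xs)"
  using assms
proof (induction xs arbitrary: c G)
  case (Cons x xs)
  have "SP c (x # xs) (\<lambda>us d. u (counit D d) (G us)) =
      SA c x (\<lambda>x' c'. u (counit D c') (G (x' # xs)))"
    using Cons.IH[OF multilinear_append[OF Cons.prems, of "[_]"]] by simp
  also have "\<dots> = u (counit D c) (G (x # xs))"
    by (intro SA_counit multilinear_slot[OF Cons.prems] linear_slotI linear_id vector_spaces)
  finally show ?case .
qed simp

text \<open>The value of \<open>\<alpha>\<close> contains the counit, which cancels the effect of
  passing \<open>c\<close> past the earlier entries. Slots are counted from 0 and indices from 1, so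
  merging \<open>i\<close> with \<open>i + 1\<close> is insertion into slot
  \<open>i - 1\<close>.\<close>

lemma dia_alpha_merge:
  assumes f: "f \<in> cochains D n" and i: "1 \<le> i" "i \<le> n"
  shows "dia D n 2 (i - 1) f (alpha D) c a b = f c (merge_diag (zeta D) i a b) (merge_off i b)"
proof -
  let ?Y = "zeta D (b i (i + 1)) * a i * a (i + 1)"
  let ?xs = "map a [1..<Suc (i - 1)]" and ?zs = "map a [Suc (i - 1 + 2)..<n + 2]"
  let ?f = "on_list n f (blocks (block_start 2 (i - 1)) b)"
  note mf = multicochain_on_list[OF f]
  note rules = linear_rules multicochain_arg[OF mf] multicochain_slot[OF mf]
  have upt: "[Suc (i - 1)..<Suc (i - 1 + 2)] = [i, i + 1]"
    using i by (simp add: upt_rec)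
  have al: "on_list 2 (alpha D) (blocks ((+) (i - 1)) b) d (map a [Suc (i - 1)..<Suc (i - 1 + 2)]) =
      scA D (counit D d) ?Y" for d
    unfolding upt using i by (simp add: alpha_on_list blocks_shift shift_off_def)
  have scale: "?f c1 (us @ scA D l ?Y # ?zs) = scA D l (?f c1 (us @ ?Y # ?zs))" for c1 us l
  proof -
    have "Vector_Spaces.linear (scA D) (scA D) (\<lambda>x. ?f c1 (us @ x # ?zs))" by (intro rules)
    then show ?thesis by (simp add: linear_iff_add_scale)
  qed
  have "dia D n 2 (i - 1) f (alpha D) c a b =
      SC c (\<lambda>c1 c2. SP c2 ?xs (\<lambda>us d. scA D (counit D d) (?f c1 (us @ ?Y # ?zs))))"
    using i by (subst dia_eq[OF f alpha_cochain]) (simp, simp only: al scale)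
  also have "\<dots> = SC c (\<lambda>c1 c2. scA D (counit D c2) (?f c1 (?xs @ ?Y # ?zs)))"
    by (subst pass_list_counit) (intro rules refl)+
  also have "\<dots> = ?f c (?xs @ ?Y # ?zs)"
    by (rule SC_counit_right) (intro rules)
  also have "\<dots> = f c (merge_diag (zeta D) i a b) (merge_off i b)"
  proof (rule on_list_eq[OF f, symmetric])
    show "length (?xs @ ?Y # ?zs) = n" using i by (simp del: upt_Suc)
    show "merge_diag (zeta D) i a b p = (?xs @ ?Y # ?zs) ! (p - 1)" if "1 \<le> p" "p \<le> n" for p
      using i that by (auto simp: merge_diag_def nth_append nth_Cons' simp del: upt_Suc
          intro!: arg_cong[where f = a])
    show "merge_off i b r s = blocks (block_start 2 (i - 1)) b r s" if "1 \<le> r" "r < s" "s \<le> n" for r s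
    proof -
      have "{i - 1 + 1..i - 1 + 2} = {i, i + 1}" using i by auto
      then show ?thesis
        using i that unfolding insert_off_eq_blocks[OF that(2), symmetric]
        by (auto simp: merge_off_def insert_off_def)
    qed
  qed
  finally show ?thesis .
qed

lemma sum_apply: "(sum F I) x = (\<Sum>i\<in>I. F i x)" for F :: "'i \<Rightarrow> 'p \<Rightarrow> 'q::comm_monoid_add"
  by (induction I rule: infinite_finite_induct) simp_all

lemma sgn_act_apply: "(sgn_act e F) x = sgn_act e (F x)" for F :: "'p \<Rightarrow> 'q::ab_group_add"
  by (simp add: sgn_act_def)

lemma differential_eq:
  assumes f: "f \<in> cochains D n"
  shows "differential D n f = dia D 2 n 1 (alpha D) f
    + (\<Sum>i\<in>{1..n}. sgn_act (int i) (dia D n 2 (i - 1) f (alpha D)))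
    + sgn_act (int n + 1) (dia D 2 n 0 (alpha D) f)"
proof (intro ext)
  fix c a b
  show "differential D n f c a b = (dia D 2 n 1 (alpha D) f
    + (\<Sum>i\<in>{1..n}. sgn_act (int i) (dia D n 2 (i - 1) f (alpha D)))
    + sgn_act (int n + 1) (dia D 2 n 0 (alpha D) f)) c a b"
    by (simp add: differential_def sum_apply sgn_act_apply dia_alpha_0[OF f] dia_alpha_1[OF f]
        dia_alpha_merge[OF f] del: One_nat_def)
qed

text \<open>This is associativity of \<open>A\<close>. Centrality of \<zeta> and commutativity of
  \<open>B\<close> collect the off-diagonal factors, which are the same three on both sides.\<close>

lemma dia_alpha_alpha: "dia D 2 2 0 (alpha D) (alpha D) = dia D 2 2 1 (alpha D) (alpha D)"
proof (intro ext)
  fix c and a :: "nat \<Rightarrow> 'a" and b :: "nat \<Rightarrow> nat \<Rightarrow> 'b"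
  have pi: "(\<Prod>r\<in>{1..2}. b r (2 + 1)) = b 1 3 * b 2 3" "(\<Prod>j\<in>{2..2 + 1}. b 1 j) = b 1 2 * b 1 3"
    by (simp_all add: numeral_2_eq_2 numeral_3_eq_3 atLeastAtMostSuc_conv mult.commute)
  have "dia D 2 2 1 (alpha D) (alpha D) c a b = SA c (a 1) (\<lambda>x d. scA D (counit D d)
      (zeta D (b 1 2 * b 1 3) * x * (zeta D (b 2 3) * a 2 * a 3)))"
    unfolding dia_alpha_1[OF alpha_cochain] pi
    by (simp add: alpha_def shift_diag_def shift_off_def A.scale_mult_right numeral_2_eq_2 numeral_3_eq_3)
  also have "\<dots> = scA D (counit D c) (zeta D (b 1 2 * b 1 3) * a 1 * (zeta D (b 2 3) * a 2 * a 3))"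
    by (intro SA_counit linear_mult_left linear_mult_right linear_id vector_spaces)
  also have "zeta D (b 1 2 * b 1 3) * a 1 * (zeta D (b 2 3) * a 2 * a 3) =
      zeta D (b 1 3 * b 2 3) * (zeta D (b 1 2) * a 1 * a 2) * a 3"
  proof -
    have "zeta D (b 1 2 * b 1 3) * a 1 * (zeta D (b 2 3) * a 2 * a 3) =
        zeta D (b 1 2 * b 1 3) * (a 1 * zeta D (b 2 3)) * a 2 * a 3"
      by (simp only: mult.assoc)
    also have "a 1 * zeta D (b 2 3) = zeta D (b 2 3) * a 1"
      by (rule zeta_central[symmetric])
    also have "zeta D (b 1 2 * b 1 3) * (zeta D (b 2 3) * a 1) * a 2 * a 3 =
        zeta D (b 1 2 * b 1 3 * b 2 3) * a 1 * a 2 * a 3"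
      by (simp only: mult.assoc zeta_mult)
    also have "b 1 2 * b 1 3 * b 2 3 = b 1 3 * b 2 3 * b 1 2"
      by (simp only: mult_ac)
    also have "zeta D (b 1 3 * b 2 3 * b 1 2) * a 1 * a 2 * a 3 =
        zeta D (b 1 3 * b 2 3) * (zeta D (b 1 2) * a 1 * a 2) * a 3"
      by (simp only: mult.assoc zeta_mult)
    finally show ?thesis .
  qed
  also have "scA D (counit D c) (zeta D (b 1 3 * b 2 3) * (zeta D (b 1 2) * a 1 * a 2) * a 3) =
      dia D 2 2 0 (alpha D) (alpha D) c a b"
    unfolding dia_alpha_0[OF alpha_cochain] pi
    by (simp add: alpha_def A.scale_mult_right A.scale_mult_left numeral_2_eq_2 numeral_3_eq_3)
  finally show "dia D 2 2 0 (alpha D) (alpha D) c a b = dia D 2 2 1 (alpha D) (alpha D) c a b" ..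
qed

section \<open>Coincidence of the cup products\<close>

lemma cup_eq_sqcup:
  assumes f: "f \<in> cochains D m" "equivariant D m f" and g: "g \<in> cochains D n"
  shows "cup D m n f g = sqcup D m n f g"
proof (intro ext)
  fix c a b
  let ?z = "zeta D (\<Prod>r\<in>{1..m}. \<Prod>s\<in>{m + 1..m + n}. b r s)"
  let ?g = "\<lambda>d. g d (shift_diag m a) (shift_off m b)"
  define F where "F x d = ?z * x * ?g d" for x d
  have F_eq: "F = (\<lambda>x d. ?z * x * ?g d)" by (intro ext F_def)
  have g': "Vector_Spaces.linear (scC D) (scA D) ?g" using g by (simp add: cochains_def)
  have F: "bilin (scA D) (scC D) (scA D) F"
    unfolding bilin_def F_def by (intro conjI allI linear_mult_left linear_mult_right linear_id vector_spaces g')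
  have "f c1 (subst_diag a us) b = on_list m f b c1 us" if "length us = length (map a [1..<Suc m])" for c1 us
    using that by (intro on_list_eq[OF f(1)]) (auto simp: subst_diag_def simp del: upt_Suc)
  then have "SP c2 (map a [1..<Suc m]) (\<lambda>us d. F (f c1 (subst_diag a us) b) d) =
      SP c2 (map a [1..<Suc m]) (\<lambda>us d. F (on_list m f b c1 us) d)" for c1 c2
    by (intro pass_list_cong) simp
  then have "cup D m n f g c a b = SC c (\<lambda>c1 c2. SP c2 (map a [1..<Suc m]) (\<lambda>us d. F (on_list m f b c1 us) d))"
    by (simp add: cup_def pass_eq_pass_list F_def del: upt_Suc)
  also have "\<dots> = SC c (\<lambda>c1 c2. SA c1 (on_list m f b c2 (map a [1..<Suc m])) F)"
    using f by (intro list_equivariant_lift[OF _ F]) (simp_all add: equivariant_iff del: upt_Suc)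
  also have "\<dots> = sqcup D m n f g c a b"
    by (simp only: on_list_map[OF f(1)] sqcup_def F_eq)
  finally show "cup D m n f g c a b = sqcup D m n f g c a b" .
qed

section \<open>Equivariant cochains as a graded vector space\<close>

abbreviation scale_cochain :: "'k \<Rightarrow> ('a, 'b, 'c) cochain \<Rightarrow> ('a, 'b, 'c) cochain"
  where "scale_cochain \<equiv> \<lambda>l f c a b. scA D l (f c a b)"

lemma vector_space_cochain: "vector_space scale_cochain"
  by unfold_locales (auto simp: fun_eq_iff A.scale_right_distrib A.scale_left_distrib)

lemma cochain_linear:
  assumes "f \<in> cochains D n"
  shows "Vector_Spaces.linear (scC D) (scA D) (\<lambda>c. f c a b)"
    and "i \<in> {1..n} \<Longrightarrow> Vector_Spaces.linear (scA D) (scA D) (\<lambda>x. f c (a(i := x)) b)"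
    and "1 \<le> i \<and> i < j \<and> j \<le> n \<Longrightarrow> Vector_Spaces.linear (scB D) (scA D) (\<lambda>y. f c a (b(i := (b i)(j := y))))"
  using assms by (simp_all add: cochains_def)

lemma cochain_add:
  assumes f: "f \<in> cochains D n" and g: "g \<in> cochains D n"
  shows "f + g \<in> cochains D n"
  unfolding cochains_def plus_fun_apply
proof (intro CollectI conjI allI ballI impI)
  fix c and a a' :: "nat \<Rightarrow> 'a" and b b' :: "nat \<Rightarrow> nat \<Rightarrow> 'b"
  assume ab: "(\<forall>i\<in>{1..n}. a i = a' i) \<and> (\<forall>i j. 1 \<le> i \<and> i < j \<and> j \<le> n \<longrightarrow> b i j = b' i j)"
  have "f c a b = f c a' b'" "g c a b = g c a' b'"
    using ab by (intro cochain_cong[OF f] cochain_cong[OF g]; simp)+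
  then show "f c a b + g c a b = f c a' b' + g c a' b'" by simp
qed (intro linear_add_fun cochain_linear[OF f] cochain_linear[OF g]; assumption)+

lemma cochain_scale:
  assumes f: "f \<in> cochains D n"
  shows "scale_cochain l f \<in> cochains D n"
  unfolding cochains_def
proof (intro CollectI conjI allI ballI impI)
  fix c and a a' :: "nat \<Rightarrow> 'a" and b b' :: "nat \<Rightarrow> nat \<Rightarrow> 'b"
  assume ab: "(\<forall>i\<in>{1..n}. a i = a' i) \<and> (\<forall>i j. 1 \<le> i \<and> i < j \<and> j \<le> n \<longrightarrow> b i j = b' i j)"
  have "f c a b = f c a' b'"
    using ab by (intro cochain_cong[OF f]; simp)
  then show "scA D l (f c a b) = scA D l (f c a' b')" by simp
qed (intro linear_scale_comp cochain_linear[OF f]; assumption)+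

lemma equivariant_add:
  assumes "equivariant D n f" "equivariant D n g"
  shows "equivariant D n (f + g)"
proof -
  have T: "tens (scA D) (scC D) (x + y) = (\<lambda>d. tens (scA D) (scC D) x d + tens (scA D) (scC D) y d)" for x y
    using bilin_tens[OF vector_spaces(1,3)] by (intro ext) (simp only: bilin_def linear_iff_add_scale)
  have fg: "(f + g) c a b = f c a b + g c a b" for c a b
    by simp
  have psi: "psi D c (x + y) = psi D c x + psi D c y" for c x y
    using psi_bilin by (simp add: bilin_def linear_iff_add_scale)
  show ?thesis
    using assms unfolding equivariant_def pass_eq_pass_list fg T psi tensor_lift_add pass_list_add
    by (simp only: simp_thms)
qed

lemma equivariant_scale:
  assumes "equivariant D n f"
  shows "equivariant D n (scale_cochain l f)"
proof -
  have bT: "bilin (scA D) (scC D) scale_tensor (tens (scA D) (scC D))"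
    by (rule bilin_tens) simp_all
  have T: "tens (scA D) (scC D) (scA D l x) d = scale_tensor l (tens (scA D) (scC D) x d)" for x d
    using bT by (simp add: bilin_def linear_iff_add_scale)
  have psi: "psi D c (scA D l x) = scale_tensor l (psi D c x)" for c x
    using psi_bilin by (simp add: bilin_def linear_iff_add_scale)
  note L = linear_scale[OF bilin_target[OF bT], of l]
  show ?thesis
    using assms unfolding equivariant_def pass_eq_pass_list T psi
      linear_pass_list_out[OF L, symmetric] linear_tensor_lift[OF L, symmetric]
    by simp
qed

lemma equivariant_cochainsD:
  assumes "f \<in> E n"
  shows "f \<in> cochains D (nat n)" "equivariant D (nat n) f"
  using assms zero_cochain zero_equivariant by (auto simp: equivariant_cochains_def split: if_splits)

lemma equivariant_cochainsI:
  "0 \<le> n \<Longrightarrow> f \<in> cochains D (nat n) \<Longrightarrow> equivariant D (nat n) f \<Longrightarrow> f \<in> E n"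
  by (simp add: equivariant_cochains_def)

lemma equivariant_cochains_neg: "n < 0 \<Longrightarrow> E n = {0}"
  by (simp add: equivariant_cochains_def)

lemma zero_equivariant_cochains: "0 \<in> E n"
  by (simp add: equivariant_cochains_def zero_cochain zero_equivariant)

lemma subspace_equivariant_cochains:
  "Modules.module.subspace scale_cochain (E n)"
proof -
  interpret V: vector_space scale_cochain by (rule vector_space_cochain)
  have z: "scale_cochain l 0 = 0" for l by (auto simp: fun_eq_iff)
  show ?thesis
    unfolding V.subspace_def
    using zero_equivariant_cochains[of n] z
    by (auto simp: equivariant_cochains_def cochain_add cochain_scale equivariant_add equivariant_scale)
qed

text \<open>As \<open>f\<close> is applied last, additivity in \<open>f\<close> holds for arbitrary
  functions; additivity in \<open>g\<close> rests on multilinearity of \<open>f\<close>.\<close>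

lemma dia_add_left: "dia D m n i (f + f') g = dia D m n i f g + dia D m n i f' g"
proof (intro ext)
  fix c a b
  show "dia D m n i (f + f') g c a b = (dia D m n i f g + dia D m n i f' g) c a b"
    by (simp add: dia_def pass_eq_pass_list tensor_lift_add pass_list_add del: upt_Suc)
qed

lemma dia_scale_left: "dia D m n i (scale_cochain l f) g = scale_cochain l (dia D m n i f g)"
proof (intro ext)
  fix c a b
  note L = linear_scale[OF vector_spaces(1), of l]
  show "dia D m n i (scale_cochain l f) g c a b = scale_cochain l (dia D m n i f g) c a b"
    by (simp add: dia_def pass_eq_pass_list linear_pass_list_out[OF L] linear_tensor_lift[OF L] del: upt_Suc)
qed

lemma dia_add_right:
  assumes f: "f \<in> cochains D m" and g: "g \<in> cochains D n" "g' \<in> cochains D n"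
  shows "dia D m n i f (g + g') = dia D m n i f g + dia D m n i f g'"
proof (cases "i < m")
  case i: True
  have L: "on_list m f B c (us @ (x + y) # zs) = on_list m f B c (us @ x # zs) + on_list m f B c (us @ y # zs)"
    for B c us x y zs
    using multicochain_on_list[OF f, of B] by (simp add: multicochain_def multilinear_def linear_iff_add_scale)
  have g': "on_list n (g + g') B d ys = on_list n g B d ys + on_list n g' B d ys" for B d ys
    by (simp add: on_list_def)
  show ?thesis
    by (intro ext) (simp only: dia_eq[OF f _ i] g cochain_add plus_fun_apply g' L pass_list_add tensor_lift_add)
qed (simp add: dia_outside)

lemma dia_scale_right:
  assumes f: "f \<in> cochains D m" and g: "g \<in> cochains D n"
  shows "dia D m n i f (scale_cochain l g) = scale_cochain l (dia D m n i f g)"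
proof (cases "i < m")
  case i: True
  have L: "on_list m f B c (us @ scA D l x # zs) = scA D l (on_list m f B c (us @ x # zs))" for B c us x zs
    using multicochain_on_list[OF f, of B] by (simp add: multicochain_def multilinear_def linear_iff_add_scale)
  have g': "on_list n (scale_cochain l g) B d ys = scA D l (on_list n g B d ys)" for B d ys
    by (simp add: on_list_def)
  note out = linear_scale[OF vector_spaces(1), of l]
  show ?thesis
    by (intro ext) (simp only: dia_eq[OF f _ i] g cochain_scale g' L
        linear_pass_list_out[OF out, symmetric] linear_tensor_lift[OF out, symmetric])
qed (simp add: dia_outside fun_eq_iff)

lemma dia_zero_right: "f \<in> cochains D m \<Longrightarrow> dia D m n i f 0 = 0"
  using dia_add_right[of f m 0 n 0 i] zero_cochain by simp

lemma dia_equivariant_cochains: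
  assumes f: "f \<in> E m" and g: "g \<in> E n"
  shows "dia D (nat m) (nat n) i f g \<in> E (m + n - 1)"
proof (cases "m \<le> 0 \<or> n < 0")
  \<comment> \<open>The truncated degrees need not match \<open>m + n - 1\<close> here, but the
    insertion is 0: either \<open>f\<close> has no slot or \<open>g\<close> vanishes.\<close>
  case True
  then have "dia D (nat m) (nat n) i f g = 0"
    using f g dia_zero_right[OF equivariant_cochainsD(1)[OF f]]
    by (auto simp: dia_outside equivariant_cochains_neg)
  then show ?thesis by (simp add: zero_equivariant_cochains)
next
  case False
  then have "nat (m + n - 1) = nat m + nat n - 1" by auto
  then show ?thesis
    using False dia_cochain[OF equivariant_cochainsD(1)[OF f] equivariant_cochainsD(1)[OF g], of i]
      dia_equivariant[OF equivariant_cochainsD[OF f] equivariant_cochainsD[OF g], of i]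
    by (intro equivariant_cochainsI) simp_all
qed

lemma alpha_equivariant_cochains: "alpha D \<in> E 2"
  by (rule equivariant_cochainsI) (simp_all add: alpha_cochain alpha_equivariant)

lemma dia_inside_all:
  assumes "f \<in> cochains D m" "g \<in> cochains D n" "h \<in> cochains D p" "i \<le> j" "j < n + i"
  shows "dia D (m + n - 1) p j (dia D m n i f g) h = dia D m (n + p - 1) i f (dia D n p (j - i) g h)"
  using dia_inside[OF assms] by (cases "i < m") (simp_all add: dia_outside dia_zero_left)

lemma equivariant_module_eq: "equivariant_module D n = vmod scale_cochain (E n)"
  by (simp add: equivariant_module_def vmod_def)

section \<open>The right comp algebra\<close>

lemma right_comp_algebra_equivariant:
  "right_comp_algebra field_ring (equivariant_module D) (comp_op D) (alpha D)"
proof (intro right_comp_algebra.intro graded_vector_space.intro right_comp_algebra_axioms.intro)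
  interpret V: vector_space scale_cochain by (rule vector_space_cochain)
  show "Ring.field field_ring" by (rule field_field_ring)
  show "Module.module field_ring (equivariant_module D n)" for n
    unfolding equivariant_module_eq by (rule V.module_vmod[OF subspace_equivariant_cochains])
  show "carrier (equivariant_module D n) = {\<zero>\<^bsub>equivariant_module D n\<^esub>}" if "n < 0" for n
    using that by (simp add: equivariant_module_eq equivariant_cochains_neg)
  show "alpha D \<in> carrier (equivariant_module D 2)"
    by (simp add: equivariant_module_eq alpha_equivariant_cochains)
  show "module_bilinear field_ring (equivariant_module D m) (equivariant_module D n)
      (equivariant_module D (m + n - 1)) (comp_op D m n i)" for m n i
    unfolding module_bilinear_def equivariant_module_eq comp_op_def vmod_simps
    by (intro conjI ballI dia_equivariant_cochains dia_add_left dia_add_right dia_scale_left dia_scale_right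
        equivariant_cochainsD)
  show "comp_op D m n i f g = \<zero>\<^bsub>equivariant_module D (m + n - 1)\<^esub>" if "m - 1 < int i" for m n i f g
    using that by (simp add: comp_op_def equivariant_module_eq dia_outside)
  have deg: "nat (int m + int n - 1) = m + n - 1" for m n by auto
  fix m n p i j :: nat and f g h
  assume "f \<in> carrier (equivariant_module D (int m))" "g \<in> carrier (equivariant_module D (int n))"
    "h \<in> carrier (equivariant_module D (int p))"
  then have f: "f \<in> cochains D m" "equivariant D m f" and g: "g \<in> cochains D n" "equivariant D n g"
    and h: "h \<in> cochains D p" "equivariant D p h"
    using equivariant_cochainsD[of _ "int _"] by (auto simp: equivariant_module_eq)
  show "comp_op D (int m + int n - 1) (int p) j (comp_op D (int m) (int n) i f g) h =
      comp_op D (int m + int p - 1) (int n) (i + p - 1) (comp_op D (int m) (int p) j f h) g" if "j < i"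
    using dia_before[OF f(1) g(1) h that] by (simp add: comp_op_def deg)
  show "comp_op D (int m + int n - 1) (int p) j (comp_op D (int m) (int n) i f g) h =
      comp_op D (int m) (int n + int p - 1) i f (comp_op D (int n) (int p) (j - i) g h)" if "i \<le> j" "j < n + i"
    using dia_inside_all[OF f(1) g(1) h(1) that] by (simp add: comp_op_def deg)
  show "comp_op D (int m + int n - 1) (int p) j (comp_op D (int m) (int n) i f g) h =
      comp_op D (int m + int p - 1) (int n) i (comp_op D (int m) (int p) (j + 1 - n) f h) g" if "n + i \<le> j"
  proof -
    \<comment> \<open>This relation is \<open>dia_before\<close> read backwards, with the roles of
      \<open>g\<close> and \<open>h\<close> exchanged and \<open>i\<close> as the smaller slot; it
      uses equivariance of \<open>g\<close>.\<close>
    have "j + 1 - n + n - 1 = j" "i < j + 1 - n" using that by auto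
    then show ?thesis
      using dia_before[OF f(1) h(1) g, of i "j + 1 - n"] by (simp add: comp_op_def deg)
  qed
next
  show "comp_op D 2 2 0 (alpha D) (alpha D) = comp_op D 2 2 1 (alpha D) (alpha D)"
    using dia_alpha_alpha by (simp add: comp_op_def)
qed

section \<open>Passage to suspended degrees\<close>

text \<open>Slots are integers here, so that \<open>i + z\<close> with \<open>z = -1\<close>
  involves no truncation; negative slots give 0.\<close>

definition signed_dia :: "int \<Rightarrow> int \<Rightarrow> int \<Rightarrow> ('a, 'b, 'c) cochain \<Rightarrow> ('a, 'b, 'c) cochain \<Rightarrow> ('a, 'b, 'c) cochain"
  where "signed_dia x y i f g =
    (if i < 0 then 0 else sgn_act (i * y) (dia D (nat (x + 1)) (nat (y + 1)) (nat i) f g))"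

lemma dia_sgn_left: "dia D m n i (sgn_act e f) g = sgn_act e (dia D m n i f g)"
proof -
  have "dia D m n i (- f) g = - dia D m n i f g"
    using dia_add_left[of m n i f "- f" g] by (simp add: dia_zero_left add_eq_0_iff)
  then show ?thesis by (simp add: sgn_act_def)
qed

lemma dia_sgn_right:
  assumes f: "f \<in> cochains D m" and g: "g \<in> cochains D n"
  shows "dia D m n i f (sgn_act e g) = sgn_act e (dia D m n i f g)"
proof -
  have "- g = scale_cochain (- 1) g" by (simp add: fun_eq_iff)
  then have "dia D m n i f (- g) = - dia D m n i f g"
    by (simp only: dia_scale_right[OF f g]) (simp add: fun_eq_iff)
  then show ?thesis by (simp add: sgn_act_def)
qed

lemma suspended_comp_algebra_equivariant:
  "suspended_comp_algebra scale_cochain (\<lambda>x. E (x + 1)) signed_dia (alpha D)"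
proof (intro suspended_comp_algebra.intro suspended_comp_algebra_axioms.intro vector_space_cochain
    subspace_equivariant_cochains)
  interpret V: vector_space scale_cochain by (rule vector_space_cochain)
  have sgn: "sgn_act e f \<in> E n" if "f \<in> E n" for e f n
    using that V.subspace_neg[OF subspace_equivariant_cochains] by (simp add: sgn_act_def)
  have sgn_scale: "sgn_act e (scale_cochain l f) = scale_cochain l (sgn_act e f)" for e l f
    by (auto simp: sgn_act_def fun_eq_iff)
  show "E (x + 1) = {0}" if "x < -1" for x
    using that by (simp add: equivariant_cochains_neg)
  show "alpha D \<in> E (1 + 1)"
    using alpha_equivariant_cochains by simp
  show "signed_dia 1 1 0 (alpha D) (alpha D) + signed_dia 1 1 1 (alpha D) (alpha D) = 0"
    using dia_alpha_alpha by (simp add: signed_dia_def sgn_act_def numeral_2_eq_2)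
  fix x y z i j :: int and f f' g g' h l
  assume f: "f \<in> E (x + 1)" and g: "g \<in> E (y + 1)"
  have deg: "x + 1 + (y + 1) - 1 = x + y + 1" by simp
  note cf = equivariant_cochainsD[OF f] and cg = equivariant_cochainsD[OF g]
  show "signed_dia x y i f g \<in> E (x + y + 1)"
    using dia_equivariant_cochains[OF f g, unfolded deg]
    by (simp add: signed_dia_def sgn zero_equivariant_cochains)
  show "signed_dia x y i (f + f') g = signed_dia x y i f g + signed_dia x y i f' g"
    by (simp add: signed_dia_def dia_add_left sgn_act_add)
  show "signed_dia x y i f (g + g') = signed_dia x y i f g + signed_dia x y i f g'"
    if "g' \<in> E (y + 1)"
    using equivariant_cochainsD[OF that] by (simp add: signed_dia_def dia_add_right cf cg sgn_act_add)
  show "signed_dia x y i (scale_cochain l f) g = scale_cochain l (signed_dia x y i f g)"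
    by (simp add: signed_dia_def dia_scale_left sgn_scale fun_eq_iff)
  show "signed_dia x y i f (scale_cochain l g) = scale_cochain l (signed_dia x y i f g)"
    by (simp add: signed_dia_def dia_scale_right cf cg sgn_scale fun_eq_iff)
  show "signed_dia x y i f g = 0" if "i < 0 \<or> x < i"
    using that by (auto simp: signed_dia_def dia_outside)
  assume h: "h \<in> E (z + 1)"
  note ch = equivariant_cochainsD[OF h]
  show "signed_dia (x + y) z j (signed_dia x y i f g) h =
      sgn_act (y * z) (signed_dia (x + z) y (i + z) (signed_dia x z j f h) g)" if ji: "j < i"
  proof (cases "0 \<le> j \<and> -1 \<le> x \<and> -1 \<le> y \<and> -1 \<le> z")
    case True
    have n: "nat (x + y + 1) = nat (x + 1) + nat (y + 1) - 1" "nat (x + z + 1) = nat (x + 1) + nat (z + 1) - 1"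
      "nat (i + z) = nat i + nat (z + 1) - 1" "nat j < nat i"
      using True ji by auto
    have "signed_dia (x + y) z j (signed_dia x y i f g) h = sgn_act (j * z + i * y)
        (dia D (nat (x + 1) + nat (y + 1) - 1) (nat (z + 1)) (nat j) (dia D (nat (x + 1)) (nat (y + 1)) (nat i) f g) h)"
      using True ji by (simp add: signed_dia_def dia_sgn_left sgn_act_sgn_act n(1))
    also have "\<dots> = sgn_act (j * z + i * y)
        (dia D (nat (x + 1) + nat (z + 1) - 1) (nat (y + 1)) (nat i + nat (z + 1) - 1)
          (dia D (nat (x + 1)) (nat (z + 1)) (nat j) f h) g)"
      by (simp only: dia_before[OF cf(1) cg(1) ch n(4)])
    \<comment> \<open>The signs agree because \<open>(i + z) * y + y * z\<close> and
      \<open>i * y\<close> have the same parity.\<close>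
    also have "\<dots> = sgn_act (y * z) (signed_dia (x + z) y (i + z) (signed_dia x z j f h) g)"
      using True ji by (simp add: signed_dia_def dia_sgn_left sgn_act_sgn_act n(2,3))
        (cases "even i"; cases "even j"; cases "even y"; cases "even z"; simp add: sgn_act_def)
    finally show ?thesis .
  next
    case False
    then consider "j < 0" | "f = 0" | "g = 0" | "h = 0"
      using f g h equivariant_cochains_neg[of "x + 1"] equivariant_cochains_neg[of "y + 1"]
        equivariant_cochains_neg[of "z + 1"] by force
    then show ?thesis
    proof cases
      case 3
      have "dia D (nat (x + z + 1)) (nat (y + 1)) k (dia D (nat (x + 1)) (nat (z + 1)) (nat j) f h) 0 = 0" for k
        using equivariant_cochainsD(1)[OF dia_equivariant_cochains[OF f h]]
        by (intro dia_zero_right) (simp add: add.commute add.left_commute)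
      then show ?thesis using 3 by (simp add: signed_dia_def dia_zero_right cf dia_zero_left dia_sgn_left)
    next
      case 4
      have "dia D (nat (x + y + 1)) (nat (z + 1)) k (dia D (nat (x + 1)) (nat (y + 1)) (nat i) f g) 0 = 0" for k
        using equivariant_cochainsD(1)[OF dia_equivariant_cochains[OF f g]]
        by (intro dia_zero_right) (simp add: add.commute add.left_commute)
      then show ?thesis using 4 by (simp add: signed_dia_def dia_zero_right cf dia_zero_left dia_sgn_left)
    qed (simp_all add: signed_dia_def dia_zero_left)
  qed
  show "signed_dia (x + y) z (i + j) (signed_dia x y i f g) h = signed_dia x (y + z) i f (signed_dia y z j g h)"
    if j: "0 \<le> j" "j \<le> y"
  proof (cases "0 \<le> i \<and> i \<le> x \<and> -1 \<le> z")
    case True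
    have n: "nat (x + y + 1) = nat (x + 1) + nat (y + 1) - 1" "nat (y + z + 1) = nat (y + 1) + nat (z + 1) - 1"
      "nat (i + j) - nat i = nat j" "nat i \<le> nat (i + j)" "nat (i + j) < nat (y + 1) + nat i"
      using True j by auto
    have "signed_dia (x + y) z (i + j) (signed_dia x y i f g) h = sgn_act ((i + j) * z + i * y)
        (dia D (nat (x + 1) + nat (y + 1) - 1) (nat (z + 1)) (nat (i + j)) (dia D (nat (x + 1)) (nat (y + 1)) (nat i) f g) h)"
      using True j by (simp add: signed_dia_def dia_sgn_left sgn_act_sgn_act n(1))
    also have "\<dots> = sgn_act ((i + j) * z + i * y) (dia D (nat (x + 1)) (nat (y + 1) + nat (z + 1) - 1) (nat i) f
        (dia D (nat (y + 1)) (nat (z + 1)) (nat j) g h))"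
      by (simp only: dia_inside_all[OF cf(1) cg(1) ch(1) n(4,5)] n(3))
    also have "\<dots> = signed_dia x (y + z) i f (signed_dia y z j g h)"
      using True j dia_sgn_right[OF cf(1) dia_cochain[OF cg(1) ch(1)]]
      by (simp add: signed_dia_def sgn_act_sgn_act n(2)) (simp add: sgn_act_def algebra_simps)
    finally show ?thesis .
  next
    case False
    then consider "i < 0" | "x < i" "0 \<le> i" | "h = 0"
      using h equivariant_cochains_neg[of "z + 1"] by force
    then show ?thesis
    proof cases
      case 3
      have "dia D (nat (x + y + 1)) (nat (z + 1)) k (dia D (nat (x + 1)) (nat (y + 1)) (nat i) f g) 0 = 0" for k
        using equivariant_cochainsD(1)[OF dia_equivariant_cochains[OF f g]]
        by (intro dia_zero_right) (simp add: add.commute add.left_commute)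
      then show ?thesis using 3 by (simp add: signed_dia_def dia_zero_right cf cg dia_zero_left dia_sgn_left)
    qed (use j in \<open>simp_all add: signed_dia_def dia_zero_left dia_outside\<close>)
  qed
qed

section \<open>Comparison with the differential, bracket and cup product of the complex\<close>

interpretation S: suspended_comp_algebra scale_cochain "\<lambda>x. E (x + 1)" signed_dia "alpha D"
  by (rule suspended_comp_algebra_equivariant)

lemma brace1_eq_circ: "S.brace1 (int m - 1) (int n - 1) f g = circ D m n f g"
  unfolding S.brace1_def circ_def
  by (rule sum.reindex_bij_witness[of _ int nat]) (auto simp: signed_dia_def)

lemma lie_eq_bracket: "S.lie (int m - 1) (int n - 1) f g = bracket D m n f g"
  by (simp add: S.lie_def bracket_def brace1_eq_circ)

lemma cupp_eq_comp_cup: "S.cupp (int m - 1) (int n - 1) f g = comp_cup D m n f g"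
proof -
  have n: "nat (int m + 1) = m + 1" by simp
  show ?thesis
    unfolding S.cupp_def S.brace2_al
    by (simp add: signed_dia_def sgn_act_sgn_act comp_cup_def n) (simp add: sgn_act_def numeral_2_eq_2 n)
qed

text \<open>Since \<open>\<alpha>\<close> has suspended degree 1, its insertion into slot
  \<open>i - 1\<close> carries the sign with exponent \<open>i - 1\<close>, whereas the differential
  has exponent \<open>i\<close>. The two outer summands change sign in the same way.\<close>

lemma dlt_eq_differential:
  assumes "f \<in> cochains D n"
  shows "S.dlt (int n - 1) f = - differential D n f"
proof -
  have "S.dlt (int n - 1) f = circ D n 2 f (alpha D) - sgn_act (int n - 1) (circ D 2 n (alpha D) f)"
    using brace1_eq_circ[of n 2 f "alpha D"] brace1_eq_circ[of 2 n "alpha D" f] by (simp add: S.dlt_def S.lie_def)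
  moreover have "circ D 2 n (alpha D) f = dia D 2 n 0 (alpha D) f + sgn_act (int n - 1) (dia D 2 n 1 (alpha D) f)"
    by (simp add: circ_def numeral_2_eq_2 sgn_act_def)
  moreover have "circ D n 2 f (alpha D) = - (\<Sum>i\<in>{1..n}. sgn_act (int i) (dia D n 2 (i - 1) f (alpha D)))"
  proof -
    have "(\<Sum>i\<in>{1..n}. sgn_act (int i) (dia D n 2 (i - 1) f (alpha D))) =
        (\<Sum>i<n. sgn_act (int (Suc i)) (dia D n 2 i f (alpha D)))"
      by (rule sum.reindex_bij_witness[of _ Suc "\<lambda>i. i - 1"]) auto
    then show ?thesis
      unfolding circ_def by (simp only: sum_negf[symmetric]) (rule sum.cong, auto simp: sgn_act_def)
  qed
  ultimately show ?thesis
    by (simp add: differential_eq[OF assms] sgn_act_def)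
qed

lemma cyc_eq_cocycles: "S.cyc n = cocycles D n"
proof (cases "0 \<le> n")
  case True
  then obtain N where N: "n = int N" using nonneg_int_cases by blast
  have "S.dlt (int N - 1) f = 0 \<longleftrightarrow> differential D N f = 0" if "f \<in> E (int N)" for f
    using dlt_eq_differential[of f N] equivariant_cochainsD(1)[OF that] by simp
  then show ?thesis
    by (auto simp: S.cyc_def cocycles_def N)
next
  case False
  then show ?thesis
    using S.subspace_0[OF S.subspace_cyc[of n]]
    by (auto simp: S.cyc_def cocycles_def equivariant_cochains_neg)
qed

text \<open>The sign between \<open>S.dlt\<close> and the differential disappears in the image,
  because the cochains are closed under negation.\<close>

lemma bdr_eq_coboundaries: "S.bdr n = coboundaries D n"
proof (cases "1 \<le> n")
  case True
  define N where "N = nat (n - 1)"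
  have N: "n = int N + 1" using True by (simp add: N_def)
  have neg: "- f \<in> E (int N)" if "f \<in> E (int N)" for f
    using that S.W_neg[of f "int N - 1"] by simp
  have d: "S.dlt (int N - 1) f = differential D N (- f)" "S.dlt (int N - 1) (- f) = differential D N f"
    if f: "f \<in> E (int N)" for f
  proof -
    have 1: "S.dlt (int N - 1) (- f) = - S.dlt (int N - 1) f"
      using S.dlt_linear(3)[of f "int N - 1"] f by simp
    have 2: "S.dlt (int N - 1) f = - differential D N f" "S.dlt (int N - 1) (- f) = - differential D N (- f)"
      using equivariant_cochainsD(1)[OF f] equivariant_cochainsD(1)[OF neg[OF f]]
      by (simp_all add: dlt_eq_differential)
    show "S.dlt (int N - 1) f = differential D N (- f)"
      using 1 unfolding 2(2) by simp
    show "S.dlt (int N - 1) (- f) = differential D N f"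
      unfolding 1 2(1) by simp
  qed
  have "S.bdr n = S.dlt (int N - 1) ` E (int N)"
    by (simp add: S.bdr_def N)
  also have "\<dots> = differential D N ` E (int N)"
  proof (intro equalityI subsetI)
    fix h assume "h \<in> S.dlt (int N - 1) ` E (int N)"
    then obtain f where "f \<in> E (int N)" "h = S.dlt (int N - 1) f" by (rule imageE)
    then show "h \<in> differential D N ` E (int N)"
      by (intro image_eqI[of _ _ "- f"]) (simp_all only: d neg minus_minus)
  next
    fix h assume "h \<in> differential D N ` E (int N)"
    then obtain f where "f \<in> E (int N)" "h = differential D N f" by (rule imageE)
    then show "h \<in> S.dlt (int N - 1) ` E (int N)"
      by (intro image_eqI[of _ _ "- f"]) (simp_all only: d neg minus_minus)
  qed
  also have "\<dots> = coboundaries D n"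
    by (simp add: coboundaries_def N)
  finally show ?thesis .
next
  case False
  then have "n - 2 + 1 < 0" by simp
  moreover have "S.dlt (n - 2) 0 = 0"
    using S.dlt_linear(1)[OF S.W_zero S.W_zero, of "n - 2"] by simp
  ultimately show ?thesis
    using False by (simp add: S.bdr_def coboundaries_def equivariant_cochains_neg)
qed

lemma coh_eq_cohomology: "S.coh n = cohomology D n"
  by (simp add: S.coh_def cohomology_def cyc_eq_cocycles bdr_eq_coboundaries equivariant_module_eq)

lemma cls_eq_cohomology_class: "S.cls n f = cohomology_class D n f"
  by (simp add: S.cls_def cohomology_class_def bdr_eq_coboundaries equivariant_module_eq)

lemma gerstenhaber_algebra_cohomology:
  "\<exists>cupH brH.
    (\<forall>m n :: nat. \<forall>f \<in> cocycles D (int m). \<forall>g \<in> cocycles D (int n).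
       cupH (int m) (int n) (cohomology_class D (int m) f) (cohomology_class D (int n) g) =
         cohomology_class D (int m + int n) (comp_cup D m n f g) \<and>
       brH (int m) (int n) (cohomology_class D (int m) f) (cohomology_class D (int n) g) =
         cohomology_class D (int m + int n - 1) (bracket D m n f g)) \<and>
    gerstenhaber_algebra field_ring (cohomology D) cupH brH"
proof -
  have "S.coh = cohomology D" by (rule ext) (rule coh_eq_cohomology)
  then obtain cupH brH where
    H: "\<And>m n f g. f \<in> cocycles D m \<Longrightarrow> g \<in> cocycles D n \<Longrightarrow>
      cupH m n (cohomology_class D m f) (cohomology_class D n g) =
        cohomology_class D (m + n) (S.cupp (m - 1) (n - 1) f g) \<and>
      brH m n (cohomology_class D m f) (cohomology_class D n g) =
        cohomology_class D (m + n - 1) (S.lie (m - 1) (n - 1) f g)"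
    and G: "gerstenhaber_algebra field_ring (cohomology D) cupH brH"
    using S.gerstenhaber_cohomology unfolding cyc_eq_cocycles cls_eq_cohomology_class by metis
  have "cupH (int m) (int n) (cohomology_class D (int m) f) (cohomology_class D (int n) g) =
        cohomology_class D (int m + int n) (comp_cup D m n f g) \<and>
      brH (int m) (int n) (cohomology_class D (int m) f) (cohomology_class D (int n) g) =
        cohomology_class D (int m + int n - 1) (bracket D m n f g)"
    if "f \<in> cocycles D (int m)" "g \<in> cocycles D (int n)" for m n f g
    using H[OF that] by (simp only: cupp_eq_comp_cup lie_eq_bracket)
  then show ?thesis using G by blast
qed

end

theorem theorem1p2:
  fixes D :: "('k::field, 'a::{ring, monoid_mult}, 'b::{comm_ring, comm_monoid_mult}, 'c::ab_group_add)
              entwining_data"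
  assumes "entwining_structure_over D"
  shows "(\<forall>m n :: nat. \<forall>f \<in> equivariant_cochains D (int m). \<forall>g \<in> equivariant_cochains D (int n).
            cup D m n f g = sqcup D m n f g) \<and>
         right_comp_algebra field_ring (equivariant_module D) (comp_op D) (alpha D) \<and>
         (\<exists>cupH brH.
            (\<forall>m n :: nat. \<forall>f \<in> cocycles D (int m). \<forall>g \<in> cocycles D (int n).
               cupH (int m) (int n) (cohomology_class D (int m) f) (cohomology_class D (int n) g) =
                 cohomology_class D (int m + int n) (comp_cup D m n f g) \<and>
               brH (int m) (int n) (cohomology_class D (int m) f) (cohomology_class D (int n) g) =
                 cohomology_class D (int m + int n - 1) (bracket D m n f g)) \<and>
            gerstenhaber_algebra field_ring (cohomology D) cupH brH)"
proof -
  interpret entwining_structure_over D by (rule assms)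
  have "cup D m n f g = sqcup D m n f g"
    if "f \<in> equivariant_cochains D (int m)" "g \<in> equivariant_cochains D (int n)" for m n f g
    using equivariant_cochainsD[OF that(1)] equivariant_cochainsD[OF that(2)] by (simp add: cup_eq_sqcup)
  then show ?thesis
    using right_comp_algebra_equivariant gerstenhaber_algebra_cohomology by blast
qed

end
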